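(* Let $\overline\rho>0$, $f\in C^1[0,\overline\rho]$ with $f(0)=0$, $h:=f'$, let $D\in C^1[0,\overline\rho]$ satisfy $D(\rho)>0$ for $\rho\in(0,\overline\rho)$, and let $g\in C[0,\overline\rho]$ satisfy $g(\rho)<0$ for $\rho\in(0,\overline\rho]$ and $g(0)=0$. Then, for every wave speed $c\in\mathbb R$, the equation $$\rho_t+f(\rho)_x=\left(D(\rho)\rho_x\right)_x+g(\rho),\qquad t\ge 0,\ x\in\mathbb R,$$ has a semi-wavefront solution from $0$ with speed $c$, which is unique (up to shifts) in the class of classical or sharp solutions. Moreover, such a solution is strict. Let $\varphi$ be its wave profile. If $D(0)>0$, then $\varphi$ is classical. If $D(0)=0$, then $\varphi$ is sharp (at $0$) if $c<h(0)$ and classical if $c>h(0)$; finally, if $D(0)=0$ and $c=h(0)$, then $\varphi$ is classical if $\dot D(0)>0$, while if $\dot D(0)=0$ it can be either classical or sharp (that is, both behaviours occur for suitable data $f,D,g$ satisfying these hypotheses with $D(0)=\dot D(0)=0$ and $c=h(0)$).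
   Context: A dot denotes differentiation with respect to the state variable ($\rho$ or $\varphi$), a prime on profiles denotes differentiation with respect to $\xi$. Traveling waves. Let $I\subseteq\mathbb R$ be an open interval and $\varphi\colon I\to[0,\overline\rho]$ with $\varphi\in C(I)$ and $D(\varphi)\varphi'\in L^1_{\rm loc}(I)$ (in particular $\varphi$ is differentiable a.e.). The function $\rho(x,t)=\varphi(x-ct)$, defined for $x-ct\in I$, is a traveling-wave solution with wave speed $c$ and wave profile $\varphi$ if $$\int_I\left\{\left(D(\varphi(\xi))\varphi'(\xi)-f(\varphi(\xi))+c\varphi(\xi)\right)\psi'(\xi)-g(\varphi(\xi))\psi(\xi)\right\}d\xi=0\quad\text{for every }\psi\in C_0^\infty(I).$$ It is: global if $I=\mathbb R$; strict if $I\ne\mathbb R$ and $\varphi$ is not extendible to $\mathbb R$; classical if $\varphi$ is differentiable, $D(\varphi)\varphi'$ is absolutely continuous and $(D(\varphi)\varphi')'+(c-h(\varphi))\varphi'+g(\varphi)=0$ holds a.e. in $I$; sharp at $\ell$ if $g(\ell)=0$ and there is $\xi_0\in I$ with $\varphi(\xi_0)=\ell$, $\varphi$ classical in $I\setminus\{\xi_0\}$ and $\varphi$ not differentiable at $\xi_0$. The same terminology is used for profiles. Semi-wavefronts. A traveling-wave solution whose profile $\varphi$ is defined in $(-\infty,\varpi)$, $\varpi\in\mathbb R$, is a semi-wavefront solution from $\ell^-\in[0,\overline\rho]$ if $g(\ell^-)=0$, $\varphi$ is monotonic (in the weak sense) and non-constant, and $\varphi(\xi)\to\ell^-$ as $\xi\to-\infty$.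 For uniqueness, profiles are understood on their maximal interval of definition (a profile is not distinguished from its restrictions to smaller half-lines), and "up to shifts" means up to translations $\xi\mapsto\xi+\xi_1$. *)

theory Defs
  imports "HOL-Analysis.Analysis"
begin

(* C^1 on a closed interval: the derivative at the endpoints is one-sided. *)
definition C1_with_deriv :: "real set \<Rightarrow> (real \<Rightarrow> real) \<Rightarrow> (real \<Rightarrow> real) \<Rightarrow> bool" where
  "C1_with_deriv S u u' \<longleftrightarrow>
     (\<forall>x\<in>S. (u has_real_derivative u' x) (at x within S)) \<and> continuous_on S u'"

(* Standing hypotheses on the equation  rho_t + f(rho)_x = (D(rho) rho_x)_x + g(rho)  on
   [0, R];  h is the derivative of f and D' that of D. *)
definition admissible_data ::
  "real \<Rightarrow> (real \<Rightarrow> real) \<Rightarrow> (real \<Rightarrow> real) \<Rightarrow> (real \<Rightarrow> real) \<Rightarrow> (real \<Rightarrow> real) \<Rightarrow> (real \<Rightarrow> real) \<Rightarrow> bool"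
  where
  "admissible_data R f h D D' g \<longleftrightarrow>
     0 < R \<and>
     C1_with_deriv {0..R} f h \<and> f 0 = 0 \<and>
     C1_with_deriv {0..R} D D' \<and> (\<forall>r\<in>{0<..<R}. 0 < D r) \<and>
     continuous_on {0..R} g \<and> (\<forall>r\<in>{0<..R}. g r < 0) \<and> g 0 = 0"

(* Absolute continuity on every compact subinterval of S. A finite family of non-overlapping
   compact intervals is encoded as a division of its own union. *)
definition locally_abs_cont_on :: "real set \<Rightarrow> (real \<Rightarrow> real) \<Rightarrow> bool" where
  "locally_abs_cont_on S u \<longleftrightarrow>
     (\<forall>a b. {a..b} \<subseteq> S \<longrightarrow>
       (\<forall>\<epsilon>>0. \<exists>\<delta>>0. \<forall>d. d division_of \<Union>d \<and> \<Union>d \<subseteq> {a..b} \<and> (\<Sum>k\<in>d. Sup k - Inf k) < \<delta> \<longrightarrow>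
          (\<Sum>k\<in>d. \<bar>u (Sup k) - u (Inf k)\<bar>) < \<epsilon>))"

definition test_function :: "real set \<Rightarrow> (real \<Rightarrow> real) \<Rightarrow> bool" where
  "test_function I \<psi> \<longleftrightarrow>
     (\<forall>n x. ((deriv ^^ n) \<psi>) differentiable (at x)) \<and>
     compact (closure {x. \<psi> x \<noteq> 0}) \<and> closure {x. \<psi> x \<noteq> 0} \<subseteq> I"

(* The derivative in  D(phi) phi' \<in> L^1_loc  is a weak one: where D(phi) does not vanish, phi
   has to be locally absolutely continuous. With a mere almost-everywhere derivative, continuous
   functions with a singular (Cantor-type) part would be admitted, although the weak equation
   does not control that part. *)
definition tw_profile ::
  "real \<Rightarrow> (real \<Rightarrow> real) \<Rightarrow> (real \<Rightarrow> real) \<Rightarrow> (real \<Rightarrow> real) \<Rightarrow> real \<Rightarrow> real set \<Rightarrow> (real \<Rightarrow> real) \<Rightarrow> bool"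
  where
  "tw_profile R f D g c I \<phi> \<longleftrightarrow>
     open I \<and> is_interval I \<and> I \<noteq> {} \<and>
     \<phi> ` I \<subseteq> {0..R} \<and> continuous_on I \<phi> \<and>
     (AE \<xi> in lebesgue. \<xi> \<in> I \<longrightarrow> \<phi> differentiable (at \<xi>)) \<and>
     locally_abs_cont_on {\<xi>\<in>I. D (\<phi> \<xi>) \<noteq> 0} \<phi> \<and>
     (\<forall>a b. {a..b} \<subseteq> I \<longrightarrow> (\<lambda>\<xi>. D (\<phi> \<xi>) * deriv \<phi> \<xi>) absolutely_integrable_on {a..b}) \<and>
     (\<forall>\<psi>. test_function I \<psi> \<longrightarrow>
        ((\<lambda>\<xi>. (D (\<phi> \<xi>) * deriv \<phi> \<xi> - f (\<phi> \<xi>) + c * \<phi> \<xi>) * deriv \<psi> \<xi> - g (\<phi> \<xi>) * \<psi> \<xi>)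
           has_integral 0) I)"

(* S is an open set, not necessarily an interval. *)
definition classical_on ::
  "(real \<Rightarrow> real) \<Rightarrow> (real \<Rightarrow> real) \<Rightarrow> (real \<Rightarrow> real) \<Rightarrow> real \<Rightarrow> real set \<Rightarrow> (real \<Rightarrow> real) \<Rightarrow> bool"
  where
  "classical_on h D g c S \<phi> \<longleftrightarrow>
     (\<forall>\<xi>\<in>S. \<phi> differentiable (at \<xi>)) \<and>
     locally_abs_cont_on S (\<lambda>\<xi>. D (\<phi> \<xi>) * deriv \<phi> \<xi>) \<and>
     (AE \<xi> in lebesgue. \<xi> \<in> S \<longrightarrow>
        (\<lambda>\<xi>. D (\<phi> \<xi>) * deriv \<phi> \<xi>) differentiable (at \<xi>) \<and>
        deriv (\<lambda>\<xi>. D (\<phi> \<xi>) * deriv \<phi> \<xi>) \<xi> + (c - h (\<phi> \<xi>)) * deriv \<phi> \<xi> + g (\<phi> \<xi>) = 0)"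

definition classical_profile ::
  "real \<Rightarrow> (real \<Rightarrow> real) \<Rightarrow> (real \<Rightarrow> real) \<Rightarrow> (real \<Rightarrow> real) \<Rightarrow> (real \<Rightarrow> real) \<Rightarrow> real \<Rightarrow> real set
     \<Rightarrow> (real \<Rightarrow> real) \<Rightarrow> bool"
  where
  "classical_profile R f h D g c I \<phi> \<longleftrightarrow> tw_profile R f D g c I \<phi> \<and> classical_on h D g c I \<phi>"

definition sharp_profile_at ::
  "real \<Rightarrow> (real \<Rightarrow> real) \<Rightarrow> (real \<Rightarrow> real) \<Rightarrow> (real \<Rightarrow> real) \<Rightarrow> (real \<Rightarrow> real) \<Rightarrow> real \<Rightarrow> real
     \<Rightarrow> real set \<Rightarrow> (real \<Rightarrow> real) \<Rightarrow> bool"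
  where
  "sharp_profile_at R f h D g c l I \<phi> \<longleftrightarrow>
     tw_profile R f D g c I \<phi> \<and> g l = 0 \<and>
     (\<exists>\<xi>0\<in>I. \<phi> \<xi>0 = l \<and> classical_on h D g c (I - {\<xi>0}) \<phi> \<and> \<not> \<phi> differentiable (at \<xi>0))"

definition strict_profile ::
  "real \<Rightarrow> (real \<Rightarrow> real) \<Rightarrow> (real \<Rightarrow> real) \<Rightarrow> (real \<Rightarrow> real) \<Rightarrow> real \<Rightarrow> real set \<Rightarrow> (real \<Rightarrow> real) \<Rightarrow> bool"
  where
  "strict_profile R f D g c I \<phi> \<longleftrightarrow>
     tw_profile R f D g c I \<phi> \<and> I \<noteq> UNIV \<and>
     \<not> (\<exists>\<theta>. tw_profile R f D g c UNIV \<theta> \<and> (\<forall>\<xi>\<in>I. \<theta> \<xi> = \<phi> \<xi>))"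

(* phi is a profile on the half-line (-infinity, w); its values elsewhere are irrelevant. *)
definition semi_wavefront_from ::
  "real \<Rightarrow> (real \<Rightarrow> real) \<Rightarrow> (real \<Rightarrow> real) \<Rightarrow> (real \<Rightarrow> real) \<Rightarrow> real \<Rightarrow> real \<Rightarrow> real \<Rightarrow> (real \<Rightarrow> real) \<Rightarrow> bool"
  where
  "semi_wavefront_from R f D g c l w \<phi> \<longleftrightarrow>
     tw_profile R f D g c {..<w} \<phi> \<and> l \<in> {0..R} \<and> g l = 0 \<and>
     (mono_on {..<w} \<phi> \<or> antimono_on {..<w} \<phi>) \<and> \<not> \<phi> constant_on {..<w} \<and>
     (\<phi> \<longlongrightarrow> l) at_bot"

definition classical_or_sharp ::
  "real \<Rightarrow> (real \<Rightarrow> real) \<Rightarrow> (real \<Rightarrow> real) \<Rightarrow> (real \<Rightarrow> real) \<Rightarrow> (real \<Rightarrow> real) \<Rightarrow> real \<Rightarrow> real set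
     \<Rightarrow> (real \<Rightarrow> real) \<Rightarrow> bool"
  where
  "classical_or_sharp R f h D g c I \<phi> \<longleftrightarrow>
     classical_profile R f h D g c I \<phi> \<or> (\<exists>l. sharp_profile_at R f h D g c l I \<phi>)"

(* Up to a shift, phi1 on (-infinity, w1) is phi on (-infinity, w) or a restriction of it to a
   smaller half-line. *)
definition shifted_restriction_of :: "real \<Rightarrow> (real \<Rightarrow> real) \<Rightarrow> real \<Rightarrow> (real \<Rightarrow> real) \<Rightarrow> bool" where
  "shifted_restriction_of w1 \<phi>1 w \<phi> \<longleftrightarrow> (\<exists>s. w1 + s \<le> w \<and> (\<forall>\<xi><w1. \<phi>1 \<xi> = \<phi> (\<xi> + s)))"

end

theory Submission
  imports Defs "HOL-Complex_Analysis.Great_Picard"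
begin

text \<open>For an increasing profile \<open>\<phi>\<close> the flux \<open>D(\<phi>) \<phi>'\<close> is a function \<open>z(\<phi>)\<close> with
  \<open>z' = h - c - D g / z\<close>, \<open>z 0 = 0\<close> and \<open>z > 0\<close> on \<open>(0, R)\<close>. Conversely, a trajectory \<open>z\<close> gives
  back the profile as the inverse of \<open>T = \<integral> D / z\<close>, extended by 0 if \<open>T\<close> is bounded below. Because
  \<open>g\<close> is negative up to \<open>R\<close>, \<open>T\<close> is bounded above, so the profile ends at a finite \<open>w\<close>, where it
  takes the value \<open>R\<close> and cannot be continued. It is classical if \<open>z / D\<close> tends to 0 at 0, which is
  decided by comparing \<open>z\<close> with multiples of \<open>D\<close>, and sharp if \<open>z / D\<close> stays away from 0. Two
  trajectories coincide since the square of their difference is decreasing and vanishes at 0.\<close>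

section \<open>Calculus on intervals\<close>

text \<open>With \<open>F s = f s - c * s\<close>, the profile equation says that
  \<open>z - F\<close>, read along \<open>\<phi>\<close>, has derivative
  \<open>- g (\<phi> \<xi>)\<close>, and \<open>\<phi>' = z / D\<close> converts derivatives in
  \<open>\<xi>\<close> into derivatives in the state. The price of this reduction is a right-hand
  side that is singular at 0 and possibly at \<open>R\<close>: there only continuity of
  \<open>z\<close> is available. Hence mean value arguments in the open interval, and the use of
  \<open>z - F\<close>, whose derivative contains no \<open>h\<close>, in place of \<open>z\<close>.
  A competing profile is only a weak solution, whose flux is known almost everywhere. Before it can
  be compared with \<open>z\<close>, the weak equation must be upgraded to a continuous flux; the
  test functions are built for this. In the uniqueness part the competitor is differentiable
  wherever it is positive, so its flux is known pointwise there. Strictness has to refute an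
  arbitrary weak extension, differentiable only almost everywhere; this is where the local absolute
  continuity in \<open>tw_profile\<close> enters, through a fundamental theorem of calculus for such
  functions.\<close>

lemma Icc_subset_interval:
  fixes I :: "real set"
  assumes "is_interval I" "a \<in> I" "b \<in> I"
  shows "{a..b} \<subseteq> I"
  using assms unfolding is_interval_1 by (meson atLeastAtMost_iff subsetI)

lemma antiderivative_on_open_interval:
  fixes q :: "real \<Rightarrow> real"
  assumes I: "open I" "is_interval I" and q: "continuous_on I q"
  shows "\<exists>Q. \<forall>x\<in>I. (Q has_real_derivative q x) (at x)"
proof (cases "I = {}")
  case False
  then obtain m where m: "m \<in> I" by auto
  \<comment> \<open>For \<open>x < m\<close> the set \<open>{m..x}\<close> is empty with integral 0,
    so the difference is the oriented integral from \<open>m\<close> to \<open>x\<close>.\<close>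
  define Q where "Q x = integral {m..x} q - integral {x..m} q" for x
  have "(Q has_real_derivative q x) (at x)" if x: "x \<in> I" for x
  proof -
    have "min x m \<in> I" "max x m \<in> I" using x m by (auto simp: min_def max_def)
    then obtain e1 e2 where e12: "e1 > 0" "cball (min x m) e1 \<subseteq> I" "e2 > 0" "cball (max x m) e2 \<subseteq> I"
      using I(1) open_contains_cball by metis
    define e where "e = min e1 e2"
    have e: "e > 0" "cball (min x m) e \<subseteq> I" "cball (max x m) e \<subseteq> I"
      using e12 subset_cball[of e e1 "min x m"] subset_cball[of e e2 "max x m"] by (auto simp: e_def)
    define a b where "a = min x m - e" and "b = max x m + e"
    have "a \<in> I"
      unfolding a_def using e(1) by (intro subsetD[OF e(2)]) (simp add: dist_real_def)
    moreover have "b \<in> I"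
      unfolding b_def using e(1) by (intro subsetD[OF e(3)]) (simp add: dist_real_def)
    ultimately have ab: "{a..b} \<subseteq> I"
      by (intro Icc_subset_interval I(2))
    have xm: "a < x" "x < b" "a < m" "m < b"
      using e(1) unfolding a_def b_def by auto
    have cq: "continuous_on {a..b} q"
      using q ab continuous_on_subset by blast
    have iq: "q integrable_on {u..v}" if "a \<le> u" "v \<le> b" for u v
      by (rule integrable_continuous_real, rule continuous_on_subset[OF cq]) (use that in auto)
    have Q: "Q t = integral {a..t} q - integral {a..m} q" if "t \<in> {a..b}" for t
    proof (cases "m \<le> t")
      case True
      then have "integral {a..m} q + integral {m..t} q = integral {a..t} q"
        using that xm by (intro Henstock_Kurzweil_Integration.integral_combine iq) auto
      moreover have "integral {t..m} q = 0"
        using True by (cases "t = m") auto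
      ultimately show ?thesis by (simp add: Q_def)
    next
      case False
      then have "integral {a..t} q + integral {t..m} q = integral {a..m} q"
        using that xm by (intro Henstock_Kurzweil_Integration.integral_combine iq) auto
      with False show ?thesis by (simp add: Q_def)
    qed
    have "((\<lambda>t. integral {a..t} q - integral {a..m} q) has_real_derivative q x) (at x within {a..b})"
      using integral_has_real_derivative[OF cq, of x] xm
      by (auto intro!: derivative_eq_intros)
    then have "(Q has_real_derivative q x) (at x within {a..b})"
      by (rule has_field_derivative_transform_within[where d=1]) (use xm Q in auto)
    then show ?thesis
      using xm at_within_Icc_at by metis
  qed
  then show ?thesis by blast
qed auto

lemma open_interval_right_of:
  fixes I :: "real set"
  assumes "open I" "x \<in> I"
  obtains y where "x < y" "y \<in> I"
proof -
  obtain e where "e > 0" "cball x e \<subseteq> I" using assms open_contains_cball by blast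
  then show ?thesis by (intro that[of "x + e"] subsetD[of "cball x e" I]) (auto simp: dist_real_def)
qed

lemma open_interval_left_of:
  fixes I :: "real set"
  assumes "open I" "x \<in> I"
  obtains y where "y < x" "y \<in> I"
proof -
  obtain e where "e > 0" "cball x e \<subseteq> I" using assms open_contains_cball by blast
  then show ?thesis by (intro that[of "x - e"] subsetD[of "cball x e" I]) (auto simp: dist_real_def)
qed

text \<open>Splits off an interval with known sign, on which a comparison argument can estimate a
  derivative; the result is then confronted with \<open>q t \<le> 0\<close>. The point is the
  maximum of the compact set where \<open>q\<close> is nonpositive.\<close>

lemma last_nonpos_point:
  fixes q :: "real \<Rightarrow> real"
  assumes q: "continuous_on {a..b} q" and "a \<le> b" "q a \<le> 0" "0 < q b"
  obtains t where "a \<le> t" "t < b" "q t \<le> 0" "\<And>x. t < x \<Longrightarrow> x \<le> b \<Longrightarrow> 0 < q x"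
proof -
  define Z where "Z = {a..b} \<inter> q -` {..0}"
  have "closed Z" unfolding Z_def
    by (rule continuous_closed_preimage[OF q]) auto
  moreover have "bounded Z" unfolding Z_def by (rule bounded_subset[OF bounded_closed_interval[of a b]]) auto
  ultimately have "compact Z" by (simp add: compact_eq_bounded_closed)
  moreover have "a \<in> Z" using assms by (simp add: Z_def)
  ultimately obtain t where t: "t \<in> Z" "\<And>x. x \<in> Z \<Longrightarrow> x \<le> t"
    using compact_attains_sup[of Z] by blast
  show ?thesis
  proof
    show "a \<le> t" "q t \<le> 0" using t(1) by (auto simp: Z_def)
    have "t \<noteq> b" using t(1) assms(4) by (auto simp: Z_def)
    then show "t < b" using t(1) by (auto simp: Z_def)
    fix x assume x: "t < x" "x \<le> b"
    show "0 < q x"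
    proof (rule ccontr)
      assume "\<not> 0 < q x"
      then have "x \<in> Z" using x \<open>a \<le> t\<close> by (auto simp: Z_def)
      with t(2) x show False by fastforce
    qed
  qed
qed

text \<open>The derivative is required only inside the interval, because the phase plane equation
  gives none at 0 and \<open>R\<close>.\<close>

lemma MVT_interior:
  fixes u :: "real \<Rightarrow> real"
  assumes "a < b" "continuous_on {a..b} u"
    and "\<And>x. a < x \<Longrightarrow> x < b \<Longrightarrow> (u has_real_derivative u' x) (at x)"
  obtains x where "a < x" "x < b" "u b - u a = (b - a) * u' x"
proof -
  obtain l x where x: "a < x" "x < b" "DERIV u x :> l" "u b - u a = (b - a) * l"
    using MVT[OF assms(1,2)] assms(3) by (metis real_differentiable_def)
  then have "l = u' x" using DERIV_unique assms(3) by blast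
  with x that show ?thesis by blast
qed

lemma continuous_on_Icc_bounded:
  fixes u :: "real \<Rightarrow> real"
  assumes "continuous_on {a..b} u"
  obtains B where "0 \<le> B" "\<And>s. s \<in> {a..b} \<Longrightarrow> \<bar>u s\<bar> \<le> B"
proof -
  obtain B where "\<forall>x\<in>u ` {a..b}. norm x \<le> B"
    using compact_imp_bounded[OF compact_continuous_image[OF assms compact_Icc]] unfolding bounded_iff by blast
  have "\<bar>u s\<bar> \<le> \<bar>B\<bar>" if "s \<in> {a..b}" for s
    using abs_ge_self[of B] by (metis \<open>\<forall>x\<in>u ` {a..b}. norm x \<le> B\<close> imageI order_trans real_norm_def that)
  then show ?thesis using that[of "\<bar>B\<bar>"] by simp
qed

lemma eq_if_zero_derivative:
  fixes A :: "real \<Rightarrow> real"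
  assumes "\<And>t. x \<le> t \<Longrightarrow> t \<le> y \<Longrightarrow> (A has_real_derivative B t) (at t)"
    and "\<And>t. x < t \<Longrightarrow> t < y \<Longrightarrow> B t = 0" "x \<le> y"
  shows "A x = A y"
proof (cases "x = y")
  case False
  then obtain z where "x < z" "z < y" "A y - A x = (y - x) * B z"
    using MVT2[of x y A B] assms(1,3) by auto
  with assms(2) show ?thesis by simp
qed auto

lemma isCont_eq_if_eq_at_left:
  fixes u v :: "real \<Rightarrow> real"
  assumes "isCont u x" "isCont v x" "a < x" "\<And>t. a < t \<Longrightarrow> t < x \<Longrightarrow> u t = v t"
  shows "u x = v x"
proof (rule tendsto_unique)
  show "(u \<longlongrightarrow> u x) (at_left x)"
    using assms(1) by (simp add: isCont_def filterlim_at_split)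
  have "(v \<longlongrightarrow> v x) (at_left x)"
    using assms(2) by (simp add: isCont_def filterlim_at_split)
  moreover have "eventually (\<lambda>t. v t = u t) (at_left x)"
    unfolding eventually_at_left_field using assms(3,4) by (intro exI[of _ a]) auto
  ultimately show "(u \<longlongrightarrow> v x) (at_left x)" by (rule Lim_transform_eventually)
qed auto

section \<open>Existence for ordinary differential equations\<close>

text \<open>Tonelli's approximation: with a delay the integral equation is solved by finitely many
  Picard steps.\<close>
lemma tonelli_delay:
  fixes F :: "real \<times> real \<Rightarrow> real"
  assumes F: "continuous_on UNIV F" and "\<delta> > 0"
  shows "\<exists>y. continuous_on {0..b} y \<and>
     (\<forall>s\<in>{0..b}. y s = integral {0..s} (\<lambda>t. F (t, if t \<le> \<delta> then 0 else y (t - \<delta>))))"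
proof -
  \<comment> \<open>All iterates vanish at 0, so clamping the delayed time at 0 reproduces the
    default value 0 of the statement and makes continuity of the integrand visible.\<close>
  define S where "S Y s = integral {0..s} (\<lambda>t. F (t, Y (max 0 (t - \<delta>))))" for Y s
  define Y where "Y n = (S ^^ n) (\<lambda>_. 0)" for n
  have Y_Suc: "Y (Suc n) = S (Y n)" for n by (simp add: Y_def)
  have Y0: "Y n 0 = 0" for n
    by (cases n) (auto simp: Y_def S_def)
  have cont: "continuous_on {0..b} (Y n)" if "b \<ge> 0" for n b
  proof (induction n arbitrary: b)
    case 0 then show ?case by (simp add: Y_def)
  next
    case (Suc n)
    have "continuous_on {0..b} (\<lambda>t. Y n (max 0 (t - \<delta>)))"
      by (rule continuous_on_compose2[OF Suc[of "max 0 b"]])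
         (use \<open>\<delta> > 0\<close> in \<open>auto intro!: continuous_intros\<close>)
    then have "continuous_on {0..b} (\<lambda>t. F (t, Y n (max 0 (t - \<delta>))))"
      by (intro continuous_on_compose2[OF F]) (auto intro!: continuous_intros)
    then show ?case
      unfolding Y_Suc S_def
      by (intro indefinite_integral_continuous_1 integrable_continuous_real)
  qed
  \<comment> \<open>The value at \<open>s\<close> involves the previous iterate only up to
    \<open>s - \<delta>\<close>, so each Picard step extends the stabilised range by
    \<open>\<delta>\<close>. Once this range covers \<open>[0, b]\<close>, the iterate solves the
    delayed equation.\<close>
  have stab: "Y (Suc n) s = Y n s" if "0 \<le> s" "s \<le> real n * \<delta>" for n s
    using that
  proof (induction n arbitrary: s)
    case 0 then show ?case by (simp add: Y0)
  next
    case (Suc n)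
    have "Y (Suc n) (max 0 (t - \<delta>)) = Y n (max 0 (t - \<delta>))" if "t \<in> {0..s}" for t
      using Suc.prems Suc.IH[of "max 0 (t - \<delta>)"] that \<open>\<delta> > 0\<close>
      by (cases "t \<le> \<delta>") (auto simp: Y0 algebra_simps)
    then show ?case
      unfolding Y_Suc[of "Suc n"] Y_Suc[of n] S_def
      by (intro integral_cong) (auto simp: Y_Suc S_def)
  qed
  obtain n where n: "b \<le> real n * \<delta>"
    using \<open>\<delta> > 0\<close> reals_Archimedean3 less_imp_le by metis
  show ?thesis
  proof (intro exI[of _ "Y n"] conjI ballI)
    show "continuous_on {0..b} (Y n)"
      using cont[of b n] by (cases "b \<ge> 0") auto
    fix s assume s: "s \<in> {0..b}"
    have "Y n s = S (Y n) s"
      using stab[of s n] s n by (simp add: Y_Suc)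
    also have "\<dots> = integral {0..s} (\<lambda>t. F (t, if t \<le> \<delta> then 0 else Y n (t - \<delta>)))"
      unfolding S_def by (intro integral_cong) (auto simp: Y0 max_def)
    finally show "Y n s = \<dots>" .
  qed
qed

text \<open>The solutions with delay \<open>1 / (n + 1)\<close> are uniformly bounded and share the
  Lipschitz constant \<open>M\<close>, so Arzela-Ascoli gives a uniformly convergent subsequence,
  and dominated convergence passes to the limit in the integral equation. Continuity of
  \<open>F\<close> has to suffice: the application contains a square root, which is not Lipschitz at
  0.\<close>

lemma peano_existence:
  fixes F :: "real \<times> real \<Rightarrow> real"
  assumes F: "continuous_on UNIV F" and M: "\<And>p. \<bar>F p\<bar> \<le> M"
  shows "\<exists>y. y 0 = 0 \<and> (\<forall>s\<in>{0..b}. (y has_real_derivative F (s, y s)) (at s within {0..b}))"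
proof (cases "b \<ge> 0")
  case False
  then show ?thesis by (intro exI[of _ "\<lambda>_. 0"]) auto
next
  case b: True
  have M0: "0 \<le> M" using M[of "(0,0)"] by linarith
  have "\<forall>n. \<exists>y. continuous_on {0..b} y \<and>
     (\<forall>s\<in>{0..b}. y s = integral {0..s} (\<lambda>t. F (t, if t \<le> inverse (real (Suc n)) then 0 else y (t - inverse (real (Suc n))))))"
    by (intro allI tonelli_delay[OF F]) simp
  then obtain Y where Yc: "\<And>n. continuous_on {0..b} (Y n)"
    and Y: "\<And>n s. s \<in> {0..b} \<Longrightarrow> Y n s = integral {0..s} (\<lambda>t. F (t, if t \<le> inverse (real (Suc n)) then 0 else Y n (t - inverse (real (Suc n)))))"
    by metis
  define G where "G n t = F (t, if t \<le> inverse (real (Suc n)) then 0 else Y n (t - inverse (real (Suc n))))" for n t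
  have Y': "Y n s = integral {0..s} (G n)" if "s \<in> {0..b}" for n s
    using Y[OF that] by (simp add: G_def[abs_def])
  have Y0: "Y n 0 = 0" for n using Y'[of 0 n] b by simp
  have Gc: "continuous_on {0..b} (G n)" for n
  proof -
    let ?d = "inverse (real (Suc n))"
    have d: "0 < ?d" by simp
    have "max 0 (t - ?d) \<in> {0..b}" if "t \<in> {0..b}" for t
      using that d unfolding atLeastAtMost_iff by linarith
    then have "continuous_on {0..b} (\<lambda>t. Y n (max 0 (t - ?d)))"
      by (intro continuous_on_compose2[OF Yc]) (auto intro!: continuous_intros)
    moreover have "Y n (max 0 (t - ?d)) = (if t \<le> ?d then 0 else Y n (t - ?d))" for t
      by (cases "t \<le> ?d") (simp_all add: max_def Y0 del: of_nat_Suc)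
    ultimately have "continuous_on {0..b} (\<lambda>t. if t \<le> ?d then 0 else Y n (t - ?d))"
      by (simp only:)
    then show ?thesis
      unfolding G_def by (intro continuous_on_compose2[OF F]) (auto intro!: continuous_intros)
  qed
  have Gi: "G n integrable_on {u..v}" if "0 \<le> u" "v \<le> b" for n u v
    by (rule integrable_continuous_real, rule continuous_on_subset[OF Gc]) (use that in auto)
  have lip1: "\<bar>Y n v - Y n u\<bar> \<le> M * (v - u)" if "0 \<le> u" "u \<le> v" "v \<le> b" for n u v
  proof -
    have "Y n u + integral {u..v} (G n) = Y n v"
      using that Y' by (simp add: Henstock_Kurzweil_Integration.integral_combine Gi)
    moreover have "norm (integral {u..v} (G n)) \<le> M * (v - u)"
      using that M by (intro integral_bound continuous_on_subset[OF Gc]) (auto simp: G_def)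
    ultimately show ?thesis by simp
  qed
  have lip: "\<bar>Y n v - Y n u\<bar> \<le> M * \<bar>v - u\<bar>" if "u \<in> {0..b}" "v \<in> {0..b}" for n u v
    using that lip1[of u v n] lip1[of v u n] by (cases "u \<le> v") (auto simp: abs_minus_commute)
  obtain y k where yc: "continuous_on {0..b} y" and k: "strict_mono (k :: nat \<Rightarrow> nat)"
    and unif: "\<And>e. 0 < e \<Longrightarrow> \<exists>N. \<forall>n x. n \<ge> N \<and> x \<in> {0..b} \<longrightarrow> norm (Y (k n) x - y x) < e"
  proof (rule Arzela_Ascoli[of "{0..b}" Y "M * b"])
    show "norm (Y n x) \<le> M * b" if "x \<in> {0..b}" for n x
      using lip[of 0 x n] that b Y0 M0
      by (auto intro: order_trans mult_left_mono)
    show "\<exists>d>0. \<forall>n y. y \<in> {0..b} \<and> norm (x - y) < d \<longrightarrow> norm (Y n x - Y n y) < e"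
      if "x \<in> {0..b}" "0 < e" for x e
    proof (intro exI[of _ "e / (M + 1)"] conjI allI impI)
      show "0 < e / (M + 1)" using that M0 by simp
      fix n y assume y: "y \<in> {0..b} \<and> norm (x - y) < e / (M + 1)"
      have "norm (Y n x - Y n y) \<le> M * \<bar>x - y\<bar>"
        using lip[of y x n] y that by simp
      also have "\<dots> \<le> M * (e / (M + 1))" using y M0 by (intro mult_left_mono) auto
      also have "\<dots> < e" using M0 that by (simp add: field_simps)
      finally show "norm (Y n x - Y n y) < e" .
    qed
  qed auto
  have lim: "(\<lambda>n. Y (k n) x) \<longlonglongrightarrow> y x" if "x \<in> {0..b}" for x
    unfolding LIMSEQ_iff using unif that by metis
  have kinf: "filterlim k at_top sequentially" using k by (rule filterlim_subseq)
  have limG: "(\<lambda>n. G (k n) t) \<longlonglongrightarrow> F (t, y t)" if t: "t \<in> {0..b}" for t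
  proof -
    let ?d = "\<lambda>n. inverse (real (Suc (k n)))"
    let ?a = "\<lambda>n. if t \<le> ?d n then 0 else Y (k n) (t - ?d n)"
    have d0: "?d \<longlonglongrightarrow> 0"
      using filterlim_compose[OF LIMSEQ_inverse_real_of_nat kinf] .
    \<comment> \<open>The default value 0 is \<open>Y (k n) 0\<close>, so the Lipschitz bound
      controls the effect of the delay in both cases.\<close>
    have "\<bar>?a n - Y (k n) t\<bar> \<le> M * ?d n" for n
    proof (cases "t \<le> ?d n")
      case True
      then have "\<bar>?a n - Y (k n) t\<bar> \<le> M * t" using lip[of 0 t "k n"] t Y0 by auto
      also have "\<dots> \<le> M * ?d n" using True M0 by (rule mult_left_mono)
      finally show ?thesis .
    next
      case False
      moreover have "?d n > 0" by simp
      ultimately have "t - ?d n \<in> {0..b}" using t by (auto simp del: inverse_positive_iff_positive)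
      then show ?thesis using lip[of t "t - ?d n" "k n"] t False by auto
    qed
    then have "\<forall>n. norm (?a n - Y (k n) t) \<le> M * ?d n" by (simp only: real_norm_def) blast
    moreover have "(\<lambda>n. M * ?d n) \<longlonglongrightarrow> 0"
      using tendsto_mult_left[OF d0, of M] by (simp only: mult_zero_right)
    ultimately have "(\<lambda>n. ?a n - Y (k n) t) \<longlonglongrightarrow> 0"
      by (rule Lim_null_comparison[OF always_eventually])
    from tendsto_add[OF this lim[OF t]] have "?a \<longlonglongrightarrow> y t"
      by (simp only: diff_add_cancel add_0)
    then have "(\<lambda>n. (t, ?a n)) \<longlonglongrightarrow> (t, y t)" by (intro tendsto_intros)
    then have "(\<lambda>n. F (t, ?a n)) \<longlonglongrightarrow> F (t, y t)"
      using F by (intro isCont_tendsto_compose[of _ F]) (auto simp: continuous_on_eq_continuous_at)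
    then show ?thesis by (simp add: G_def)
  qed
  have inteq: "y s = integral {0..s} (\<lambda>t. F (t, y t))" if s: "s \<in> {0..b}" for s
  proof -
    have "(\<lambda>n. integral {0..s} (G (k n))) \<longlonglongrightarrow> integral {0..s} (\<lambda>t. F (t, y t))"
    proof (rule dominated_convergence(2)[where h="\<lambda>_. M"])
      show "G (k n) integrable_on {0..s}" for n using s by (intro Gi) auto
      show "norm (G (k n) t) \<le> M" for n t unfolding G_def using M by simp
      show "(\<lambda>n. G (k n) t) \<longlonglongrightarrow> F (t, y t)" if "t \<in> {0..s}" for t using that s by (intro limG) auto
    qed (rule integrable_const_ivl)
    moreover have "(\<lambda>n. integral {0..s} (G (k n))) \<longlonglongrightarrow> y s"
      using lim[OF s] Y'[OF s] by simp
    ultimately show ?thesis using LIMSEQ_unique by blast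
  qed
  have Fc: "continuous_on {0..b} (\<lambda>t. F (t, y t))"
    by (intro continuous_on_compose2[OF F]) (auto intro!: continuous_intros yc)
  have "(y has_real_derivative F (s, y s)) (at s within {0..b})" if "s \<in> {0..b}" for s
    by (rule has_field_derivative_transform_within[OF integral_has_real_derivative[OF Fc that],
          where d=1]) (use inteq that in auto)
  moreover have "y 0 = 0" using inteq[of 0] b by simp
  ultimately show ?thesis by blast
qed

section \<open>Absolute continuity\<close>

lemma division_of_Icc:
  fixes d :: "real set set"
  assumes "d division_of \<Union>d" "\<Union>d \<subseteq> {a..b}" "k \<in> d"
  shows "k = {Inf k..Sup k}" "Inf k \<le> Sup k" "a \<le> Inf k" "Sup k \<le> b"
proof -
  obtain l r where k: "k = {l..r}" "k \<noteq> {}"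
    using division_ofD(3,4)[OF assms(1,3)] by auto
  then have lr: "l \<le> r" by auto
  with k have e: "Inf k = l" "Sup k = r" by auto
  moreover have "k \<subseteq> {a..b}" using assms(2,3) by blast
  then have "l \<in> {a..b}" "r \<in> {a..b}" using k lr by auto
  ultimately show "k = {Inf k..Sup k}" "Inf k \<le> Sup k" "a \<le> Inf k" "Sup k \<le> b"
    using k lr by auto
qed

text \<open>Extending the division to the whole interval only adds nonnegative terms, after which
  the increments telescope.\<close>

lemma division_sum_le_mono:
  fixes u :: "real \<Rightarrow> real"
  assumes u: "mono_on {a..b} u" and "a \<le> b" and d: "d division_of \<Union>d" "\<Union>d \<subseteq> {a..b}"
  shows "(\<Sum>k\<in>d. \<bar>u (Sup k) - u (Inf k)\<bar>) \<le> u b - u a"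
proof -
  obtain r where r: "d \<subseteq> r" "r division_of {a..b}"
    using partial_division_extend[OF d(1) division_of_self[of a b] ] d(2) \<open>a \<le> b\<close> by auto
  \<comment> \<open>The left end points serve as tags merely to reach the telescoping identity,
    which is stated for tagged divisions.\<close>
  define p where "p = (\<lambda>k. (Inf k, k)) ` r"
  have rU: "r division_of \<Union>r" "\<Union>r \<subseteq> {a..b}"
    using r(2) division_ofD(6)[OF r(2)] by auto
  note rk = division_of_Icc[OF rU]
  have rk': "Inf k \<in> k" if "k \<in> r" for k
    by (subst rk(1)[OF that]) (use rk(2)[OF that] in simp)
  have p: "p tagged_division_of {a..b}"
    unfolding tagged_division_of p_def
    using division_ofD(1,2,4,5,6)[OF r(2)] rk'
    by (intro conjI allI impI finite_imageI) (simp_all add: image_iff, blast+)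
  have "(\<Sum>k\<in>d. \<bar>u (Sup k) - u (Inf k)\<bar>) \<le> (\<Sum>k\<in>r. \<bar>u (Sup k) - u (Inf k)\<bar>)"
    using r division_ofD(1)[OF r(2)] by (intro sum_mono2) auto
  also have "\<dots> = (\<Sum>k\<in>r. u (Sup k) - u (Inf k))"
  proof (intro sum.cong refl abs_of_nonneg)
    fix k assume "k \<in> r"
    note k = rk[OF this]
    show "0 \<le> u (Sup k) - u (Inf k)"
      using k(2,3,4) by (simp add: mono_onD[OF u])
  qed
  also have "\<dots> = (\<Sum>(x,k)\<in>p. u (Sup k) - u (Inf k))"
    unfolding p_def by (subst sum.reindex) (auto simp: inj_on_def)
  also have "\<dots> = u b - u a"
    by (rule additive_tagged_division_1[OF \<open>a \<le> b\<close> p])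
  finally show ?thesis .
qed

text \<open>The inner clause of \<open>locally_abs_cont_on\<close> under a name, so that its
  quantifier over divisions is instantiated in a controlled way.\<close>

definition small_variation :: "(real \<Rightarrow> real) \<Rightarrow> real set \<Rightarrow> real \<Rightarrow> real \<Rightarrow> bool" where
  "small_variation u K \<delta> \<epsilon> \<longleftrightarrow>
     (\<forall>d. d division_of \<Union>d \<and> \<Union>d \<subseteq> K \<and> (\<Sum>k\<in>d. Sup k - Inf k) < \<delta> \<longrightarrow>
          (\<Sum>k\<in>d. \<bar>u (Sup k) - u (Inf k)\<bar>) < \<epsilon>)"

lemma small_variationD:
  assumes "small_variation u K \<delta> \<epsilon>"
    and "d division_of \<Union>d" "\<Union>d \<subseteq> K" "(\<Sum>k\<in>d. Sup k - Inf k) < \<delta>"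
  shows "(\<Sum>k\<in>d. \<bar>u (Sup k) - u (Inf k)\<bar>) < \<epsilon>"
  using assms(1)[unfolded small_variation_def, THEN spec, THEN mp, OF conjI[OF assms(2) conjI[OF assms(3,4)]]] .

lemma small_variationI:
  assumes "\<And>d. d division_of \<Union>d \<Longrightarrow> \<Union>d \<subseteq> K \<Longrightarrow> (\<Sum>k\<in>d. Sup k - Inf k) < \<delta> \<Longrightarrow>
    (\<Sum>k\<in>d. \<bar>u (Sup k) - u (Inf k)\<bar>) < \<epsilon>"
  shows "small_variation u K \<delta> \<epsilon>"
  unfolding small_variation_def by (intro allI impI, elim conjE) (rule assms)

lemma locally_abs_cont_on_iff:
  "locally_abs_cont_on S u \<longleftrightarrow>
     (\<forall>a b. {a..b} \<subseteq> S \<longrightarrow> (\<forall>\<epsilon>>0. \<exists>\<delta>>0. small_variation u {a..b} \<delta> \<epsilon>))"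
  unfolding locally_abs_cont_on_def small_variation_def ..

lemma locally_abs_cont_onD:
  assumes "locally_abs_cont_on S u" "{a..b} \<subseteq> S" "\<epsilon> > 0"
  obtains \<delta> where "\<delta> > 0" "small_variation u {a..b} \<delta> \<epsilon>"
  using assms unfolding locally_abs_cont_on_iff by blast

lemma locally_abs_cont_on_subset:
  "locally_abs_cont_on S u \<Longrightarrow> T \<subseteq> S \<Longrightarrow> locally_abs_cont_on T u"
  unfolding locally_abs_cont_on_iff by (meson order_trans)

lemma locally_abs_cont_on_cong:
  assumes "locally_abs_cont_on S u" "\<And>x. x \<in> S \<Longrightarrow> u x = v x"
  shows "locally_abs_cont_on S v"
  unfolding locally_abs_cont_on_iff
proof (intro allI impI)
  fix a b \<epsilon> :: real assume ab: "{a..b} \<subseteq> S" "\<epsilon> > 0"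
  then obtain \<delta> where \<delta>: "\<delta> > 0"
    "small_variation u {a..b} \<delta> (\<epsilon>)"
    using locally_abs_cont_onD[OF assms(1)] by blast
  have sv: "(\<Sum>k\<in>d. \<bar>v (Sup k) - v (Inf k)\<bar>) < \<epsilon>"
    if d: "d division_of \<Union>d" "\<Union>d \<subseteq> {a..b}" "(\<Sum>k\<in>d. Sup k - Inf k) < \<delta>" for d
  proof -
    have "Sup k \<in> S" "Inf k \<in> S" if "k \<in> d" for k
      using division_of_Icc[OF d(1,2) that] ab(1) by (auto simp: subset_iff)
    then have "(\<Sum>k\<in>d. \<bar>v (Sup k) - v (Inf k)\<bar>) = (\<Sum>k\<in>d. \<bar>u (Sup k) - u (Inf k)\<bar>)"
      using assms(2) by (intro sum.cong) auto
    with small_variationD[OF \<delta>(2) d] show ?thesis by simp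
  qed
  have "small_variation v {a..b} \<delta> \<epsilon>"
    using sv by (rule small_variationI)
  with \<delta>(1) show "\<exists>\<delta>>0. small_variation v {a..b} \<delta> \<epsilon>" by blast
qed

lemma locally_abs_cont_on_lipschitz:
  assumes "\<And>a b. {a..b} \<subseteq> S \<Longrightarrow> \<exists>L. \<forall>x\<in>{a..b}. \<forall>y\<in>{a..b}. x \<le> y \<longrightarrow> \<bar>u y - u x\<bar> \<le> L * (y - x)"
  shows "locally_abs_cont_on S u"
  unfolding locally_abs_cont_on_iff
proof (intro allI impI)
  fix a b \<epsilon> :: real assume ab: "{a..b} \<subseteq> S" "\<epsilon> > 0"
  then obtain L0 where L0: "\<And>x y. x \<in> {a..b} \<Longrightarrow> y \<in> {a..b} \<Longrightarrow> x \<le> y \<Longrightarrow> \<bar>u y - u x\<bar> \<le> L0 * (y - x)"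
    using assms[of a b] by blast
  define L where "L = \<bar>L0\<bar> + 1"
  have L: "L > 0" "\<And>x y. x \<in> {a..b} \<Longrightarrow> y \<in> {a..b} \<Longrightarrow> x \<le> y \<Longrightarrow> \<bar>u y - u x\<bar> \<le> L * (y - x)"
  proof -
    show "L > 0" by (simp add: L_def)
    fix x y assume xy: "x \<in> {a..b}" "y \<in> {a..b}" "x \<le> y"
    have "L0 * (y - x) \<le> L * (y - x)" using xy(3) by (intro mult_right_mono) (auto simp: L_def)
    with L0[OF xy] show "\<bar>u y - u x\<bar> \<le> L * (y - x)" by linarith
  qed
  have sv: "(\<Sum>k\<in>d. \<bar>u (Sup k) - u (Inf k)\<bar>) < \<epsilon>"
    if d: "d division_of \<Union>d" "\<Union>d \<subseteq> {a..b}" "(\<Sum>k\<in>d. Sup k - Inf k) < \<epsilon> / L" for d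
  proof -
    have "(\<Sum>k\<in>d. \<bar>u (Sup k) - u (Inf k)\<bar>) \<le> (\<Sum>k\<in>d. L * (Sup k - Inf k))"
    proof (intro sum_mono L(2))
      fix k assume "k \<in> d"
      note k = division_of_Icc[OF d(1,2) this]
      show "Inf k \<in> {a..b}" "Sup k \<in> {a..b}" "Inf k \<le> Sup k" using k by auto
    qed
    also have "\<dots> = L * (\<Sum>k\<in>d. Sup k - Inf k)" by (simp add: sum_distrib_left)
    also have "\<dots> < L * (\<epsilon> / L)" using d(3) L(1) by (intro mult_strict_left_mono)
    finally show ?thesis using L(1) by simp
  qed
  then show "\<exists>\<delta>>0. small_variation u {a..b} \<delta> \<epsilon>"
    using L(1) ab(2) by (intro exI[of _ "\<epsilon> / L"]) (auto intro!: small_variationI sv)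
qed

lemma locally_abs_cont_on_lipschitz_compose:
  assumes u: "locally_abs_cont_on S u" and uT: "u ` S \<subseteq> T"
    and F: "\<And>x y. x \<in> T \<Longrightarrow> y \<in> T \<Longrightarrow> \<bar>F x - F y\<bar> \<le> L * \<bar>x - y\<bar>"
  shows "locally_abs_cont_on S (\<lambda>x. F (u x))"
  unfolding locally_abs_cont_on_iff
proof (intro allI impI)
  fix a b \<epsilon> :: real assume ab: "{a..b} \<subseteq> S" "\<epsilon> > 0"
  define L' where "L' = \<bar>L\<bar> + 1"
  have L': "L' > 0" "\<bar>F x - F y\<bar> \<le> L' * \<bar>x - y\<bar>" if "x \<in> T" "y \<in> T" for x y
  proof -
    show "L' > 0" by (simp add: L'_def)
    have "L * \<bar>x - y\<bar> \<le> L' * \<bar>x - y\<bar>" by (rule mult_right_mono) (auto simp: L'_def)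
    with F[OF that] show "\<bar>F x - F y\<bar> \<le> L' * \<bar>x - y\<bar>" by linarith
  qed
  have "\<epsilon> / L' > 0" using ab(2) by (auto simp: L'_def)
  then obtain \<delta> where \<delta>: "\<delta> > 0"
    "small_variation u {a..b} \<delta> (\<epsilon> / L')"
    using locally_abs_cont_onD[OF u ab(1)] by blast
  have sv: "(\<Sum>k\<in>d. \<bar>F (u (Sup k)) - F (u (Inf k))\<bar>) < \<epsilon>"
    if d: "d division_of \<Union>d" "\<Union>d \<subseteq> {a..b}" "(\<Sum>k\<in>d. Sup k - Inf k) < \<delta>" for d
  proof -
    have "(\<Sum>k\<in>d. \<bar>F (u (Sup k)) - F (u (Inf k))\<bar>) \<le> (\<Sum>k\<in>d. L' * \<bar>u (Sup k) - u (Inf k)\<bar>)"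
    proof (intro sum_mono L'(2))
      fix k assume "k \<in> d"
      note k = division_of_Icc[OF d(1,2) this]
      show "u (Sup k) \<in> T" "u (Inf k) \<in> T" 
        using k by (auto intro!: subsetD[OF uT] imageI subsetD[OF ab(1)])
    qed
    also have "\<dots> = L' * (\<Sum>k\<in>d. \<bar>u (Sup k) - u (Inf k)\<bar>)" by (simp add: sum_distrib_left)
    also have "\<dots> < L' * (\<epsilon> / L')"
      using small_variationD[OF \<delta>(2) d] by (intro mult_strict_left_mono) (auto simp: L'_def)
    finally show ?thesis by (auto simp: L'_def)
  qed
  have "small_variation (\<lambda>x. F (u x)) {a..b} \<delta> \<epsilon>"
    using sv by (rule small_variationI)
  with \<delta>(1) show "\<exists>\<delta>>0. small_variation (\<lambda>x. F (u x)) {a..b} \<delta> \<epsilon>" by blast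
qed

lemma locally_abs_cont_on_add:
  assumes u: "locally_abs_cont_on S u" and v: "locally_abs_cont_on S v"
  shows "locally_abs_cont_on S (\<lambda>x. u x + v x)"
  unfolding locally_abs_cont_on_iff
proof (intro allI impI)
  fix a b \<epsilon> :: real assume ab: "{a..b} \<subseteq> S" "\<epsilon> > 0"
  obtain \<delta>1 where \<delta>1: "\<delta>1 > 0"
    "small_variation u {a..b} \<delta>1 (\<epsilon>/2)"
    using locally_abs_cont_onD[OF u ab(1) half_gt_zero[OF ab(2)]] by blast
  obtain \<delta>2 where \<delta>2: "\<delta>2 > 0"
    "small_variation v {a..b} \<delta>2 (\<epsilon>/2)"
    using locally_abs_cont_onD[OF v ab(1) half_gt_zero[OF ab(2)]] by blast
  have sv: "(\<Sum>k\<in>d. \<bar>u (Sup k) + v (Sup k) - (u (Inf k) + v (Inf k))\<bar>) < \<epsilon>"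
    if d: "d division_of \<Union>d" "\<Union>d \<subseteq> {a..b}" "(\<Sum>k\<in>d. Sup k - Inf k) < min \<delta>1 \<delta>2" for d
  proof -
    have "(\<Sum>k\<in>d. \<bar>u (Sup k) + v (Sup k) - (u (Inf k) + v (Inf k))\<bar>)
        \<le> (\<Sum>k\<in>d. \<bar>u (Sup k) - u (Inf k)\<bar> + \<bar>v (Sup k) - v (Inf k)\<bar>)"
      by (intro sum_mono) linarith
    also have "\<dots> < \<epsilon>/2 + \<epsilon>/2"
      unfolding sum.distrib using small_variationD[OF \<delta>1(2)] d small_variationD[OF \<delta>2(2)] by (intro add_strict_mono) auto
    finally show ?thesis by simp
  qed
  with \<delta>1(1) \<delta>2(1) show "\<exists>\<delta>>0. small_variation (\<lambda>x. u x + v x) {a..b} \<delta> \<epsilon>"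
    by (intro exI[of _ "min \<delta>1 \<delta>2"] conjI small_variationI sv) auto
qed

text \<open>Split \<open>\<phi> = max \<phi> m + min \<phi> m - m\<close>: the first part is Lipschitz, the variation of the
  second is at most \<open>m\<close>, which is arbitrarily small.\<close>
lemma locally_abs_cont_on_monotone:
  fixes \<phi> :: "real \<Rightarrow> real"
  assumes mono: "mono_on S \<phi>" and nonneg: "\<And>x. x \<in> S \<Longrightarrow> 0 \<le> \<phi> x"
    and lip: "\<And>a b \<epsilon>. {a..b} \<subseteq> S \<Longrightarrow> 0 < \<epsilon> \<Longrightarrow> \<exists>m L. 0 \<le> m \<and> m < \<epsilon> \<and>
      (\<forall>x\<in>{a..b}. \<forall>y\<in>{a..b}. x \<le> y \<longrightarrow> max (\<phi> y) m - max (\<phi> x) m \<le> L * (y - x))"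
  shows "locally_abs_cont_on S \<phi>"
  unfolding locally_abs_cont_on_iff
proof (intro allI impI)
  fix a b \<epsilon> :: real assume ab: "{a..b} \<subseteq> S" "\<epsilon> > 0"
  show "\<exists>\<delta>>0. small_variation \<phi> {a..b} \<delta> \<epsilon>"
  proof (cases "a \<le> b")
    case False
    have "d = {}" if "d division_of \<Union>d" "\<Union>d \<subseteq> {a..b}" for d
      using division_of_Icc(2-4)[OF that] False by fastforce
    then have "small_variation \<phi> {a..b} 1 \<epsilon>"
      using ab(2) by (intro small_variationI) (metis sum.empty)
    then show ?thesis using zero_less_one by blast
  next
    case True
    have "\<epsilon>/2 > 0" using ab(2) by simp
    from lip[OF ab(1) this] obtain m L0 where m: "0 \<le> m" "m < \<epsilon>/2"
      and L0: "\<forall>x\<in>{a..b}. \<forall>y\<in>{a..b}. x \<le> y \<longrightarrow> max (\<phi> y) m - max (\<phi> x) m \<le> L0 * (y - x)"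
      by blast
    have mab: "mono_on {a..b} \<phi>" using mono ab(1) by (rule mono_on_subset)
    have abs: "locally_abs_cont_on {a..b} (\<lambda>x. max (\<phi> x) m)"
    proof (rule locally_abs_cont_on_lipschitz, intro exI ballI impI)
      fix a' b' x y assume *: "{a'..b'} \<subseteq> {a..b}" "x \<in> {a'..b'}" "y \<in> {a'..b'}" "x \<le> y"
      then have "x \<in> {a..b}" "y \<in> {a..b}" by blast+
      then have "max (\<phi> y) m - max (\<phi> x) m \<le> L0 * (y - x)" "\<phi> x \<le> \<phi> y"
        using L0 * mono_onD[OF mab] by auto
      then show "\<bar>max (\<phi> y) m - max (\<phi> x) m\<bar> \<le> L0 * (y - x)" by linarith
    qed
    from locally_abs_cont_onD[OF this order_refl \<open>\<epsilon>/2 > 0\<close>] obtain \<delta> where \<delta>: "\<delta> > 0"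
      "small_variation (\<lambda>x. max (\<phi> x) m) {a..b} \<delta> (\<epsilon>/2)" .
    have sv: "(\<Sum>k\<in>d. \<bar>\<phi> (Sup k) - \<phi> (Inf k)\<bar>) < \<epsilon>"
      if d: "d division_of \<Union>d" "\<Union>d \<subseteq> {a..b}" "(\<Sum>k\<in>d. Sup k - Inf k) < \<delta>" for d
    proof -
      let ?n = "\<lambda>x. min (\<phi> x) m"
      have "mono_on {a..b} ?n"
        using mono_onD[OF mab] by (intro mono_onI min.mono) auto
      then have "(\<Sum>k\<in>d. \<bar>?n (Sup k) - ?n (Inf k)\<bar>) \<le> ?n b - ?n a"
        by (rule division_sum_le_mono[OF _ True d(1,2)])
      also have "\<dots> < \<epsilon>/2"
      proof -
        have "a \<in> S" using ab(1) True by auto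
        from nonneg[OF this] m show ?thesis by linarith
      qed
      finally have n: "(\<Sum>k\<in>d. \<bar>?n (Sup k) - ?n (Inf k)\<bar>) < \<epsilon>/2" .
      have "(\<Sum>k\<in>d. \<bar>\<phi> (Sup k) - \<phi> (Inf k)\<bar>) \<le>
        (\<Sum>k\<in>d. \<bar>max (\<phi> (Sup k)) m - max (\<phi> (Inf k)) m\<bar> + \<bar>?n (Sup k) - ?n (Inf k)\<bar>)"
        by (intro sum_mono) linarith
      also have "\<dots> < \<epsilon>/2 + \<epsilon>/2"
        unfolding sum.distrib using small_variationD[OF \<delta>(2)] d n by (intro add_strict_mono) auto
      finally show ?thesis by simp
    qed
    have "small_variation \<phi> {a..b} \<delta> \<epsilon>"
    using sv by (rule small_variationI)
  with \<delta>(1) show ?thesis by blast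
  qed
qed

text \<open>Works directly with gauges. The exceptional null set is covered by an open set of
  measure below the \<delta> of absolute continuity; intervals tagged in it lie in that cover and
  carry little variation, while all other tags obey the usual estimate from differentiability. It
  serves for global extensions, which are differentiable only almost everywhere.\<close>

lemma fundamental_theorem_of_calculus_abs_cont:
  fixes u u' :: "real \<Rightarrow> real"
  assumes ac: "locally_abs_cont_on S u" and ab: "{a..b} \<subseteq> S" "a \<le> b"
    and deriv: "AE x in lebesgue. x \<in> S \<longrightarrow> (u has_real_derivative u' x) (at x)"
  shows "(u' has_integral (u b - u a)) {a..b}"
proof -
  obtain N where N: "N \<in> null_sets lebesgue"
    and Nd: "\<And>x. x \<in> {a..b} \<Longrightarrow> x \<notin> N \<Longrightarrow> (u has_real_derivative u' x) (at x)"
    using deriv ab(1) unfolding eventually_ae_filter by (auto simp: subset_iff)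
  \<comment> \<open>With the value 0 on \<open>N\<close>, exceptional tags contribute nothing to the
    Riemann sum, and only the variation of \<open>u\<close> remains to be bounded there.\<close>
  define u'' where "u'' x = (if x \<in> N then 0 else u' x)" for x
  have "(u'' has_integral (u b - u a)) {a..b}"
    unfolding has_integral_real
  proof (intro allI impI)
    fix e :: real assume e: "e > 0"
    from locally_abs_cont_onD[OF ac ab(1) half_gt_zero[OF e]] obtain \<delta> where \<delta>: "\<delta> > 0"
      "small_variation u {a..b} \<delta> (e/2)"
      by blast
    obtain T where T: "open T" "N \<subseteq> T" "T - N \<in> lmeasurable" "emeasure lebesgue (T - N) < ennreal \<delta>"
      using sets_lebesgue_outer_open[of N \<delta>] N \<delta>(1) by auto
    have Tm: "T \<in> lmeasurable" "measure lebesgue T < \<delta>"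
    proof -
      have "emeasure lebesgue (T - N) = emeasure lebesgue T"
        using N T(1) by (intro emeasure_Diff_null_set) auto
      with T(4) have "emeasure lebesgue T < ennreal \<delta>" by simp
      moreover from this show T: "T \<in> lmeasurable"
        using T(1) by (intro fmeasurableI) (auto intro: less_trans)
      ultimately show "measure lebesgue T < \<delta>"
        using \<delta>(1) by (simp add: emeasure_eq_measure2 ennreal_less_iff)
    qed
    \<comment> \<open>The regular tags may use up \<open>e / 2\<close>; the summand 1 keeps the
      quotient meaningful when \<open>a = b\<close>.\<close>
    define e' where "e' = e / (2 * (b - a + 1))"
    have e': "e' > 0" using e ab(2) by (simp add: e'_def)
    have "\<exists>\<eta>>0. \<forall>y. \<bar>y - x\<bar> < \<eta> \<longrightarrow> \<bar>u y - u x - u' x * (y - x)\<bar> \<le> e' * \<bar>y - x\<bar>"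
      if "x \<in> {a..b}" "x \<notin> N" for x
      using Nd[OF that] e' unfolding has_field_derivative_def has_derivative_at_alt
      by (auto simp: mult.commute)
    then obtain \<eta> where \<eta>: "\<And>x. x \<in> {a..b} \<Longrightarrow> x \<notin> N \<Longrightarrow> \<eta> x > 0"
      "\<And>x y. x \<in> {a..b} \<Longrightarrow> x \<notin> N \<Longrightarrow> \<bar>y - x\<bar> < \<eta> x \<Longrightarrow> \<bar>u y - u x - u' x * (y - x)\<bar> \<le> e' * \<bar>y - x\<bar>"
      by metis
    define \<gamma> where "\<gamma> x = (if x \<in> N then T else if x \<in> {a..b} then ball x (\<eta> x) else ball x 1)" for x
    have gauge: "gauge \<gamma>"
      unfolding gauge_def \<gamma>_def using T \<eta>(1) by auto
    have main: "norm ((\<Sum>(x, k)\<in>p. measure lborel k *\<^sub>R u'' x) - (u b - u a)) < e"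
      if p: "p tagged_division_of {a..b}" "\<gamma> fine p" for p
    proof -
      note pD = tagged_division_ofD[OF p(1)]
      have pk: "k = {Inf k..Sup k}" "Inf k \<le> Sup k" "a \<le> Inf k" "Sup k \<le> b" "Inf k \<le> x" "x \<le> Sup k"
        "measure lborel k = Sup k - Inf k" if xk: "(x, k) \<in> p" for x k
      proof -
        obtain l r where k: "k = {l..r}" using pD(4)[OF xk] by auto
        moreover have "x \<in> k" "k \<subseteq> {a..b}" using pD(2,3)[OF xk] by auto
        ultimately have "l \<le> r" "l \<le> x" "x \<le> r" "a \<le> l" "r \<le> b" by auto
        with k show "k = {Inf k..Sup k}" "Inf k \<le> Sup k" "a \<le> Inf k" "Sup k \<le> b" "Inf k \<le> x" "x \<le> Sup k"
          "measure lborel k = Sup k - Inf k" by auto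
      qed
      define pN where "pN = {(x,k)\<in>p. x \<in> N}"
      have pN: "pN \<subseteq> p" "finite pN" "finite p" using pD(1) by (auto simp: pN_def intro: finite_subset)
      define d where "d = snd ` pN"
      have "pN tagged_partial_division_of {a..b}"
        using p(1) pN(1) tagged_partial_division_subset unfolding tagged_division_of_def by blast
      then have pNt: "pN tagged_division_of \<Union>d"
        unfolding d_def by (rule tagged_partial_division_of_Union_self)
      then have dd: "d division_of \<Union>d"
        using division_of_tagged_division unfolding d_def by blast
      have dab: "\<Union>d \<subseteq> {a..b}" using pD(3) pN(1) unfolding d_def by force
      have dT: "\<Union>d \<subseteq> T"
        using p(2) unfolding fine_def d_def pN_def \<gamma>_def by fastforce
      have "(\<Sum>k\<in>d. Sup k - Inf k) = (\<Sum>k\<in>d. measure lebesgue k)"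
      proof (intro sum.cong refl)
        fix k assume "k \<in> d"
        note k = division_of_Icc[OF dd dab this]
        have "measure lebesgue {Inf k..Sup k} = Sup k - Inf k" using k(2) by (simp add: measure_completion)
        then show "Sup k - Inf k = measure lebesgue k" using k(1) by simp
      qed
      also have "\<dots> = measure lebesgue (\<Union>d)"
        by (rule content_division[OF dd])
      also have "\<dots> \<le> measure lebesgue T"
        using dd Tm(1) dT by (intro measure_mono_fmeasurable) (auto dest: lmeasurable_division)
      finally have "(\<Sum>k\<in>d. Sup k - Inf k) < \<delta>" using Tm(2) by simp
      from small_variationD[OF \<delta>(2) dd dab this] have "(\<Sum>k\<in>d. \<bar>u (Sup k) - u (Inf k)\<bar>) < e/2" .
      moreover have "(\<Sum>(x,k)\<in>pN. \<bar>u (Sup k) - u (Inf k)\<bar>) = (\<Sum>k\<in>d. \<bar>u (Sup k) - u (Inf k)\<bar>)"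
      proof -
        \<comment> \<open>Two tags can share an interval only if it has empty interior. Reindexing
          by intervals therefore requires the value 0 on every such interval, including the empty
          one, where \<open>Sup\<close> and \<open>Inf\<close> say nothing.\<close>
        let ?g = "\<lambda>k. if k = {} then 0 else \<bar>u (Sup k) - u (Inf k)\<bar>"
        have ne: "k \<noteq> {}" if "(x, k) \<in> p" for x k using pD(2)[OF that] by auto
        have "(\<Sum>(x,k)\<in>pN. ?g k) = sum ?g d"
          unfolding d_def
        proof (rule sum.over_tagged_division_lemma[OF pNt])
          fix l r :: real assume "box l r = {}"
          then have "r \<le> l" by (simp add: box_real)
          then show "?g (cbox l r) = 0" by (cases "r = l") auto
        qed
        moreover have "(\<Sum>(x,k)\<in>pN. ?g k) = (\<Sum>(x,k)\<in>pN. \<bar>u (Sup k) - u (Inf k)\<bar>)"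
          using ne pN(1) by (intro sum.cong refl) auto
        moreover have "sum ?g d = (\<Sum>k\<in>d. \<bar>u (Sup k) - u (Inf k)\<bar>)"
          using ne pN(1) unfolding d_def by (intro sum.cong refl) auto
        ultimately show ?thesis by simp
      qed
      ultimately have sN: "(\<Sum>(x,k)\<in>pN. \<bar>u (Sup k) - u (Inf k)\<bar>) < e/2" by simp
      have sR: "(\<Sum>(x,k)\<in>p - pN. \<bar>measure lborel k *\<^sub>R u'' x - (u (Sup k) - u (Inf k))\<bar>) \<le> e' * (b - a)"
      proof -
        have "(\<Sum>(x,k)\<in>p - pN. \<bar>measure lborel k *\<^sub>R u'' x - (u (Sup k) - u (Inf k))\<bar>)
          \<le> (\<Sum>(x,k)\<in>p - pN. e' * measure lborel k)"
        proof (intro sum_mono, clarify)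
          fix x k assume xk: "(x, k) \<in> p" "(x, k) \<notin> pN"
          then have xN: "x \<notin> N" by (simp add: pN_def)
          note k = pk[OF xk(1)]
          have x: "x \<in> {a..b}" using k by auto
          have sub: "k \<subseteq> ball x (\<eta> x)" using fineD[OF p(2) xk(1)] xN x by (simp add: \<gamma>_def)
          have "Inf k \<in> k" "Sup k \<in> k" using k by (metis atLeastAtMost_iff order_refl)+
          then have "\<bar>Inf k - x\<bar> < \<eta> x" "\<bar>Sup k - x\<bar> < \<eta> x"
            using sub by (auto simp: dist_real_def subset_iff)
          from \<eta>(2)[OF x xN this(1)] \<eta>(2)[OF x xN this(2)]
          have "\<bar>u (Inf k) - u x - u' x * (Inf k - x)\<bar> \<le> e' * (x - Inf k)"
            "\<bar>u (Sup k) - u x - u' x * (Sup k - x)\<bar> \<le> e' * (Sup k - x)"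
            using k by auto
          then show "\<bar>measure lborel k *\<^sub>R u'' x - (u (Sup k) - u (Inf k))\<bar> \<le> e' * measure lborel k"
          proof -
            assume le: "\<bar>u (Inf k) - u x - u' x * (Inf k - x)\<bar> \<le> e' * (x - Inf k)"
              "\<bar>u (Sup k) - u x - u' x * (Sup k - x)\<bar> \<le> e' * (Sup k - x)"
            have "e' * (x - Inf k) + e' * (Sup k - x) = e' * (Sup k - Inf k)"
              "u' x * (Sup k - x) - u' x * (Inf k - x) = (Sup k - Inf k) * u' x"
              by (simp_all add: algebra_simps)
            with le have "\<bar>(Sup k - Inf k) * u' x - (u (Sup k) - u (Inf k))\<bar> \<le> e' * (Sup k - Inf k)"
              by linarith
            then show ?thesis using xN k(7) by (simp add: u''_def)
          qed
        qed
        also have "\<dots> \<le> (\<Sum>(x,k)\<in>p. e' * measure lborel k)"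
          using pN e' by (intro sum_mono2) auto
        also have "\<dots> = e' * (\<Sum>(x,k)\<in>p. measure lborel k)"
          by (simp add: sum_distrib_left case_prod_unfold)
        also have "(\<Sum>(x,k)\<in>p. measure lborel k) = b - a"
          using additive_content_tagged_division[of p a b] p(1) ab(2) by simp
        finally show ?thesis .
      qed
      have "(\<Sum>(x, k)\<in>p. measure lborel k *\<^sub>R u'' x) - (u b - u a)
          = (\<Sum>(x, k)\<in>p. measure lborel k *\<^sub>R u'' x - (u (Sup k) - u (Inf k)))"
        using additive_tagged_division_1[OF ab(2) p(1), of u]
        by (simp add: case_prod_unfold sum_subtractf)
      also have "\<bar>\<dots>\<bar> \<le> (\<Sum>(x, k)\<in>p. \<bar>measure lborel k *\<^sub>R u'' x - (u (Sup k) - u (Inf k))\<bar>)"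
        unfolding case_prod_unfold by (rule sum_abs)
      also have "\<dots> = (\<Sum>(x, k)\<in>p - pN. \<bar>measure lborel k *\<^sub>R u'' x - (u (Sup k) - u (Inf k))\<bar>)
          + (\<Sum>(x, k)\<in>pN. \<bar>measure lborel k *\<^sub>R u'' x - (u (Sup k) - u (Inf k))\<bar>)"
        by (rule sum.subset_diff[OF pN(1,3)])
      also have "(\<Sum>(x, k)\<in>pN. \<bar>measure lborel k *\<^sub>R u'' x - (u (Sup k) - u (Inf k))\<bar>)
          = (\<Sum>(x,k)\<in>pN. \<bar>u (Sup k) - u (Inf k)\<bar>)"
        by (intro sum.cong refl) (auto simp: pN_def u''_def)
      also have "(\<Sum>(x, k)\<in>p - pN. \<bar>measure lborel k *\<^sub>R u'' x - (u (Sup k) - u (Inf k))\<bar>)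
          + (\<Sum>(x,k)\<in>pN. \<bar>u (Sup k) - u (Inf k)\<bar>) < e' * (b - a) + e/2"
        using sR sN by linarith
      also have "e' * (b - a) \<le> e/2"
        using e ab(2) by (simp add: e'_def field_simps)
      finally show ?thesis by simp
    qed
    show "\<exists>\<gamma>. gauge \<gamma> \<and> (\<forall>p. p tagged_division_of {a..b} \<and> \<gamma> fine p \<longrightarrow>
        norm ((\<Sum>(x, k)\<in>p. measure lborel k *\<^sub>R u'' x) - (u b - u a)) < e)"
    proof (intro exI[of _ \<gamma>] conjI allI impI)
      show "gauge \<gamma>" by (rule gauge)
      fix p assume "p tagged_division_of {a..b} \<and> \<gamma> fine p"
      then show "norm ((\<Sum>(x, k)\<in>p. measure lborel k *\<^sub>R u'' x) - (u b - u a)) < e"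
        using main by simp
    qed
  qed
  moreover have "negligible N" using N by (simp add: negligible_iff_null_sets)
  ultimately show ?thesis
    by (elim has_integral_spike[rotated 2]) (auto simp: u''_def)
qed

section \<open>Test functions and the du Bois-Reymond lemma\<close>

text \<open>The polynomial is carried along because derivatives stay in this family;
  \<open>p = 1\<close> is the standard smooth function that vanishes to infinite order at 0.\<close>

definition flat :: "real poly \<Rightarrow> real \<Rightarrow> real" where
  "flat p x = (if 0 < x then poly p (1 / x) * exp (- (1 / x)) else 0)"

lemma poly_mult_exp_minus_tendsto_0:
  "((\<lambda>x::real. poly q x * exp (- x)) \<longlongrightarrow> 0) at_top"
proof -
  have "((\<lambda>x::real. \<Sum>i\<le>degree q. coeff q i * (x ^ i / exp x)) \<longlongrightarrow> (\<Sum>i\<le>degree q. coeff q i * 0)) at_top"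
    by (intro tendsto_intros tendsto_power_div_exp_0)
  then show ?thesis
    by (simp add: poly_altdef sum_distrib_right exp_minus divide_inverse mult.assoc)
qed

text \<open>With \<open>t = 1 / x\<close> one has \<open>dt/dx = - t^2\<close>, and differentiating
  \<open>p(t) exp(-t)\<close> in \<open>t\<close> gives \<open>(p' - p) exp(-t)\<close>; this
  explains the new polynomial. At 0 the exponential beats every polynomial.\<close>

lemma has_real_derivative_flat:
  "(flat p has_real_derivative flat (monom 1 2 * (p - pderiv p)) x) (at x)"
proof (cases x "0::real" rule: linorder_cases)
  case less
  have "((\<lambda>_. 0) has_real_derivative 0) (at x)" by simp
  then have "(flat p has_real_derivative 0) (at x)"
    by (rule has_field_derivative_transform_within_open[where S="{..<0}"]) (use less in \<open>auto simp: flat_def\<close>)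
  with less show ?thesis by (simp add: flat_def)
next
  case greater
  have inv: "((\<lambda>x. 1 / x) has_real_derivative - (1 / x^2)) (at x)"
    using DERIV_inverse[of x] greater by (simp add: inverse_eq_divide power2_eq_square)
  have "((\<lambda>x. poly p (1 / x) * exp (- (1 / x))) has_real_derivative
     poly (pderiv p) (1 / x) * - (1 / x^2) * exp (- (1 / x)) +
     exp (- (1 / x)) * - (- (1 / x^2)) * poly p (1 / x)) (at x)"
    by (rule DERIV_mult[OF DERIV_chain2[OF poly_DERIV inv] DERIV_chain2[OF DERIV_exp DERIV_minus[OF inv]]])
  moreover have "poly (pderiv p) (1 / x) * - (1 / x^2) * exp (- (1 / x)) +
     exp (- (1 / x)) * - (- (1 / x^2)) * poly p (1 / x) = flat (monom 1 2 * (p - pderiv p)) x"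
    using greater by (simp add: flat_def poly_monom power_one_over algebra_simps)
  ultimately have "((\<lambda>x. poly p (1 / x) * exp (- (1 / x))) has_real_derivative
     flat (monom 1 2 * (p - pderiv p)) x) (at x)" by simp
  then show ?thesis
    by (rule has_field_derivative_transform_within_open[where S="{0<..}"]) (use greater in \<open>auto simp: flat_def\<close>)
next
  case equal
  have "((\<lambda>h. flat p h / h) \<longlongrightarrow> 0) (at_right 0)"
  proof -
    \<comment> \<open>Dividing by \<open>h\<close> multiplies the polynomial in \<open>1 / h\<close>
      by its variable, which is what \<open>pCons 0 p\<close> does.\<close>
    have "((\<lambda>h::real. poly (pCons 0 p) (inverse h) * exp (- inverse h)) \<longlongrightarrow> 0) (at_right 0)"
      by (rule filterlim_compose[OF poly_mult_exp_minus_tendsto_0 filterlim_inverse_at_top_right])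
    moreover have "eventually (\<lambda>h::real. poly (pCons 0 p) (inverse h) * exp (- inverse h) = flat p h / h) (at_right 0)"
      unfolding eventually_at_right_field by (intro exI[of _ 1]) (auto simp: flat_def field_simps)
    ultimately show ?thesis by (rule Lim_transform_eventually)
  qed
  moreover have "((\<lambda>h. flat p h / h) \<longlongrightarrow> 0) (at_left 0)"
    by (rule Lim_transform_eventually[OF tendsto_const])
       (auto simp: eventually_at_left_field flat_def intro!: exI[of _ "-1"])
  ultimately have "((\<lambda>h. flat p h / h) \<longlongrightarrow> 0) (at 0)"
    by (rule filterlim_split_at[rotated])
  then show ?thesis
    using equal by (simp add: DERIV_def flat_def[of _ 0])
qed

text \<open>An inductive class whose rules are exactly the operations needed to build cut-offs.
  Closure under differentiation is then one induction, and smoothness of all orders follows. The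
  last rule admits steps and ramps, which have no closed formula.\<close>

inductive smooth_fn :: "(real \<Rightarrow> real) \<Rightarrow> bool" where
  flat: "smooth_fn (flat p)"
| const: "smooth_fn (\<lambda>_. k)"
| add: "smooth_fn u \<Longrightarrow> smooth_fn v \<Longrightarrow> smooth_fn (\<lambda>x. u x + v x)"
| mult: "smooth_fn u \<Longrightarrow> smooth_fn v \<Longrightarrow> smooth_fn (\<lambda>x. u x * v x)"
| affine: "smooth_fn u \<Longrightarrow> smooth_fn (\<lambda>x. u (s * x + t))"
| antiderivative: "smooth_fn v \<Longrightarrow> (\<And>x. (u has_real_derivative v x) (at x)) \<Longrightarrow> smooth_fn u"

lemma smooth_fn_has_derivative:
  assumes "smooth_fn u"
  shows "\<exists>v. smooth_fn v \<and> (\<forall>x. (u has_real_derivative v x) (at x))"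
  using assms
proof induction
  case (flat p)
  then show ?case using has_real_derivative_flat smooth_fn.flat by blast
next
  case (const k)
  then show ?case using smooth_fn.const[of 0] by (intro exI[of _ "\<lambda>_. 0"]) auto
next
  case (add u v)
  then obtain u' v' where "smooth_fn u'" "smooth_fn v'"
    "\<And>x. (u has_real_derivative u' x) (at x)" "\<And>x. (v has_real_derivative v' x) (at x)" by blast
  then show ?case
    by (intro exI[of _ "\<lambda>x. u' x + v' x"] conjI allI smooth_fn.add DERIV_add)
next
  case (mult u v)
  then obtain u' v' where "smooth_fn u'" "smooth_fn v'"
    "\<And>x. (u has_real_derivative u' x) (at x)" "\<And>x. (v has_real_derivative v' x) (at x)" by blast
  then show ?case using mult.hyps
    by (intro exI[of _ "\<lambda>x. u' x * v x + v' x * u x"] conjI allI smooth_fn.add smooth_fn.mult DERIV_mult)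
next
  case (affine u s t)
  then obtain u' where u': "smooth_fn u'" "\<And>x. (u has_real_derivative u' x) (at x)" by blast
  have "((\<lambda>x. u (s * x + t)) has_real_derivative u' (s * x + t) * s) (at x)" for x
    by (rule DERIV_chain'[OF _ u'(2)]) (auto intro!: derivative_eq_intros)
  with u'(1) show ?case
    by (intro exI[of _ "\<lambda>x. u' (s * x + t) * s"] conjI allI smooth_fn.mult smooth_fn.const smooth_fn.affine)
next
  case (antiderivative v u)
  then show ?case by blast
qed

lemma smooth_fn_funpow_deriv: "smooth_fn u \<Longrightarrow> smooth_fn ((deriv ^^ n) u)"
proof (induction n)
  case (Suc n)
  then obtain v where v: "smooth_fn v" "\<And>x. (((deriv ^^ n) u) has_real_derivative v x) (at x)"
    using smooth_fn_has_derivative by blast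
  then have "deriv ((deriv ^^ n) u) = v" by (intro ext DERIV_imp_deriv)
  with v show ?case by simp
qed auto

lemma smooth_fn_differentiable: "smooth_fn u \<Longrightarrow> u differentiable (at x)"
  using smooth_fn_has_derivative real_differentiable_def by metis

lemma smooth_fn_continuous_on: "smooth_fn u \<Longrightarrow> continuous_on A u"
  using smooth_fn_has_derivative DERIV_isCont continuous_at_imp_continuous_on by metis

lemma smooth_fn_test_function:
  assumes "smooth_fn \<psi>" "{a..b} \<subseteq> I" "\<And>x. x \<notin> {a..b} \<Longrightarrow> \<psi> x = 0"
  shows "test_function I \<psi>"
proof -
  have sub: "closure {x. \<psi> x \<noteq> 0} \<subseteq> {a..b}"
    by (intro closure_minimal subsetI) (use assms(3) in \<open>blast, simp\<close>)
  then have "compact (closure {x. \<psi> x \<noteq> 0})"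
    by (meson bounded_subset bounded_closed_interval closed_closure compact_eq_bounded_closed)
  with sub show ?thesis
    unfolding test_function_def
    using assms(1,2) smooth_fn_differentiable smooth_fn_funpow_deriv by blast
qed

lemma smooth_step:
  obtains S where "smooth_fn S" "\<And>x. x \<le> 0 \<Longrightarrow> S x = 0" "\<And>x. x \<ge> 1 \<Longrightarrow> S x = 1"
    "\<And>x. 0 \<le> S x" "\<And>x. S x \<le> 1"
proof -
  \<comment> \<open>A bump supported in \<open>[0, 1]\<close>; its normalised antiderivative is the
    step. The argument \<open>1 - x\<close> is written in the form of the affine rule.\<close>
  define \<beta> where "\<beta> x = flat 1 x * flat 1 ((-1) * x + 1)" for x
  have \<beta>s: "smooth_fn \<beta>"
    unfolding \<beta>_def[abs_def] by (intro smooth_fn.mult smooth_fn.flat smooth_fn.affine)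
  have \<beta>: "\<beta> x \<ge> 0" "0 < x \<Longrightarrow> x < 1 \<Longrightarrow> \<beta> x > 0" "x \<le> 0 \<Longrightarrow> \<beta> x = 0" "x \<ge> 1 \<Longrightarrow> \<beta> x = 0" for x
    by (auto simp: \<beta>_def flat_def)
  obtain A where A: "\<And>x. (A has_real_derivative \<beta> x) (at x)"
    using antiderivative_on_open_interval[of UNIV \<beta>] smooth_fn_continuous_on[OF \<beta>s] by auto
  have mono: "A x \<le> A y" if "x \<le> y" for x y
    using that A \<beta>(1) by (metis DERIV_nonneg_imp_nondecreasing)
  obtain z where z: "0 < z" "z < 1" "A 1 - A 0 = (1 - 0) * \<beta> z"
    using MVT2[of 0 1 A \<beta>] A by auto
  then have pos: "A 1 - A 0 > 0" using \<beta>(2) by simp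
  have A0: "A x = A 0" if "x \<le> 0" for x
    by (rule eq_if_zero_derivative[OF A]) (use that \<beta>(3) in auto)
  have A1: "A x = A 1" if "x \<ge> 1" for x
    by (rule eq_if_zero_derivative[OF A, symmetric]) (use that \<beta>(4) in auto)
  define S where "S x = (A x + - A 0) * (1 / (A 1 - A 0))" for x
  show ?thesis
  proof
    show "smooth_fn S" unfolding S_def[abs_def]
      by (intro smooth_fn.mult smooth_fn.add smooth_fn.const smooth_fn.antiderivative[OF \<beta>s A])
    show "S x = 0" if "x \<le> 0" for x using A0[OF that] by (simp add: S_def)
    show "S x = 1" if "x \<ge> 1" for x using A1[OF that] pos by (simp add: S_def)
    show "0 \<le> S x" for x
    proof -
      have "A 0 \<le> A x" using mono[of 0 x] A0[of x] by (cases "x \<le> 0") auto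
      then show ?thesis using pos by (simp add: S_def)
    qed
    show "S x \<le> 1" for x
    proof -
      have "A x \<le> A 1" using mono[of x 1] A1[of x] by (cases "x \<ge> 1") auto
      then show ?thesis using pos by (simp add: S_def field_simps)
    qed
  qed
qed

text \<open>The difference of two such ramps is a test function whose derivative compares the averages
  over two intervals.\<close>
lemma smooth_ramps:
  fixes a b :: real
  assumes ab: "a < b"
  obtains r r' :: "nat \<Rightarrow> real \<Rightarrow> real"
  where "\<And>n. smooth_fn (r n)" "\<And>n. smooth_fn (r' n)"
    "\<And>n x. (r n has_real_derivative r' n x) (at x)"
    "\<And>n x. x \<le> a \<Longrightarrow> r n x = 0" "\<And>n x. x \<ge> b + 1 / real (Suc n) \<Longrightarrow> r n x = 1"
    "\<And>n x. \<bar>r' n x\<bar> \<le> 1 / (b - a)"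
    "\<And>x. (\<lambda>n. r' n x) \<longlonglongrightarrow> (if a < x \<and> x \<le> b then 1 / (b - a) else 0)"
proof -
  obtain S where S: "smooth_fn S" "\<And>x. x \<le> 0 \<Longrightarrow> S x = 0" "\<And>x. x \<ge> 1 \<Longrightarrow> S x = 1"
    "\<And>x. 0 \<le> S x" "\<And>x. S x \<le> 1"
    using smooth_step by blast
  obtain Q0 where Q0: "\<And>x. (Q0 has_real_derivative S x) (at x)"
    using antiderivative_on_open_interval[of UNIV S] smooth_fn_continuous_on[OF S(1)] by auto
  define Q where "Q x = Q0 x + - Q0 0" for x
  have Q: "(Q has_real_derivative S x) (at x)" for x
    unfolding Q_def[abs_def] by (auto intro!: derivative_eq_intros Q0)
  have Qs: "smooth_fn Q" by (rule smooth_fn.antiderivative[OF S(1) Q])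
  have Qneg: "Q x = 0" if "x \<le> 0" for x
  proof -
    have "Q x = Q 0" by (rule eq_if_zero_derivative[OF Q]) (use that S(2) in auto)
    then show ?thesis by (simp add: Q_def)
  qed
  \<comment> \<open>Beyond 1 the smoothed ramp \<open>Q\<close> runs parallel to the identity,
    delayed by the constant \<open>m\<close>.\<close>
  define m where "m = 1 - Q 1"
  have Qpos: "Q x = x - m" if "x \<ge> 1" for x
  proof -
    have "((\<lambda>t. Q t - t) has_real_derivative S t - 1) (at t)" for t
      by (intro derivative_intros Q)
    from eq_if_zero_derivative[where A="\<lambda>t. Q t - t", OF this _ that] S(3) show ?thesis
      by (auto simp: m_def)
  qed
  define q where "q N x = Q (N * x) / N" for N x :: real
  have q: "q N x = 0" if "x \<le> 0" "N > 0" for N x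
    using that by (simp add: q_def Qneg mult_nonneg_nonpos)
  have q1: "q N x = x - m / N" if "x \<ge> 1 / N" "N > 0" for N x
    using that by (simp add: q_def Qpos field_simps)
  \<comment> \<open>The difference of two rescaled copies started at \<open>a\<close> and
    \<open>b\<close>: their delays \<open>m / N\<close> cancel, so \<open>r n\<close> is exactly 1
    from \<open>b + 1 / N\<close> on, with \<open>N = n + 1\<close>. The products follow the shape
    of the \<open>smooth_fn\<close> rules.\<close>
  define r where "r n x = (Q (real (Suc n) * x + (- real (Suc n) * a)) * (1 / real (Suc n)) +
      (-1) * (Q (real (Suc n) * x + (- real (Suc n) * b)) * (1 / real (Suc n)))) * (1 / (b - a))" for n x
  define r' where "r' n x = (S (real (Suc n) * x + (- real (Suc n) * a)) +
      (-1) * S (real (Suc n) * x + (- real (Suc n) * b))) * (1 / (b - a))" for n x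
  have r_alt: "r n x = (q (real (Suc n)) (x - a) - q (real (Suc n)) (x - b)) / (b - a)" for n x
    unfolding r_def q_def by (simp add: algebra_simps diff_divide_distrib)
  have r'_alt: "r' n x = (S (real (Suc n) * (x - a)) - S (real (Suc n) * (x - b))) / (b - a)" for n x
    unfolding r'_def by (simp add: right_diff_distrib del: of_nat_Suc)
  show ?thesis
  proof
    show "smooth_fn (r n)" for n
      unfolding r_def[abs_def] by (intro smooth_fn.mult smooth_fn.add smooth_fn.const smooth_fn.affine Qs)
    show "smooth_fn (r' n)" for n
      unfolding r'_def[abs_def] by (intro smooth_fn.mult smooth_fn.add smooth_fn.const smooth_fn.affine S(1))
    show "(r n has_real_derivative r' n x) (at x)" for n x
    proof -
      have *: "((\<lambda>x. Q (real (Suc n) * x + t) * (1 / real (Suc n))) has_real_derivative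
          S (real (Suc n) * x + t)) (at x)" for t
      proof -
        have "((\<lambda>x. real (Suc n) * x + t) has_real_derivative real (Suc n)) (at x)"
          by (auto intro!: derivative_eq_intros)
        from DERIV_cmult_right[OF DERIV_chain2[OF Q this], of "1 / real (Suc n)"]
        show ?thesis by (simp del: of_nat_Suc)
      qed
      show ?thesis
        unfolding r_def[abs_def] r'_def by (intro DERIV_cmult_right DERIV_cmult DERIV_add *)
    qed
    show "r n x = 0" if "x \<le> a" for n x
      using that ab by (simp add: r_alt q)
    show "r n x = 1" if x: "x \<ge> b + 1 / real (Suc n)" for n x
    proof -
      have "q (real (Suc n)) (x - a) = x - a - m / real (Suc n)"
        "q (real (Suc n)) (x - b) = x - b - m / real (Suc n)"
        using x ab by (intro q1; simp del: of_nat_Suc; linarith)+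
      then show ?thesis using ab by (simp add: r_alt)
    qed
    show "\<bar>r' n x\<bar> \<le> 1 / (b - a)" for n x
    proof -
      have "\<bar>S (real (Suc n) * (x - a)) - S (real (Suc n) * (x - b))\<bar> \<le> 1"
        using S(4,5) by (smt (verit, best))
      then show ?thesis using ab by (simp add: r'_alt abs_divide divide_right_mono)
    qed
    have lim: "(\<lambda>n. S (real (Suc n) * (x - t))) \<longlonglongrightarrow> (if x > t then 1 else 0)" for x t
    proof (cases "x > t")
      case True
      then obtain n0 where n0: "1 < real n0 * (x - t)"
        using reals_Archimedean3[of "x - t"] by auto
      have "S (real (Suc n) * (x - t)) = 1" if "n \<ge> n0" for n
      proof (rule S(3))
        have "real n0 * (x - t) \<le> real (Suc n) * (x - t)"
          using that True by (intro mult_right_mono) auto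
        with n0 show "1 \<le> real (Suc n) * (x - t)" by linarith
      qed
      then have "eventually (\<lambda>n. S (real (Suc n) * (x - t)) = 1) sequentially"
        using eventually_sequentially by blast
      then show ?thesis using True by (simp add: tendsto_eventually)
    next
      case False
      then have "S (real (Suc n) * (x - t)) = 0" for n
        by (intro S(2)) (simp add: mult_nonneg_nonpos)
      with False show ?thesis by simp
    qed
    show "(\<lambda>n. r' n x) \<longlonglongrightarrow> (if a < x \<and> x \<le> b then 1 / (b - a) else 0)" for x
    proof -
      have "(\<lambda>n. r' n x) \<longlonglongrightarrow> ((if x > a then 1 else 0) - (if x > b then 1 else 0)) / (b - a)"
        unfolding r'_alt by (intro tendsto_divide tendsto_diff lim tendsto_const) (use ab in auto)
      then show ?thesis using ab by (auto split: if_splits)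
    qed
  qed
qed

section \<open>Constancy of averages, and the continuous flux of a weak solution\<close>

lemma absolutely_integrable_mult_continuous:
  fixes U v :: "real \<Rightarrow> real"
  assumes "U absolutely_integrable_on {a..b}" "continuous_on {a..b} v"
  shows "(\<lambda>x. U x * v x) absolutely_integrable_on {a..b}"
proof -
  have "(\<lambda>x. v x * U x) absolutely_integrable_on {a..b}"
  proof (rule absolutely_integrable_bounded_measurable_product_real)
    show "v \<in> borel_measurable (lebesgue_on {a..b})"
      using assms(2) by (rule continuous_imp_measurable_on_sets_lebesgue) auto
    show "bounded (v ` {a..b})"
      using assms(2) by (intro compact_imp_bounded compact_continuous_image) auto
  qed (use assms in auto)
  then show ?thesis by (simp add: mult.commute)
qed

text \<open>Dominated convergence with majorant \<open>\<bar>U\<bar> / (b - a)\<close>: in the limit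
  a ramp derivative computes the average of \<open>U\<close> over \<open>[a, b]\<close>.\<close>

lemma ramp_integral_tendsto:
  fixes U :: "real \<Rightarrow> real"
  assumes U: "U absolutely_integrable_on {\<alpha>..\<beta>}" and ab: "a < b" "\<alpha> \<le> a" "b \<le> \<beta>"
    and r': "\<And>n. continuous_on {\<alpha>..\<beta>} (r' n)" "\<And>n x. \<bar>r' n x\<bar> \<le> 1 / (b - a)"
      "\<And>x. (\<lambda>n. r' n x) \<longlonglongrightarrow> (if a < x \<and> x \<le> b then 1 / (b - a) else 0)"
  shows "(\<lambda>n. integral {\<alpha>..\<beta>} (\<lambda>x. U x * r' n x)) \<longlonglongrightarrow> integral {a..b} U / (b - a)"
proof -
  let ?G = "\<lambda>x. U x * (if a < x \<and> x \<le> b then 1 / (b - a) else 0)"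
  have "(\<lambda>n. integral {\<alpha>..\<beta>} (\<lambda>x. U x * r' n x)) \<longlonglongrightarrow> integral {\<alpha>..\<beta>} ?G"
  proof (rule dominated_convergence(2)[where h="\<lambda>x. \<bar>U x\<bar> * (1 / (b - a))"])
    show "(\<lambda>x. U x * r' n x) integrable_on {\<alpha>..\<beta>}" for n
      using absolutely_integrable_mult_continuous[OF U r'(1)[of n]]
      by (rule set_lebesgue_integral_eq_integral(1))
    show "(\<lambda>x. \<bar>U x\<bar> * (1 / (b - a))) integrable_on {\<alpha>..\<beta>}"
      using U unfolding absolutely_integrable_on_def real_norm_def
      by (intro integrable_on_mult_left) auto
    show "norm (U x * r' n x) \<le> \<bar>U x\<bar> * (1 / (b - a))" for n x
      unfolding real_norm_def abs_mult by (intro mult_left_mono r'(2)) auto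
    show "(\<lambda>n. U x * r' n x) \<longlonglongrightarrow> ?G x" for x
      by (intro tendsto_mult_left r'(3))
  qed
  moreover have "(?G has_integral integral {a..b} U / (b - a)) {\<alpha>..\<beta>}"
  proof -
    have "U integrable_on {a..b}"
      using U ab unfolding absolutely_integrable_on_def
      by (meson atLeastatMost_subset_iff integrable_on_subinterval)
    then have "((\<lambda>x. U x * (1 / (b - a))) has_integral integral {a..b} U * (1 / (b - a))) {a..b}"
      by (intro has_integral_mult_left integrable_integral)
    then have "((\<lambda>x. if x \<in> {a..b} then U x * (1 / (b - a)) else 0) has_integral integral {a..b} U * (1 / (b - a))) {\<alpha>..\<beta>}"
      using ab by (subst has_integral_restrict) auto
    then have "(?G has_integral integral {a..b} U * (1 / (b - a))) {\<alpha>..\<beta>}"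
      by (rule has_integral_spike_finite[where S="{a}", rotated 2]) auto
    then show ?thesis by simp
  qed
  ultimately show ?thesis by (simp add: integral_unique)
qed

text \<open>Testing with the difference of two smoothed ramps shows in the limit that
  \<open>U\<close> has the same average over any two intervals; this common average is
  \<open>k\<close>. The conclusion is kept in integrated form, which is how it is used.\<close>

lemma du_bois_reymond:
  fixes U :: "real \<Rightarrow> real"
  assumes I: "open I" "is_interval I"
    and U: "\<And>a b. {a..b} \<subseteq> I \<Longrightarrow> U absolutely_integrable_on {a..b}"
    and weak: "\<And>\<psi>. test_function I \<psi> \<Longrightarrow> ((\<lambda>x. U x * deriv \<psi> x) has_integral 0) I"
  shows "\<exists>k. \<forall>a b. a \<le> b \<longrightarrow> {a..b} \<subseteq> I \<longrightarrow> (U has_integral k * (b - a)) {a..b}"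
proof -
  have avg: "integral {a..b} U / (b - a) = integral {a'..b'} U / (b' - a')"
    if ab: "a < b" "a \<in> I" "b \<in> I" and ab': "a' < b'" "a' \<in> I" "b' \<in> I" for a b a' b'
  proof -
    define \<alpha> where "\<alpha> = min a a'"
    \<comment> \<open>Leaves room to the right of both intervals: the ramps reach 1 slightly after
      \<open>b\<close> and \<open>b'\<close>, and only from there on do they cancel.\<close>
    have "max b b' \<in> I" using ab ab' by (auto simp: max_def)
    then obtain \<beta> where \<beta>: "max b b' < \<beta>" "\<beta> \<in> I"
      using I(1) open_interval_right_of by blast
    have "\<alpha> \<in> I" using ab ab' by (auto simp: \<alpha>_def min_def)
    then have sub: "{\<alpha>..\<beta>} \<subseteq> I" using I(2) \<beta>(2) by (intro Icc_subset_interval)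
    have \<alpha>: "\<alpha> \<le> a" "\<alpha> \<le> a'" and \<beta>': "b < \<beta>" "b' < \<beta>" using \<beta>(1) by (auto simp: \<alpha>_def)
    note Ui = U[OF sub]
    obtain r r' where r: "\<And>n. smooth_fn (r n)" "\<And>n. smooth_fn (r' n)"
      "\<And>n x. (r n has_real_derivative r' n x) (at x)"
      "\<And>n x. x \<le> a \<Longrightarrow> r n x = 0" "\<And>n x. x \<ge> b + 1 / real (Suc n) \<Longrightarrow> r n x = 1"
      "\<And>n x. \<bar>r' n x\<bar> \<le> 1 / (b - a)"
      "\<And>x. (\<lambda>n. r' n x) \<longlonglongrightarrow> (if a < x \<and> x \<le> b then 1 / (b - a) else 0)"
      using smooth_ramps[OF ab(1)] by metis
    obtain q q' where q: "\<And>n. smooth_fn (q n)" "\<And>n. smooth_fn (q' n)"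
      "\<And>n x. (q n has_real_derivative q' n x) (at x)"
      "\<And>n x. x \<le> a' \<Longrightarrow> q n x = 0" "\<And>n x. x \<ge> b' + 1 / real (Suc n) \<Longrightarrow> q n x = 1"
      "\<And>n x. \<bar>q' n x\<bar> \<le> 1 / (b' - a')"
      "\<And>x. (\<lambda>n. q' n x) \<longlonglongrightarrow> (if a' < x \<and> x \<le> b' then 1 / (b' - a') else 0)"
      using smooth_ramps[OF ab'(1)] by metis
    have "(\<lambda>n. integral {\<alpha>..\<beta>} (\<lambda>x. U x * r' n x)) \<longlonglongrightarrow> integral {a..b} U / (b - a)"
      using \<alpha> \<beta>' by (intro ramp_integral_tendsto[OF Ui ab(1)] smooth_fn_continuous_on r) auto
    moreover have "(\<lambda>n. integral {\<alpha>..\<beta>} (\<lambda>x. U x * q' n x)) \<longlonglongrightarrow> integral {a'..b'} U / (b' - a')"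
      using \<alpha> \<beta>' by (intro ramp_integral_tendsto[OF Ui ab'(1)] smooth_fn_continuous_on q) auto
    ultimately have "(\<lambda>n. integral {\<alpha>..\<beta>} (\<lambda>x. U x * r' n x) - integral {\<alpha>..\<beta>} (\<lambda>x. U x * q' n x))
        \<longlonglongrightarrow> integral {a..b} U / (b - a) - integral {a'..b'} U / (b' - a')"
      by (rule tendsto_diff)
    moreover have "eventually (\<lambda>n. integral {\<alpha>..\<beta>} (\<lambda>x. U x * r' n x) - integral {\<alpha>..\<beta>} (\<lambda>x. U x * q' n x) = 0) sequentially"
    proof -
      obtain n0 where n0: "n0 > 0" "1 / real n0 < \<beta> - max b b'"
        using \<beta>(1) by (metis diff_gt_0_iff_gt nat_approx_posE inverse_eq_divide zero_less_Suc)
      have "integral {\<alpha>..\<beta>} (\<lambda>x. U x * r' n x) - integral {\<alpha>..\<beta>} (\<lambda>x. U x * q' n x) = 0" if n: "n \<ge> n0" for n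
      proof -
        have "1 / real (Suc n) \<le> 1 / real n0" using n n0(1) by (intro divide_left_mono) auto
        then have big: "b + 1 / real (Suc n) < \<beta>" "b' + 1 / real (Suc n) < \<beta>" using n0(2) by linarith+
        define \<psi> where "\<psi> x = r n x + (-1) * q n x" for x
        define \<psi>' where "\<psi>' x = r' n x - q' n x" for x
        have \<psi>s: "smooth_fn \<psi>" unfolding \<psi>_def[abs_def]
          by (intro smooth_fn.add smooth_fn.mult smooth_fn.const r q)
        have \<psi>0: "\<psi> x = 0" if "x \<notin> {\<alpha><..<\<beta>}" for x
        proof (cases "x \<le> \<alpha>")
          case True then show ?thesis using \<alpha> r(4) q(4) by (simp add: \<psi>_def)
        next
          case False
          then have "\<beta> \<le> x" using that by auto
          then show ?thesis using big r(5)[of n x] q(5)[of n x] by (simp add: \<psi>_def del: of_nat_Suc)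
        qed
        have \<psi>d: "(\<psi> has_real_derivative \<psi>' x) (at x)" for x
          unfolding \<psi>_def[abs_def] \<psi>'_def by (auto intro!: derivative_eq_intros r(3) q(3))
        then have deriv: "deriv \<psi> x = \<psi>' x" for x by (rule DERIV_imp_deriv)
        have \<psi>'0: "\<psi>' x = 0" if "x \<notin> {\<alpha>..\<beta>}" for x
        proof -
          have "((\<lambda>_. 0) has_real_derivative 0) (at x)" by simp
          then have "(\<psi> has_real_derivative 0) (at x)"
            by (rule has_field_derivative_transform_within_open[where S="- {\<alpha>..\<beta>}"])
               (use that \<psi>0 in \<open>auto simp: open_Compl\<close>)
          then show ?thesis using \<psi>d DERIV_unique by blast
        qed
        have "test_function I \<psi>"
          by (rule smooth_fn_test_function[OF \<psi>s sub]) (rule \<psi>0, auto)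
        from weak[OF this] have z: "((\<lambda>x. U x * \<psi>' x) has_integral 0) I" by (simp add: deriv)
        have ir: "(\<lambda>x. U x * r' n x) integrable_on {\<alpha>..\<beta>}" "(\<lambda>x. U x * q' n x) integrable_on {\<alpha>..\<beta>}"
          using absolutely_integrable_mult_continuous[OF Ui smooth_fn_continuous_on[OF r(2)]]
            absolutely_integrable_mult_continuous[OF Ui smooth_fn_continuous_on[OF q(2)]]
          by (auto intro: set_lebesgue_integral_eq_integral(1))
        let ?J = "integral {\<alpha>..\<beta>} (\<lambda>x. U x * r' n x) - integral {\<alpha>..\<beta>} (\<lambda>x. U x * q' n x)"
        have "((\<lambda>x. U x * r' n x - U x * q' n x) has_integral ?J) {\<alpha>..\<beta>}"
          by (intro has_integral_diff integrable_integral ir)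
        then have "((\<lambda>x. U x * \<psi>' x) has_integral ?J) {\<alpha>..\<beta>}"
          by (simp add: \<psi>'_def right_diff_distrib)
        then have "((\<lambda>x. U x * \<psi>' x) has_integral ?J) I"
          by (rule has_integral_on_superset) (use \<psi>'0 sub in auto)
        from has_integral_unique[OF this z] show ?thesis .
      qed
      then show ?thesis using eventually_sequentially by blast
    qed
    ultimately have "integral {a..b} U / (b - a) - integral {a'..b'} U / (b' - a') = 0"
      by (rule LIMSEQ_unique[OF _ tendsto_eventually])
    then show ?thesis by simp
  qed
  show ?thesis
  proof (cases "\<exists>a\<in>I. \<exists>b\<in>I. a < b")
    case True
    then obtain a0 b0 where 0: "a0 < b0" "a0 \<in> I" "b0 \<in> I" by blast
    show ?thesis
    proof (intro exI[of _ "integral {a0..b0} U / (b0 - a0)"] allI impI)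
      fix a b :: real assume ab: "a \<le> b" "{a..b} \<subseteq> I"
      have "U integrable_on {a..b}" using U[OF ab(2)] by (simp add: absolutely_integrable_on_def)
      then have "(U has_integral integral {a..b} U) {a..b}" by (rule integrable_integral)
      moreover have "integral {a..b} U = integral {a0..b0} U / (b0 - a0) * (b - a)"
      proof (cases "a = b")
        case False
        then have "a < b" "a \<in> I" "b \<in> I" using ab by auto
        from avg[OF 0 this] this(1) show ?thesis by (simp add: field_simps)
      qed auto
      ultimately show "(U has_integral integral {a0..b0} U / (b0 - a0) * (b - a)) {a..b}" by simp
    qed
  next
    case False
    show ?thesis
    proof (intro exI allI impI)
      fix a b :: real assume ab: "a \<le> b" "{a..b} \<subseteq> I"
      then have "a \<in> I" "b \<in> I" by auto
      with False ab have "a = b" by force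
      then show "(U has_integral 0 * (b - a)) {a..b}"
        using has_integral_refl(2)[of U b] by simp
    qed
  qed
qed

text \<open>The finite set \<open>E\<close> admits the front of a profile, at which the flux need
  not be differentiable; continuity of \<open>w\<close> prevents a boundary term there.\<close>

lemma test_function_integrate_by_parts:
  fixes w :: "real \<Rightarrow> real"
  assumes I: "open I" and \<psi>: "test_function I \<psi>" and I2: "is_interval I"
    and w: "continuous_on I w" and E: "finite E"
    and w': "\<And>x. x \<in> I - E \<Longrightarrow> (w has_real_derivative w' x) (at x)"
  shows "((\<lambda>x. w x * deriv \<psi> x + w' x * \<psi> x) has_integral 0) I"
proof -
  define K where "K = closure {x. \<psi> x \<noteq> 0}"
  have K: "compact K" "K \<subseteq> I" using \<psi> by (auto simp: test_function_def K_def)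
  have "((deriv ^^ 0) \<psi>) differentiable (at x)" for x
    using \<psi> unfolding test_function_def by blast
  then have \<psi>d: "(\<psi> has_real_derivative deriv \<psi> x) (at x)" for x
    by (simp add: DERIV_deriv_iff_real_differentiable)
  have \<psi>0: "\<psi> x = 0" if "x \<notin> K" for x
    using that closure_subset[of "{x. \<psi> x \<noteq> 0}"] unfolding K_def by blast
  have \<psi>'0: "deriv \<psi> x = 0" if "x \<notin> K" for x
  proof -
    have "((\<lambda>_. 0) has_real_derivative 0) (at x)" by simp
    then have "(\<psi> has_real_derivative 0) (at x)"
      by (rule has_field_derivative_transform_within_open[where S="- K"])
         (use that \<psi>0 in \<open>auto simp: open_Compl compact_imp_closed[OF K(1)]\<close>)
    then show ?thesis by (rule DERIV_imp_deriv)
  qed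
  show ?thesis
  proof (cases "K = {}")
    case True
    then show ?thesis using \<psi>0 \<psi>'0 by simp
  next
    case False
    obtain l where l: "l \<in> K" "\<And>x. x \<in> K \<Longrightarrow> l \<le> x" using compact_attains_inf[OF K(1) False] by blast
    obtain u where u: "u \<in> K" "\<And>x. x \<in> K \<Longrightarrow> x \<le> u" using compact_attains_sup[OF K(1) False] by blast
    \<comment> \<open>The hull of the support is enlarged inside \<open>I\<close>, so that
      \<open>\<psi>\<close> vanishes at both ends and no boundary terms remain.\<close>
    obtain a where a: "a < l" "a \<in> I" using open_interval_left_of[OF I, of l] K(2) l(1) by blast
    obtain b where b: "u < b" "b \<in> I" using open_interval_right_of[OF I, of u] K(2) u(1) by blast
    have sub: "{a..b} \<subseteq> I" by (rule Icc_subset_interval[OF I2 a(2) b(2)])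
    have out: "x \<notin> K" if "x \<le> a \<or> b \<le> x" for x using that a b l(2)[of x] u(2)[of x] by auto
    have "((\<lambda>x. w x * deriv \<psi> x + w' x * \<psi> x) has_integral w b * \<psi> b - w a * \<psi> a) {a..b}"
    proof (rule fundamental_theorem_of_calculus_interior_strong[OF E])
      show "a \<le> b" using a(1) b(1) l(2)[OF u(1)] by linarith
      show "((\<lambda>x. w x * \<psi> x) has_vector_derivative w x * deriv \<psi> x + w' x * \<psi> x) (at x)"
        if "x \<in> {a<..<b} - E" for x
      proof -
        have "x \<in> I - E" using that sub by (auto intro: subsetD[OF sub])
        then show ?thesis
          using w'[of x] \<psi>d[of x] unfolding has_real_derivative_iff_has_vector_derivative[symmetric]
          by (intro DERIV_mult') auto
      qed
      show "continuous_on {a..b} (\<lambda>x. w x * \<psi> x)"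
        by (intro continuous_on_mult continuous_on_subset[OF w sub])
          (use \<psi>d in \<open>auto intro: DERIV_isCont continuous_at_imp_continuous_on\<close>)
    qed
    then have "((\<lambda>x. w x * deriv \<psi> x + w' x * \<psi> x) has_integral 0) {a..b}"
      using out \<psi>0 by simp
    then show ?thesis
      by (rule has_integral_on_superset) (use out \<psi>0 \<psi>'0 sub in auto)
  qed
qed

text \<open>The weak equation only says that the flux \<open>D(\<phi>) \<phi>'\<close> agrees almost everywhere with a
  function \<open>y\<close> such that \<open>y - f(\<phi>) + c \<phi>\<close> is continuously differentiable.\<close>
lemma tw_profile_flux:
  assumes adm: "admissible_data R f h D D' g" and tw: "tw_profile R f D g c I \<phi>"
  obtains y where "continuous_on I y"
    "\<And>\<xi>. \<xi> \<in> I \<Longrightarrow> ((\<lambda>\<xi>. y \<xi> - (f (\<phi> \<xi>) - c * \<phi> \<xi>)) has_real_derivative - g (\<phi> \<xi>)) (at \<xi>)"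
    "\<And>a b. a \<le> b \<Longrightarrow> {a..b} \<subseteq> I \<Longrightarrow>
       ((\<lambda>\<xi>. D (\<phi> \<xi>) * deriv \<phi> \<xi>) has_integral integral {a..b} y) {a..b}"
proof -
  have I: "open I" "is_interval I" and \<phi>R: "\<phi> ` I \<subseteq> {0..R}" and \<phi>c: "continuous_on I \<phi>"
    and vi: "\<And>a b. {a..b} \<subseteq> I \<Longrightarrow> (\<lambda>\<xi>. D (\<phi> \<xi>) * deriv \<phi> \<xi>) absolutely_integrable_on {a..b}"
    and weak: "\<And>\<psi>. test_function I \<psi> \<Longrightarrow>
        ((\<lambda>\<xi>. (D (\<phi> \<xi>) * deriv \<phi> \<xi> - f (\<phi> \<xi>) + c * \<phi> \<xi>) * deriv \<psi> \<xi> - g (\<phi> \<xi>) * \<psi> \<xi>)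
           has_integral 0) I"
    using tw by (auto simp: tw_profile_def)
  have gc: "continuous_on I (\<lambda>\<xi>. - g (\<phi> \<xi>))"
    using adm \<phi>R by (intro continuous_intros continuous_on_compose2[OF _ \<phi>c])
      (auto simp: admissible_data_def)
  have "continuous_on {0..R} f"
    using adm unfolding admissible_data_def C1_with_deriv_def by (meson DERIV_continuous_on)
  then have fc: "continuous_on I (\<lambda>\<xi>. f (\<phi> \<xi>) - c * \<phi> \<xi>)"
    using \<phi>R \<phi>c by (intro continuous_intros continuous_on_compose2[OF _ \<phi>c]) auto
  obtain W where W: "\<And>\<xi>. \<xi> \<in> I \<Longrightarrow> (W has_real_derivative - g (\<phi> \<xi>)) (at \<xi>)"
    using antiderivative_on_open_interval[OF I gc] by blast
  then have Wc: "continuous_on I W"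
    by (meson DERIV_isCont continuous_at_imp_continuous_on)
  \<comment> \<open>Integrating \<open>W\<close> by parts against \<open>\<psi>\<close> turns the
    source term into a multiple of \<open>\<psi>'\<close>; the weak equation then says that
    \<open>U\<close> is orthogonal to every \<open>\<psi>'\<close>.\<close>
  define U where "U \<xi> = D (\<phi> \<xi>) * deriv \<phi> \<xi> - ((f (\<phi> \<xi>) - c * \<phi> \<xi>) + W \<xi>)" for \<xi>
  have "\<exists>k. \<forall>a b. a \<le> b \<longrightarrow> {a..b} \<subseteq> I \<longrightarrow> (U has_integral k * (b - a)) {a..b}"
  proof (rule du_bois_reymond[OF I])
    fix a b assume ab: "{a..b} \<subseteq> I"
    show "U absolutely_integrable_on {a..b}"
      unfolding U_def[abs_def]
      by (intro set_integral_diff vi[OF ab] absolutely_integrable_continuous_real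
          continuous_on_subset[OF continuous_on_add[OF fc Wc] ab])
  next
    fix \<psi> assume \<psi>: "test_function I \<psi>"
    have "((\<lambda>x. W x * deriv \<psi> x + - g (\<phi> x) * \<psi> x) has_integral 0) I"
      by (rule test_function_integrate_by_parts[OF I(1) \<psi> I(2) Wc, of "{}"]) (use W in auto)
    from has_integral_diff[OF weak[OF \<psi>] this]
    show "((\<lambda>x. U x * deriv \<psi> x) has_integral 0) I"
      by (simp add: U_def algebra_simps)
  qed
  then obtain k where k: "\<And>a b. a \<le> b \<Longrightarrow> {a..b} \<subseteq> I \<Longrightarrow> (U has_integral k * (b - a)) {a..b}"
    by blast
  define y where "y \<xi> = k + ((f (\<phi> \<xi>) - c * \<phi> \<xi>) + W \<xi>)" for \<xi>
  show ?thesis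
  proof
    show yc: "continuous_on I y" unfolding y_def by (intro continuous_on_add continuous_on_const fc Wc)
    show "((\<lambda>\<xi>. y \<xi> - (f (\<phi> \<xi>) - c * \<phi> \<xi>)) has_real_derivative - g (\<phi> \<xi>)) (at \<xi>)" if "\<xi> \<in> I" for \<xi>
      using W[OF that] unfolding y_def by (auto intro!: derivative_eq_intros)
    fix a b :: real assume ab: "a \<le> b" "{a..b} \<subseteq> I"
    have "(y has_integral integral {a..b} y) {a..b}"
      by (intro integrable_integral integrable_continuous_real continuous_on_subset[OF yc ab(2)])
    moreover have "((\<lambda>x. U x - k) has_integral k * (b - a) - k * (b - a)) {a..b}"
      using has_integral_const_real[of k a b] ab(1)
      by (intro has_integral_diff k ab) (simp add: mult.commute)
    ultimately have "((\<lambda>\<xi>. (U \<xi> - k) + y \<xi>) has_integral 0 + integral {a..b} y) {a..b}"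
      by (intro has_integral_add) auto
    then show "((\<lambda>\<xi>. D (\<phi> \<xi>) * deriv \<phi> \<xi>) has_integral integral {a..b} y) {a..b}"
      by (simp add: U_def y_def)
  qed
qed

section \<open>The phase plane trajectory\<close>

locale wave_data =
  fixes R c :: real and f h D D' g :: "real \<Rightarrow> real"
  assumes adm: "admissible_data R f h D D' g"
begin

lemma R_pos: "0 < R"
  and D_pos: "0 < s \<Longrightarrow> s < R \<Longrightarrow> 0 < D s"
  and g_neg: "0 < s \<Longrightarrow> s \<le> R \<Longrightarrow> g s < 0"
  and g_0: "g 0 = 0"
  and g_cont: "continuous_on {0..R} g"
  and h_cont: "continuous_on {0..R} h"
  and D'_cont: "continuous_on {0..R} D'"
  and f_deriv: "s \<in> {0..R} \<Longrightarrow> (f has_real_derivative h s) (at s within {0..R})"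
  and D_deriv: "s \<in> {0..R} \<Longrightarrow> (D has_real_derivative D' s) (at s within {0..R})"
  using adm by (auto simp: admissible_data_def C1_with_deriv_def)

lemma D_cont: "continuous_on {0..R} D"
  using D_deriv by (rule DERIV_continuous_on)

lemma f_cont: "continuous_on {0..R} f"
  using f_deriv by (rule DERIV_continuous_on)

lemma f_deriv_interior: "0 < s \<Longrightarrow> s < R \<Longrightarrow> (f has_real_derivative h s) (at s)"
  using f_deriv[of s] by (simp add: at_within_Icc_at)

lemma D_deriv_interior: "0 < s \<Longrightarrow> s < R \<Longrightarrow> (D has_real_derivative D' s) (at s)"
  using D_deriv[of s] by (simp add: at_within_Icc_at)

lemma D_nonneg:
  assumes "0 \<le> s" "s \<le> R"
  shows "0 \<le> D s"
proof -
  have "closure {0<..<R} \<subseteq> {0..R} \<inter> D -` {0..}"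
  proof (rule closure_minimal)
    show "closed ({0..R} \<inter> D -` {0..})"
      by (rule continuous_closed_preimage[OF D_cont]) auto
    show "{0<..<R} \<subseteq> {0..R} \<inter> D -` {0..}"
      using less_imp_le[OF D_pos] by auto
  qed
  then show ?thesis using R_pos assms by (auto simp: closure_greaterThanLessThan)
qed

text \<open>The convective flux in the frame moving with speed \<open>c\<close>.\<close>

definition F :: "real \<Rightarrow> real" where "F s = f s - c * s"

lemma F_cont: "continuous_on {0..R} F"
  unfolding F_def by (intro continuous_intros f_cont)

lemma F_deriv: "0 < s \<Longrightarrow> s < R \<Longrightarrow> (F has_real_derivative h s - c) (at s)"
  unfolding F_def[abs_def] by (auto intro!: derivative_eq_intros f_deriv_interior)

lemma F_lipschitz:
  obtains L where "\<And>x y. x \<in> {0..R} \<Longrightarrow> y \<in> {0..R} \<Longrightarrow> \<bar>F x - F y\<bar> \<le> L * \<bar>x - y\<bar>"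
proof -
  have "continuous_on {0..R} (\<lambda>s. h s - c)" by (intro continuous_intros h_cont)
  then obtain L where L: "\<And>s. s \<in> {0..R} \<Longrightarrow> norm (h s - c) \<le> L"
    using continuous_on_Icc_bounded unfolding real_norm_def by metis
  have "norm (F x - F y) \<le> L * norm (x - y)" if "x \<in> {0..R}" "y \<in> {0..R}" for x y
  proof (rule field_differentiable_bound[OF _ _ L that])
    show "(F has_field_derivative h s - c) (at s within {0..R})" if "s \<in> {0..R}" for s
      unfolding F_def[abs_def] by (auto intro!: derivative_eq_intros f_deriv that)
  qed auto
  then show ?thesis by (intro that[of L]) simp
qed

text \<open>The equation for \<open>z\<close> is singular at \<open>z = 0\<close>; its square \<open>y = z\<^sup>2\<close> satisfies
  \<open>y' = 2 (h - c) \<surd>y - 2 D g\<close>, whose right-hand side is continuous.\<close>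
lemma trajectory_exists:
  obtains z where "continuous_on {0..R} z" "z 0 = 0" "0 \<le> z R"
    "\<And>s. 0 < s \<Longrightarrow> s < R \<Longrightarrow> 0 < z s"
    "\<And>s. 0 < s \<Longrightarrow> s < R \<Longrightarrow> (z has_real_derivative h s - c - D s * g s / z s) (at s)"
proof -
  \<comment> \<open>Clamping the state to \<open>[0, R]\<close> extends the data continuously to the
    whole line, as the existence theorem requires.\<close>
  define p where "p s = max 0 (min R s)" for s
  define P where "P s = - (D s * g s)" for s
  define k where "k s = h s - c" for s
  have pR: "p s \<in> {0..R}" for s using R_pos by (auto simp: p_def)
  have p_id: "p s = s" if "s \<in> {0..R}" for s using that by (simp add: p_def)
  have P0: "0 \<le> P s" if "s \<in> {0..R}" for s
    using that D_nonneg[of s] g_neg[of s] g_0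
    by (cases "s = 0") (auto simp: P_def mult_nonneg_nonpos)
  have Pc: "continuous_on {0..R} P" unfolding P_def by (intro continuous_intros D_cont g_cont)
  have kc: "continuous_on {0..R} k" unfolding k_def by (intro continuous_intros h_cont)
  obtain K where K: "\<And>s. s \<in> {0..R} \<Longrightarrow> \<bar>k s\<bar> \<le> K"
    using continuous_on_Icc_bounded[OF kc] unfolding real_norm_def by metis
  obtain N where N: "\<And>s. s \<in> {0..R} \<Longrightarrow> \<bar>P s\<bar> \<le> N"
    using continuous_on_Icc_bounded[OF Pc] unfolding real_norm_def by metis
  have "0 \<in> {0..R}" using R_pos by simp
  from K[OF this] N[OF this] have K0: "0 \<le> K" and N0: "0 \<le> N" by linarith+
  \<comment> \<open>Large enough that a solution with slope at most \<open>2 * K * b + 2 * N\<close>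
    stays below \<open>b^2\<close> on \<open>[0, R]\<close>. The cut-off of the square root in
    \<open>G\<close> makes \<open>G\<close> bounded and is inactive along the solution.\<close>
  define b where "b = 2 * R * K + 2 * N * R + 1"
  have b1: "1 \<le> b" using K0 N0 R_pos by (simp add: b_def)
  have b2: "R * (2 * K * b + 2 * N) \<le> b^2"
  proof -
    have "2 * N * R * 1 \<le> 2 * N * R * b" using b1 N0 R_pos by (intro mult_left_mono) auto
    then have "R * (2 * K * b + 2 * N) \<le> (2 * R * K + 2 * N * R) * b" by (simp add: algebra_simps)
    also have "\<dots> \<le> b * b" using b1 by (intro mult_right_mono) (auto simp: b_def)
    finally show ?thesis by (simp add: power2_eq_square)
  qed
  define G where "G = (\<lambda>(s, y). 2 * k (p s) * sqrt (min (max y 0) (b^2)) + 2 * P (p s))"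
  have pc: "continuous_on UNIV (\<lambda>x :: real \<times> real. p (fst x))"
    unfolding p_def by (intro continuous_intros)
  have Gc: "continuous_on UNIV G"
    unfolding G_def case_prod_unfold
    by (intro continuous_intros continuous_on_compose2[OF kc pc] continuous_on_compose2[OF Pc pc])
       (use pR in auto)
  have GM: "\<bar>G x\<bar> \<le> 2 * K * b + 2 * N" for x
  proof (cases x)
    case (Pair s y)
    let ?q = "sqrt (min (max y 0) (b^2))"
    have q: "0 \<le> ?q" "?q \<le> b"
      using b1 by (auto intro!: real_le_lsqrt)
    have "\<bar>G x\<bar> \<le> 2 * (\<bar>k (p s)\<bar> * ?q) + 2 * \<bar>P (p s)\<bar>"
      using abs_triangle_ineq[of "2 * k (p s) * ?q" "2 * P (p s)"] q(1)
      by (simp add: G_def Pair abs_mult)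
    moreover have "\<bar>k (p s)\<bar> * ?q \<le> K * b" using K[OF pR] q K0 by (intro mult_mono) auto
    moreover have "\<bar>P (p s)\<bar> \<le> N" using N[OF pR] .
    ultimately show ?thesis by linarith
  qed
  obtain y where y0: "y 0 = 0"
    and y: "\<And>s. s \<in> {0..R} \<Longrightarrow> (y has_real_derivative G (s, y s)) (at s within {0..R})"
    using peano_existence[OF Gc GM, of R] by blast
  have yc: "continuous_on {0..R} y" using y by (rule DERIV_continuous_on)
  have yi: "(y has_real_derivative G (s, y s)) (at s)" if "0 < s" "s < R" for s
    using y[of s] that by (simp add: at_within_Icc_at)
  have y_le: "y s \<le> b^2" if s: "s \<in> {0..R}" for s
  proof (cases "s = 0")
    case False
    then have "0 < s" using s by simp
    moreover have "continuous_on {0..s} y" using yc s by (auto intro: continuous_on_subset)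
    ultimately obtain t where t: "0 < t" "t < s" "y s - y 0 = (s - 0) * G (t, y t)"
      by (rule MVT_interior) (use yi s in auto)
    have "y s \<le> s * \<bar>G (t, y t)\<bar>" using t(3) y0 s by (simp add: mult_left_mono)
    also have "\<dots> \<le> R * (2 * K * b + 2 * N)"
      using s GM by (intro mult_mono) auto
    finally show ?thesis using b2 by linarith
  qed (use y0 in simp)
  \<comment> \<open>Where \<open>y\<close> is negative the square root term is cut off to 0 and
    \<open>G = 2 P \<ge> 0\<close>, so \<open>y\<close> cannot have decreased since its last
    nonnegative value.\<close>
  have y_nonneg: "0 \<le> y s" if s: "s \<in> {0..R}" for s
  proof (rule ccontr)
    assume neg: "\<not> 0 \<le> y s"
    have "continuous_on {0..s} (\<lambda>x. - y x)"
      using yc s by (auto intro!: continuous_intros intro: continuous_on_subset)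
    then obtain t where t: "0 \<le> t" "t < s" "- y t \<le> 0" "\<And>x. t < x \<Longrightarrow> x \<le> s \<Longrightarrow> 0 < - y x"
      by (rule last_nonpos_point) (use s neg y0 in auto)
    have "continuous_on {t..s} y" using yc s t by (auto intro: continuous_on_subset)
    then obtain x where x: "t < x" "x < s" "y s - y t = (s - t) * G (x, y x)"
      by (rule MVT_interior[OF t(2)]) (use yi s t(1) in auto)
    have "y x < 0" using t(4)[of x] x by simp
    moreover have "0 \<le> P (p x)" using P0 pR by simp
    ultimately have "0 \<le> G (x, y x)" by (simp add: G_def)
    with x(3) t(2) have "y t \<le> y s" by (metis diff_ge_0_iff_ge less_imp_le mult_nonneg_nonneg)
    with t(3) neg show False by simp
  qed
  \<comment> \<open>An interior zero would be a minimum with derivative 0, whereas the equation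
    gives the derivative \<open>2 P s > 0\<close> there.\<close>
  have y_pos: "0 < y s" if s: "0 < s" "s < R" for s
  proof (rule ccontr)
    assume "\<not> 0 < y s"
    then have ys: "y s = 0" using y_nonneg[of s] s by simp
    define d where "d = min s (R - s)"
    have "G (s, y s) = 0"
    proof (rule DERIV_local_min[OF yi[OF s]])
      show "0 < d" using s by (simp add: d_def)
      show "\<forall>x. \<bar>s - x\<bar> < d \<longrightarrow> y s \<le> y x"
        using ys y_nonneg by (intro allI impI) (auto simp: d_def abs_less_iff)
    qed
    moreover have "0 < P s" using D_pos[OF s] g_neg[of s] s by (simp add: P_def mult_pos_neg)
    ultimately show False using ys s by (simp add: G_def p_id)
  qed
  define z where "z s = sqrt (y s)" for s
  show ?thesis
  proof (rule that[of z])
    show "continuous_on {0..R} z" unfolding z_def by (intro continuous_intros yc)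
    show "z 0 = 0" "0 \<le> z R" using y0 y_nonneg[of R] R_pos by (auto simp: z_def)
    show "0 < z s" if "0 < s" "s < R" for s using y_pos that by (simp add: z_def)
    show "(z has_real_derivative h s - c - D s * g s / z s) (at s)" if s: "0 < s" "s < R" for s
    proof -
      have ys: "0 < y s" by (rule y_pos[OF s])
      have Gs: "G (s, y s) = 2 * k s * sqrt (y s) + 2 * P s"
        using s ys y_le[of s] by (simp add: G_def p_id min_def max_def)
      have "(z has_real_derivative inverse (sqrt (y s)) / 2 * G (s, y s)) (at s)"
        unfolding z_def[abs_def] by (rule DERIV_chain2[OF DERIV_real_sqrt[OF ys] yi[OF s]])
      moreover have "inverse (sqrt (y s)) / 2 * G (s, y s) = h s - c - D s * g s / z s"
        using ys by (simp add: Gs z_def k_def P_def field_simps)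
      ultimately show ?thesis by (simp only:)
    qed
  qed
qed

end

section \<open>The profile of a trajectory\<close>

locale trajectory = wave_data +
  fixes z :: "real \<Rightarrow> real"
  assumes z_cont: "continuous_on {0..R} z" and z_0: "z 0 = 0" and z_R: "0 \<le> z R"
    and z_pos: "0 < s \<Longrightarrow> s < R \<Longrightarrow> 0 < z s"
    and z_deriv: "0 < s \<Longrightarrow> s < R \<Longrightarrow> (z has_real_derivative h s - c - D s * g s / z s) (at s)"
begin

text \<open>The time map: \<open>T s\<close> is the position at which the profile takes the value
  \<open>s\<close>. The unspecified additive constant is the freedom of shifts.\<close>

definition T :: "real \<Rightarrow> real" where
  "T = (SOME T. \<forall>s\<in>{0<..<R}. (T has_real_derivative D s / z s) (at s))"

lemma T_deriv: "0 < s \<Longrightarrow> s < R \<Longrightarrow> (T has_real_derivative D s / z s) (at s)"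
proof -
  have "continuous_on {0<..<R} (\<lambda>s. D s / z s)"
    by (intro continuous_on_divide continuous_on_subset[OF D_cont] continuous_on_subset[OF z_cont])
       (use z_pos less_imp_neq in fastforce)+
  then have "\<exists>T. \<forall>s\<in>{0<..<R}. (T has_real_derivative D s / z s) (at s)"
    by (intro antiderivative_on_open_interval) (auto simp: is_interval_oo)
  from someI_ex[OF this] show "0 < s \<Longrightarrow> s < R \<Longrightarrow> ?thesis"
    unfolding T_def[symmetric] by simp
qed

lemma T_cont: "0 < a \<Longrightarrow> b < R \<Longrightarrow> continuous_on {a..b} T"
  by (intro continuous_at_imp_continuous_on ballI DERIV_isCont[OF T_deriv]) auto

lemma T_MVT:
  assumes "0 < a" "a < b" "b < R"
  obtains s where "a < s" "s < b" "T b - T a = (b - a) * (D s / z s)"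
  by (rule MVT_interior[OF assms(2) T_cont[OF assms(1,3)], of "\<lambda>s. D s / z s"])
     (use T_deriv assms that in auto)

lemma T_less:
  assumes "0 < a" "a < b" "b < R"
  shows "T a < T b"
proof -
  obtain s where s: "a < s" "s < b" "T b - T a = (b - a) * (D s / z s)" using T_MVT[OF assms] .
  then have "0 < (b - a) * (D s / z s)"
    using assms D_pos[of s] z_pos[of s] by (intro mult_pos_pos divide_pos_pos) auto
  with s show ?thesis by simp
qed

lemma T_le_iff: "0 < a \<Longrightarrow> a < R \<Longrightarrow> 0 < b \<Longrightarrow> b < R \<Longrightarrow> T a \<le> T b \<longleftrightarrow> a \<le> b"
  using T_less[of a b] T_less[of b a] by (cases a b rule: linorder_cases) auto

lemma T_less_iff: "0 < a \<Longrightarrow> a < R \<Longrightarrow> 0 < b \<Longrightarrow> b < R \<Longrightarrow> T a < T b \<longleftrightarrow> a < b"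
  using T_le_iff[of b a] by auto

lemma zF_cont: "continuous_on {0..R} (\<lambda>s. z s - F s)"
  by (intro continuous_intros z_cont F_cont)

lemma zF_deriv: "0 < s \<Longrightarrow> s < R \<Longrightarrow> ((\<lambda>s. z s - F s) has_real_derivative - D s * g s / z s) (at s)"
  by (rule DERIV_cong[OF DERIV_diff[OF z_deriv F_deriv]]) auto

text \<open>Since \<open>(z - F)' = - g T'\<close> and \<open>- g\<close> is bounded away from 0 near \<open>R\<close>, the profile
  reaches \<open>R\<close> in finite time.\<close>
lemma T_bdd_above: "bdd_above (T ` {0<..<R})"
proof -
  define m where "m = R / 2"
  have m: "0 < m" "m < R" using R_pos by (auto simp: m_def)
  have "continuous_on {m..R} (\<lambda>s. - g s)"
    using m by (intro continuous_intros continuous_on_subset[OF g_cont]) auto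
  then obtain s0 where s0: "s0 \<in> {m..R}" "\<And>s. s \<in> {m..R} \<Longrightarrow> - g s0 \<le> - g s"
    using continuous_attains_inf[of "{m..R}" "\<lambda>s. - g s"] m by auto
  define \<eta> where "\<eta> = - g s0"
  have \<eta>: "0 < \<eta>" using g_neg[of s0] s0(1) m by (auto simp: \<eta>_def)
  obtain B where B: "\<And>s. s \<in> {0..R} \<Longrightarrow> norm (z s - F s) \<le> B"
    using continuous_on_Icc_bounded[OF zF_cont] unfolding real_norm_def by metis
  have le: "T s \<le> T m + 2 * B / \<eta>" if s: "m < s" "s < R" for s
  proof -
    \<comment> \<open>\<open>T - (z - F) / \<eta>\<close> has the derivative
      \<open>(D / z) * (1 + g / \<eta>)\<close>, which is nonpositive because
      \<open>- g \<ge> \<eta>\<close> on \<open>[m, R]\<close>; and \<open>z - F\<close> is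
      bounded.\<close>
    have "continuous_on {m..s} (\<lambda>s. T s - (z s - F s) / \<eta>)"
      using m s \<eta> by (intro continuous_intros T_cont continuous_on_subset[OF zF_cont, unfolded]
        continuous_on_subset[OF z_cont] continuous_on_subset[OF F_cont]) auto
    then obtain x where x: "m < x" "x < s"
      "(T s - (z s - F s) / \<eta>) - (T m - (z m - F m) / \<eta>) = (s - m) * (D x / z x - (- D x * g x / z x) / \<eta>)"
    proof (rule MVT_interior[OF s(1)])
      fix x assume x: "m < x" "x < s"
      then show "((\<lambda>s. T s - (z s - F s) / \<eta>) has_real_derivative D x / z x - (- D x * g x / z x) / \<eta>) (at x)"
        using m s by (intro DERIV_diff T_deriv DERIV_cdivide zF_deriv) auto
    qed
    have "D x / z x - (- D x * g x / z x) / \<eta> = (D x / z x) * (1 - (- g x) / \<eta>)"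
      by (simp add: algebra_simps add_divide_distrib)
    also have "\<dots> \<le> 0"
    proof (rule mult_nonneg_nonpos)
      show "0 \<le> D x / z x" using x m s D_pos[of x] z_pos[of x] by (intro divide_nonneg_nonneg) auto
      show "1 - (- g x) / \<eta> \<le> 0" using \<eta> s0(2)[of x] x s by (simp add: \<eta>_def field_simps)
    qed
    finally have "(s - m) * (D x / z x - (- D x * g x / z x) / \<eta>) \<le> 0"
      using s by (intro mult_nonneg_nonpos) auto
    with x(3) have "T s \<le> T m + (z s - F s) / \<eta> - (z m - F m) / \<eta>" by linarith
    moreover have "(z s - F s) / \<eta> \<le> B / \<eta>" using B[of s] \<eta> m s by (intro divide_right_mono) auto
    moreover have "- (z m - F m) / \<eta> \<le> B / \<eta>" using B[of m] \<eta> m by (intro divide_right_mono) auto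
    moreover have "- (z m - F m) / \<eta> = - ((z m - F m) / \<eta>)"
      by (rule minus_divide_left[symmetric])
    moreover have "2 * B / \<eta> = B / \<eta> + B / \<eta>" by simp
    ultimately show ?thesis by linarith
  qed
  have "0 \<le> 2 * B / \<eta>" using B[of 0] R_pos \<eta> by (intro divide_nonneg_pos) auto
  then have "T s \<le> T m + 2 * B / \<eta>" if "0 < s" "s < R" for s
    using le[of s] T_le_iff[of s m] that m by (cases "s \<le> m") auto
  then show ?thesis by (intro bdd_aboveI2) auto
qed

section \<open>The profile as the inverse of the time map\<close>

definition w :: real where "w = Sup (T ` {0<..<R})"

lemma T_less_w: "0 < s \<Longrightarrow> s < R \<Longrightarrow> T s < w"
proof -
  assume s: "0 < s" "s < R"
  then obtain s' where s': "s < s'" "s' < R" using dense by blast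
  then have "T s < T s'" using s T_less by blast
  also have "T s' \<le> w" unfolding w_def using s s' by (intro cSup_upper T_bdd_above) auto
  finally show "T s < w" .
qed

lemma less_w: "\<xi> < w \<Longrightarrow> \<exists>s. 0 < s \<and> s < R \<and> \<xi> < T s"
  using less_cSup_iff[OF _ T_bdd_above, of \<xi>] R_pos unfolding w_def by force

text \<open>If \<open>T\<close> is bounded below, the default value continues the profile to the
  left by the equilibrium 0; otherwise the range of \<open>T\<close> is all of
  \<open>{..<w}\<close>.\<close>

definition \<phi> :: "real \<Rightarrow> real" where
  "\<phi> \<xi> = (if \<xi> \<in> T ` {0<..<R} then inv_into {0<..<R} T \<xi> else 0)"

lemma phi_T: "0 < s \<Longrightarrow> s < R \<Longrightarrow> \<phi> (T s) = s"
proof -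
  assume s: "0 < s" "s < R"
  have "inj_on T {0<..<R}"
    by (rule inj_onI) (metis T_less_iff greaterThanLessThan_iff less_irrefl linorder_neqE)
  then show ?thesis using s by (simp add: \<phi>_def)
qed

text \<open>By the intermediate value theorem the range of \<open>T\<close> has no gaps below
  \<open>w\<close>: a point is either attained or lies to the left of all values.\<close>

lemma phi_cases:
  assumes "\<xi> < w"
  obtains (pos) "0 < \<phi> \<xi>" "\<phi> \<xi> < R" "T (\<phi> \<xi>) = \<xi>"
  | (zero) "\<phi> \<xi> = 0" "\<And>s. 0 < s \<Longrightarrow> s < R \<Longrightarrow> \<xi> < T s"
proof (cases "\<exists>s. 0 < s \<and> s < R \<and> T s \<le> \<xi>")
  case True
  then obtain s where s: "0 < s" "s < R" "T s \<le> \<xi>" by blast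
  obtain t where t: "0 < t" "t < R" "\<xi> < T t" using less_w[OF assms] by blast
  have "s \<le> t" using s t T_le_iff[of s t] by auto
  then obtain r where r: "s \<le> r" "r \<le> t" "T r = \<xi>"
    using IVT'[of T s \<xi> t] s t T_cont[of s t] by auto
  then have "\<phi> \<xi> = r" using phi_T[of r] s t by auto
  with r s t pos show ?thesis by auto
next
  case False
  then have "\<xi> < T s" if "0 < s" "s < R" for s using that by force
  moreover from this have "\<phi> \<xi> = 0" unfolding \<phi>_def by fastforce
  ultimately show ?thesis using zero by blast
qed

lemma phi_nonneg: "\<xi> < w \<Longrightarrow> 0 \<le> \<phi> \<xi>"
  by (erule phi_cases) auto

lemma phi_less_R: "\<xi> < w \<Longrightarrow> \<phi> \<xi> < R"
  by (erule phi_cases) (use R_pos in auto)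

text \<open>Relates the order on both sides of the inversion also where the profile is 0, so that
  monotonicity, continuity and limits reduce to comparisons with values of \<open>T\<close>.\<close>

lemma phi_le_iff: "\<xi> < w \<Longrightarrow> 0 < s \<Longrightarrow> s < R \<Longrightarrow> \<phi> \<xi> \<le> s \<longleftrightarrow> \<xi> \<le> T s"
  by (erule phi_cases) (use T_le_iff in force)+

lemma phi_mono: "x \<le> y \<Longrightarrow> y < w \<Longrightarrow> \<phi> x \<le> \<phi> y"
proof -
  assume xy: "x \<le> y" "y < w"
  show ?thesis
    using xy(2)
  proof (cases rule: phi_cases)
    case pos
    then show ?thesis using phi_le_iff[of x "\<phi> y"] xy by auto
  next
    case zero
    have "x < w" using xy by simp
    then show ?thesis
      by (cases rule: phi_cases) (use zero xy in force)+
  qed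
qed

lemma phi_isCont: "\<xi> < w \<Longrightarrow> isCont \<phi> \<xi>"
  unfolding isCont_def
proof (rule order_tendstoI)
  assume \<xi>: "\<xi> < w"
  fix a assume a: "a < \<phi> \<xi>"
  show "eventually (\<lambda>x. a < \<phi> x) (at \<xi>)"
  proof (cases "a < 0")
    case True
    have "eventually (\<lambda>x. x < w) (at \<xi>)" using order_tendstoD(2)[OF tendsto_ident_at \<xi>] .
    then show ?thesis by eventually_elim (use True phi_nonneg in fastforce)
  next
    case False
    obtain s where s: "a < s" "s < \<phi> \<xi>" using a dense by blast
    then have s': "0 < s" "s < R" using False phi_less_R[OF \<xi>] by auto
    then have "T s < \<xi>" using phi_le_iff[OF \<xi> s'] s by auto
    then have "eventually (\<lambda>x. T s < x) (at \<xi>)" "eventually (\<lambda>x. x < w) (at \<xi>)"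
      using order_tendstoD[OF tendsto_ident_at] \<xi> by blast+
    then show ?thesis
      by eventually_elim (use s s' phi_le_iff in force)
  qed
next
  assume \<xi>: "\<xi> < w"
  fix a assume a: "\<phi> \<xi> < a"
  obtain s where s: "\<phi> \<xi> < s" "s < min a R" using a phi_less_R[OF \<xi>] dense[of "\<phi> \<xi>" "min a R"] by auto
  obtain r where r: "\<phi> \<xi> < r" "r < s" using s dense by blast
  have pos: "0 < r" using r phi_nonneg[OF \<xi>] by simp
  have "\<xi> \<le> T r" using phi_le_iff[OF \<xi> pos] r s by auto
  also have "T r < T s" using pos r s by (intro T_less) auto
  finally have "eventually (\<lambda>x. x < T s) (at \<xi>)" "eventually (\<lambda>x. x < w) (at \<xi>)"
    using order_tendstoD[OF tendsto_ident_at] \<xi> by blast+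
  then show "eventually (\<lambda>x. \<phi> x < a) (at \<xi>)"
  proof eventually_elim
    case (elim x)
    then have "\<phi> x \<le> s" using phi_le_iff[of x s] pos r s by auto
    with s show ?case by simp
  qed
qed

lemma phi_continuous_on: "continuous_on {..<w} \<phi>"
  using phi_isCont by (intro continuous_at_imp_continuous_on) auto

lemma phi_tendsto_0: "(\<phi> \<longlongrightarrow> 0) at_bot"
proof (rule order_tendstoI)
  fix a :: real assume "a < 0"
  have "eventually (\<lambda>x. x < w) at_bot" by (rule eventually_gt_at_bot)
  then show "eventually (\<lambda>x. a < \<phi> x) at_bot"
    by eventually_elim (use \<open>a < 0\<close> phi_nonneg in fastforce)
next
  fix a :: real assume "0 < a"
  then obtain s where s: "0 < s" "s < min a R" using R_pos dense[of 0 "min a R"] by auto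
  have "eventually (\<lambda>x. x < w) at_bot" "eventually (\<lambda>x. x < T s) at_bot"
    by (rule eventually_gt_at_bot)+
  then show "eventually (\<lambda>x. \<phi> x < a) at_bot"
  proof eventually_elim
    case (elim x)
    then have "\<phi> x \<le> s" using phi_le_iff[of x s] s by auto
    with s show ?case by simp
  qed
qed

lemma phi_deriv_pos:
  assumes "\<xi> < w" "0 < \<phi> \<xi>"
  shows "(\<phi> has_real_derivative z (\<phi> \<xi>) / D (\<phi> \<xi>)) (at \<xi>)"
proof -
  have R: "\<phi> \<xi> < R" by (rule phi_less_R[OF assms(1)])
  define a where "a = T (\<phi> \<xi> / 2)"
  have s: "0 < \<phi> \<xi> / 2" "\<phi> \<xi> / 2 < R" using assms R by auto
  have pos: "0 < \<phi> y" if "a < y" "y < w" for y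
    using that phi_le_iff[of y "\<phi> \<xi> / 2"] s unfolding a_def by auto
  have a: "a < \<xi>" using phi_le_iff[OF assms(1) s] assms(2) unfolding a_def by auto
  have "(\<phi> has_real_derivative inverse (D (\<phi> \<xi>) / z (\<phi> \<xi>))) (at \<xi>)"
  proof (rule DERIV_inverse_function[where f=T])
    show "(T has_real_derivative D (\<phi> \<xi>) / z (\<phi> \<xi>)) (at (\<phi> \<xi>))"
      by (rule T_deriv[OF assms(2) R])
    show "D (\<phi> \<xi>) / z (\<phi> \<xi>) \<noteq> 0" using D_pos z_pos assms(2) R by fastforce
    show "T (\<phi> y) = y" if "a < y" "y < w" for y
      using that(2) by (cases rule: phi_cases) (use pos[OF that] in auto)
  qed (use a assms phi_isCont in auto)
  then show ?thesis by simp
qed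

text \<open>The right end of the zero set, encoded as a set with at most one element because there
  is none when the profile is positive everywhere. Outside it the profile is differentiable.\<close>

definition front :: "real set" where
  "front = {\<xi>. \<xi> < w \<and> \<phi> \<xi> = 0 \<and> (\<forall>x. \<xi> < x \<longrightarrow> x < w \<longrightarrow> 0 < \<phi> x)}"

lemma front_unique: "x \<in> front \<Longrightarrow> y \<in> front \<Longrightarrow> x = y"
  by (rule linorder_cases[of x y]) (auto simp: front_def)

lemma finite_front: "finite front"
proof (cases "front = {}")
  case False
  then obtain x where "x \<in> front" by blast
  then have "front \<subseteq> {x}" using front_unique by blast
  then show ?thesis by (rule finite_subset) auto
qed auto

lemma phi_zero_nbhd:
  assumes "\<xi> < w" "\<phi> \<xi> = 0" "\<xi> \<notin> front"
  obtains y where "\<xi> < y" "y < w" "\<And>x. x < y \<Longrightarrow> \<phi> x = 0"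
proof -
  obtain y where y: "\<xi> < y" "y < w" "\<not> 0 < \<phi> y" using assms by (auto simp: front_def)
  have "\<phi> x = 0" if "x < y" for x
    using phi_mono[of x y] phi_nonneg[of x] y that by force
  with y that show ?thesis by blast
qed

lemma phi_deriv_zero:
  assumes "\<xi> < w" "\<phi> \<xi> = 0" "\<xi> \<notin> front"
  shows "(\<phi> has_real_derivative 0) (at \<xi>)"
proof -
  obtain y where y: "\<xi> < y" "y < w" "\<And>x. x < y \<Longrightarrow> \<phi> x = 0" using phi_zero_nbhd[OF assms] by metis
  have "((\<lambda>_. 0) has_real_derivative 0) (at \<xi>)" by simp
  then show ?thesis
    by (rule has_field_derivative_transform_within_open[where S="{..<y}"]) (use y in auto)
qed

lemma phi_differentiable: "\<xi> < w \<Longrightarrow> \<xi> \<notin> front \<Longrightarrow> \<phi> differentiable (at \<xi>)"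
  using phi_deriv_zero[of \<xi>] phi_deriv_pos[of \<xi>] phi_nonneg[of \<xi>] real_differentiable_def
  by (cases "\<phi> \<xi> = 0") force+

text \<open>If \<open>z / D < e'\<close> near 0, then \<open>T\<close> grows there with slope above
  \<open>1 / e'\<close>, so the profile leaves the value 0 with slope at most \<open>e'\<close>.
  This is what makes the front smooth.\<close>

lemma phi_deriv_at_zero:
  assumes lim: "((\<lambda>s. z s / D s) \<longlongrightarrow> 0) (at_right 0)" and \<xi>: "\<xi> < w" "\<phi> \<xi> = 0"
  shows "(\<phi> has_real_derivative 0) (at \<xi>)"
  unfolding has_field_derivative_iff
proof (rule tendstoI)
  fix e :: real assume e: "0 < e"
  define e' where "e' = e / 2"
  have e': "0 < e'" "e' < e" using e by (auto simp: e'_def)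
  obtain \<delta>0 where \<delta>0: "\<delta>0 > 0" "\<And>s. 0 < s \<Longrightarrow> s < \<delta>0 \<Longrightarrow> z s / D s < e'"
    using order_tendstoD(2)[OF lim e'(1)] unfolding eventually_at_right_field by auto
  define \<delta> where "\<delta> = min \<delta>0 R"
  have \<delta>: "0 < \<delta>" using \<delta>0 R_pos by (simp add: \<delta>_def)
  have "eventually (\<lambda>x. \<phi> x < \<delta>) (at \<xi>)" "eventually (\<lambda>x. x < w) (at \<xi>)"
    using order_tendstoD(2)[OF phi_isCont[OF \<xi>(1), unfolded isCont_def], of \<delta>]
      order_tendstoD(2)[OF tendsto_ident_at \<xi>(1)] \<delta> \<xi>(2) by auto
  moreover have "eventually (\<lambda>x. x \<noteq> \<xi>) (at \<xi>)" by (simp add: eventually_at_filter)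
  ultimately show "eventually (\<lambda>x. dist ((\<phi> x - \<phi> \<xi>) / (x - \<xi>)) 0 < e) (at \<xi>)"
  proof eventually_elim
    case (elim x)
    show ?case
    proof (cases "\<phi> x = 0")
      case False
      then have pos: "0 < \<phi> x" using phi_nonneg elim by force
      then have x: "\<xi> < x" using phi_mono[of x \<xi>] \<xi> by (metis not_le)
      have Tx: "T (\<phi> x) = x" using elim(2) by (cases rule: phi_cases) (use pos in auto)
      have "s' \<le> e' * (x - \<xi>)" if s': "0 < s'" "s' < \<phi> x" for s'
      proof -
        define t where "t = \<phi> x - s'"
        have t: "0 < t" "t < \<phi> x" "\<phi> x < R" using s' phi_less_R elim by (auto simp: t_def)
        obtain r where r: "t < r" "r < \<phi> x" "T (\<phi> x) - T t = (\<phi> x - t) * (D r / z r)"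
          using T_MVT[OF t] .
        have rr: "0 < D r" "0 < z r" "z r / D r < e'"
          using r t elim \<delta>0(2)[of r] D_pos[of r] z_pos[of r] by (auto simp: \<delta>_def)
        then have "1 \<le> e' * (D r / z r)" by (simp add: field_simps)
        from mult_left_mono[OF this, of s'] have "s' \<le> s' * (e' * (D r / z r))" using s' by simp
        also have "\<dots> = e' * (T (\<phi> x) - T t)" using r(3) by (simp add: t_def)
        also have "\<dots> \<le> e' * (x - \<xi>)"
        proof -
          have "\<xi> < T t" using \<xi>(1) by (cases rule: phi_cases) (use \<xi>(2) t in auto)
          then show ?thesis using e' Tx by (intro mult_left_mono) auto
        qed
        finally show ?thesis .
      qed
      then have "\<phi> x \<le> e' * (x - \<xi>)" by (rule dense_le_bounded[OF pos])
      also have "\<dots> < e * (x - \<xi>)" using e' x by simp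
      finally have "\<phi> x / (x - \<xi>) < e" using x by (simp add: pos_divide_less_eq)
      moreover have "0 \<le> \<phi> x / (x - \<xi>)" using pos x by simp
      ultimately show ?thesis using \<xi>(2) by (simp add: dist_real_def abs_of_nonneg del: abs_divide)
    qed (use e \<xi> in simp)
  qed
qed

lemma slope_tendsto_0_nondegenerate:
  assumes "0 < D 0"
  shows "((\<lambda>s. z s / D s) \<longlongrightarrow> 0) (at_right 0)"
proof -
  have "((\<lambda>s. z s / D s) \<longlongrightarrow> z 0 / D 0) (at_right 0)"
    using assms by (intro tendsto_divide continuous_on_Icc_at_rightD[OF z_cont R_pos]
        continuous_on_Icc_at_rightD[OF D_cont R_pos]) auto
  then show ?thesis by (simp add: z_0)
qed

text \<open>Holds at the front as well: if \<open>D 0 = 0\<close> the product is 0 whatever value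
  \<open>deriv\<close> has at a point of non-differentiability, and if \<open>D 0 > 0\<close> the
  derivative is 0.\<close>

lemma phi_flux:
  assumes "\<xi> < w"
  shows "D (\<phi> \<xi>) * deriv \<phi> \<xi> = z (\<phi> \<xi>)"
proof (cases "\<phi> \<xi> = 0")
  case True
  show ?thesis
  proof (cases "D 0 = 0")
    case False
    then have "0 < D 0" using D_nonneg[of 0] R_pos by simp
    from phi_deriv_at_zero[OF slope_tendsto_0_nondegenerate[OF this] assms True]
    have "deriv \<phi> \<xi> = 0" by (rule DERIV_imp_deriv)
    then show ?thesis using True z_0 by simp
  qed (use True z_0 in simp)
next
  case False
  then have pos: "0 < \<phi> \<xi>" using phi_nonneg[OF assms] by simp
  from DERIV_imp_deriv[OF phi_deriv_pos[OF assms pos]]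
  show ?thesis using D_pos[OF pos phi_less_R[OF assms]] by simp
qed

lemma balance_deriv:
  assumes "\<xi> < w" "\<xi> \<notin> front"
  shows "((\<lambda>\<xi>. z (\<phi> \<xi>) - F (\<phi> \<xi>)) has_real_derivative - g (\<phi> \<xi>)) (at \<xi>)"
proof (cases "\<phi> \<xi> = 0")
  case True
  obtain y where y: "\<xi> < y" "y < w" "\<And>x. x < y \<Longrightarrow> \<phi> x = 0"
    using phi_zero_nbhd[OF assms(1) True assms(2)] by metis
  have "((\<lambda>_. z 0 - F 0) has_real_derivative 0) (at \<xi>)" by simp
  then have "((\<lambda>\<xi>. z (\<phi> \<xi>) - F (\<phi> \<xi>)) has_real_derivative 0) (at \<xi>)"
    by (rule has_field_derivative_transform_within_open[where S="{..<y}"]) (use y in auto)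
  then show ?thesis using True g_0 by simp
next
  case False
  then have pos: "0 < \<phi> \<xi>" "\<phi> \<xi> < R" using phi_nonneg phi_less_R assms by force+
  have "((\<lambda>\<xi>. z (\<phi> \<xi>) - F (\<phi> \<xi>)) has_real_derivative
      - D (\<phi> \<xi>) * g (\<phi> \<xi>) / z (\<phi> \<xi>) * (z (\<phi> \<xi>) / D (\<phi> \<xi>))) (at \<xi>)"
    by (rule DERIV_chain2[OF zF_deriv[OF pos] phi_deriv_pos[OF assms(1) pos(1)]])
  then show ?thesis using D_pos[OF pos] z_pos[OF pos] by simp
qed

section \<open>Regularity of the profile and its weak equation\<close>

lemma phi_image: "\<phi> ` {..<w} \<subseteq> {0..R}"
  using phi_nonneg less_imp_le[OF phi_less_R] by auto

lemma comp_phi_cont: "continuous_on {0..R} u \<Longrightarrow> continuous_on {..<w} (\<lambda>\<xi>. u (\<phi> \<xi>))"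
  by (rule continuous_on_compose2[OF _ phi_continuous_on phi_image])

text \<open>The slope \<open>z / D\<close> may be unbounded near the state 0, but it is bounded on
  states from \<open>m\<close> up to the largest value on the interval; truncating at a small
  \<open>m\<close> isolates the bad part.\<close>

lemma phi_locally_abs_cont: "locally_abs_cont_on {..<w} \<phi>"
proof (rule locally_abs_cont_on_monotone)
  show "mono_on {..<w} \<phi>" using phi_mono by (intro mono_onI) auto
  show "0 \<le> \<phi> x" if "x \<in> {..<w}" for x using phi_nonneg that by simp
  fix a b \<epsilon> :: real assume ab: "{a..b} \<subseteq> {..<w}" "0 < \<epsilon>"
  show "\<exists>m L. 0 \<le> m \<and> m < \<epsilon> \<and>
      (\<forall>x\<in>{a..b}. \<forall>y\<in>{a..b}. x \<le> y \<longrightarrow> max (\<phi> y) m - max (\<phi> x) m \<le> L * (y - x))"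
  proof (cases "a \<le> b")
    case False
    then show ?thesis using ab(2) by (intro exI[of _ 0]) auto
  next
    case True
    then have bw: "b < w" using ab(1) by auto
    obtain m where m: "0 < m" "m < min \<epsilon> R" using ab(2) R_pos dense[of 0 "min \<epsilon> R"] by auto
    \<comment> \<open>States in \<open>[m, t]\<close> with \<open>0 < m\<close> and
      \<open>t < R\<close> stay away from both possible zeros of \<open>D\<close>.\<close>
    define t where "t = max (\<phi> b) m"
    have t: "m \<le> t" "t < R" using m phi_less_R[OF bw] by (auto simp: t_def)
    have "continuous_on {m..t} (\<lambda>s. z s / D s)"
    proof (intro continuous_on_divide continuous_on_subset[OF z_cont] continuous_on_subset[OF D_cont] ballI)
      show "D s \<noteq> 0" if "s \<in> {m..t}" for s using D_pos[of s] that m t by auto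
    qed (use m t in auto)
    from continuous_on_Icc_bounded[OF this]
    obtain L where L0: "0 \<le> L" and L: "\<And>s. s \<in> {m..t} \<Longrightarrow> \<bar>z s / D s\<bar> \<le> L" by blast
    show ?thesis
    proof (rule exI[of _ m], rule exI[of _ L], intro conjI ballI impI)
      fix x y assume xy: "x \<in> {a..b}" "y \<in> {a..b}" "x \<le> y"
      then have w: "x < w" "y < w" using bw by auto
      define s1 s2 where "s1 = max (\<phi> x) m" and "s2 = max (\<phi> y) m"
      have "\<phi> x \<le> \<phi> y" "\<phi> y \<le> \<phi> b" using phi_mono xy bw w by auto
      then have s: "m \<le> s1" "s1 \<le> s2" "s2 \<le> t" by (auto simp: s1_def s2_def t_def)
      show "max (\<phi> y) m - max (\<phi> x) m \<le> L * (y - x)"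
      proof (cases "s1 = s2")
        case True
        then show ?thesis using L0 xy(3) by (simp add: s1_def s2_def)
      next
        case False
        then have s12: "s1 < s2" using s by simp
        then have "m < s2" using s(1) by simp
        then have y2: "s2 = \<phi> y" unfolding s2_def by linarith
        have Ty: "T s2 = y"
          using w(2) by (cases rule: phi_cases) (use y2 \<open>m < s2\<close> m(1) in auto)
        have "0 < s1" "s1 < R" using s12 s m t by auto
        moreover have "\<phi> x \<le> s1" by (simp add: s1_def)
        ultimately have Tx: "x \<le> T s1" using phi_le_iff[OF w(1), of s1] by simp
        obtain r where r: "s1 < r" "r < s2" "T s2 - T s1 = (s2 - s1) * (D r / z r)"
          using T_MVT[of s1 s2] s12 s m t by auto
        have rr: "0 < D r" "0 < z r" "z r / D r \<le> L"
          using r s m t D_pos[of r] z_pos[of r] L[of r] by auto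
        then have "1 \<le> L * (D r / z r)" by (simp add: field_simps)
        from mult_left_mono[OF this, of "s2 - s1"] have "s2 - s1 \<le> (s2 - s1) * (L * (D r / z r))"
          using s12 by simp
        also have "\<dots> = L * (T s2 - T s1)" using r(3) by simp
        also have "\<dots> \<le> L * (y - x)" using Ty Tx L0 by (intro mult_left_mono) auto
        finally show ?thesis by (simp add: s1_def s2_def)
      qed
    qed (use m in auto)
  qed
qed

lemma AE_not_front: "AE \<xi> in lebesgue. \<xi> \<notin> front"
proof (rule AE_not_in)
  show "front \<in> null_sets lebesgue"
    using finite_front negligible_finite negligible_iff_null_sets by blast
qed

lemma phi_tw_profile: "tw_profile R f D g c {..<w} \<phi>"
  unfolding tw_profile_def
proof (intro conjI allI impI)
  show "open {..<w}" "is_interval {..<w}" "\<phi> ` {..<w} \<subseteq> {0..R}" "continuous_on {..<w} \<phi>"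
    using phi_image phi_continuous_on by (auto simp: is_interval_1)
  show "{..<w} \<noteq> {}" using lt_ex by blast
  show "AE \<xi> in lebesgue. \<xi> \<in> {..<w} \<longrightarrow> \<phi> differentiable at \<xi>"
    using AE_not_front by eventually_elim (use phi_differentiable in auto)
  show "locally_abs_cont_on {\<xi> \<in> {..<w}. D (\<phi> \<xi>) \<noteq> 0} \<phi>"
    by (rule locally_abs_cont_on_subset[OF phi_locally_abs_cont]) auto
  fix a b assume ab: "{a..b} \<subseteq> {..<w}"
  have "(\<lambda>\<xi>. z (\<phi> \<xi>)) absolutely_integrable_on {a..b}"
    by (intro absolutely_integrable_continuous_real continuous_on_subset[OF comp_phi_cont[OF z_cont] ab])
  moreover have "D (\<phi> \<xi>) * deriv \<phi> \<xi> = z (\<phi> \<xi>)" if "\<xi> \<in> {a..b}" for \<xi>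
    using phi_flux ab that by auto
  ultimately show "(\<lambda>\<xi>. D (\<phi> \<xi>) * deriv \<phi> \<xi>) absolutely_integrable_on {a..b}"
    using set_integrable_cong[of lebesgue lebesgue "{a..b}" "{a..b}"] by (metis (no_types, lifting))
next
  fix \<psi> assume \<psi>: "test_function {..<w} \<psi>"
  have "((\<lambda>x. (z (\<phi> x) - F (\<phi> x)) * deriv \<psi> x + - g (\<phi> x) * \<psi> x) has_integral 0) {..<w}"
    by (rule test_function_integrate_by_parts[OF _ \<psi> _ _ finite_front])
       (use balance_deriv comp_phi_cont[OF zF_cont] in \<open>auto simp: is_interval_1\<close>)
  then show "((\<lambda>\<xi>. (D (\<phi> \<xi>) * deriv \<phi> \<xi> - f (\<phi> \<xi>) + c * \<phi> \<xi>) * deriv \<psi> \<xi> - g (\<phi> \<xi>) * \<psi> \<xi>)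
      has_integral 0) {..<w}"
    by (rule has_integral_eq[rotated]) (use phi_flux in \<open>auto simp: F_def algebra_simps\<close>)
qed

lemma phi_semi_wavefront: "semi_wavefront_from R f D g c 0 w \<phi>"
  unfolding semi_wavefront_from_def
proof (intro conjI)
  show "mono_on {..<w} \<phi> \<or> antimono_on {..<w} \<phi>" using phi_mono by (intro disjI1 mono_onI) auto
  show "\<not> \<phi> constant_on {..<w}"
  proof
    assume "\<phi> constant_on {..<w}"
    then have "\<phi> (T (R/2)) = \<phi> (T (R/3))"
      using T_less_w[of "R/2"] T_less_w[of "R/3"] R_pos unfolding constant_on_def by auto
    then show False using phi_T[of "R/2"] phi_T[of "R/3"] R_pos by simp
  qed
qed (use phi_tw_profile phi_tendsto_0 g_0 R_pos in auto)

text \<open>The quotient \<open>D g / z\<close> gives no evident bound for \<open>z'\<close> near 0,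
  so the flux is split as \<open>(z - F) + F\<close> along the profile: the first part is Lipschitz
  because its derivative is \<open>- g\<close>, the second is a Lipschitz function of an absolutely
  continuous one.\<close>

lemma phi_flux_locally_abs_cont: "locally_abs_cont_on {..<w} (\<lambda>\<xi>. D (\<phi> \<xi>) * deriv \<phi> \<xi>)"
proof -
  obtain L where L: "\<And>x y. x \<in> {0..R} \<Longrightarrow> y \<in> {0..R} \<Longrightarrow> \<bar>F x - F y\<bar> \<le> L * \<bar>x - y\<bar>"
    using F_lipschitz by metis
  obtain B where B: "\<And>s. s \<in> {0..R} \<Longrightarrow> norm (g s) \<le> B"
    using continuous_on_Icc_bounded[OF g_cont] unfolding real_norm_def by metis
  have B0: "0 \<le> B" using B[of 0] R_pos by (auto intro: order_trans[OF norm_ge_zero])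
  have "locally_abs_cont_on {..<w} (\<lambda>\<xi>. z (\<phi> \<xi>) - F (\<phi> \<xi>))"
  proof (rule locally_abs_cont_on_lipschitz, intro exI[of _ B] ballI impI)
    fix a b x y assume "{a..b} \<subseteq> {..<w}" "x \<in> {a..b}" "y \<in> {a..b}" and xy: "x \<le> y"
    then have "y < w" by blast
    then have sub: "{x..y} \<subseteq> {..<w}" by auto
    have "((\<lambda>\<xi>. - g (\<phi> \<xi>)) has_integral (z (\<phi> y) - F (\<phi> y)) - (z (\<phi> x) - F (\<phi> x))) {x..y}"
      by (rule fundamental_theorem_of_calculus_interior_strong[OF finite_front xy])
         (use balance_deriv continuous_on_subset[OF comp_phi_cont[OF zF_cont] sub] \<open>y < w\<close> in
          \<open>auto simp: has_real_derivative_iff_has_vector_derivative[symmetric]\<close>)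
    then have "norm ((z (\<phi> y) - F (\<phi> y)) - (z (\<phi> x) - F (\<phi> x))) \<le> B * measure lborel {x..y}"
      by (rule has_integral_bound_real[OF B0 finite.emptyI])
        (use B phi_image \<open>y < w\<close> in \<open>force simp: image_subset_iff\<close>)
    then show "\<bar>z (\<phi> y) - F (\<phi> y) - (z (\<phi> x) - F (\<phi> x))\<bar> \<le> B * (y - x)"
      using xy by simp
  qed
  moreover have "locally_abs_cont_on {..<w} (\<lambda>\<xi>. F (\<phi> \<xi>))"
    by (rule locally_abs_cont_on_lipschitz_compose[OF phi_locally_abs_cont phi_image L])
  ultimately have "locally_abs_cont_on {..<w} (\<lambda>\<xi>. (z (\<phi> \<xi>) - F (\<phi> \<xi>)) + F (\<phi> \<xi>))"
    by (rule locally_abs_cont_on_add)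
  then show ?thesis
    by (rule locally_abs_cont_on_cong) (use phi_flux in auto)
qed

text \<open>Stated for a subset so that it serves both the whole half-line and the half-line without
  the front.\<close>

lemma phi_classical_on:
  assumes S: "S \<subseteq> {..<w}" and diff: "\<And>\<xi>. \<xi> \<in> S \<Longrightarrow> \<phi> differentiable (at \<xi>)"
  shows "classical_on h D g c S \<phi>"
  unfolding classical_on_def
proof (intro conjI ballI diff)
  show "locally_abs_cont_on S (\<lambda>\<xi>. D (\<phi> \<xi>) * deriv \<phi> \<xi>)"
    by (rule locally_abs_cont_on_subset[OF phi_flux_locally_abs_cont S])
  have eq: "((\<lambda>\<xi>. D (\<phi> \<xi>) * deriv \<phi> \<xi>) has_real_derivative - (c - h (\<phi> \<xi>)) * deriv \<phi> \<xi> - g (\<phi> \<xi>)) (at \<xi>)"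
    if \<xi>: "\<xi> < w" "\<xi> \<notin> front" for \<xi>
  proof -
    have "((\<lambda>\<xi>. z (\<phi> \<xi>)) has_real_derivative - (c - h (\<phi> \<xi>)) * deriv \<phi> \<xi> - g (\<phi> \<xi>)) (at \<xi>)"
    proof (cases "\<phi> \<xi> = 0")
      case True
      obtain y where y: "\<xi> < y" "y < w" "\<And>x. x < y \<Longrightarrow> \<phi> x = 0"
        using phi_zero_nbhd[OF \<xi>(1) True \<xi>(2)] by metis
      have "((\<lambda>_. z 0) has_real_derivative 0) (at \<xi>)" by simp
      then have "((\<lambda>\<xi>. z (\<phi> \<xi>)) has_real_derivative 0) (at \<xi>)"
        by (rule has_field_derivative_transform_within_open[where S="{..<y}"]) (use y in auto)
      then show ?thesis
        using DERIV_imp_deriv[OF phi_deriv_zero[OF \<xi>(1) True \<xi>(2)]] True g_0 by simp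
    next
      case False
      then have pos: "0 < \<phi> \<xi>" "\<phi> \<xi> < R" using phi_nonneg phi_less_R \<xi> by force+
      note d = phi_deriv_pos[OF \<xi>(1) pos(1)]
      have "((\<lambda>\<xi>. z (\<phi> \<xi>)) has_real_derivative
          (h (\<phi> \<xi>) - c - D (\<phi> \<xi>) * g (\<phi> \<xi>) / z (\<phi> \<xi>)) * (z (\<phi> \<xi>) / D (\<phi> \<xi>))) (at \<xi>)"
        by (rule DERIV_chain2[OF z_deriv[OF pos] d])
      moreover have "(h (\<phi> \<xi>) - c - D (\<phi> \<xi>) * g (\<phi> \<xi>) / z (\<phi> \<xi>)) * (z (\<phi> \<xi>) / D (\<phi> \<xi>))
          = - (c - h (\<phi> \<xi>)) * deriv \<phi> \<xi> - g (\<phi> \<xi>)"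
        using D_pos[OF pos] z_pos[OF pos] by (simp add: DERIV_imp_deriv[OF d] field_simps)
      ultimately show ?thesis by simp
    qed
    then show ?thesis
      by (rule has_field_derivative_transform_within_open[where S="{..<w}"]) (use \<xi> phi_flux in auto)
  qed
  show "AE \<xi> in lebesgue. \<xi> \<in> S \<longrightarrow> (\<lambda>\<xi>. D (\<phi> \<xi>) * deriv \<phi> \<xi>) differentiable (at \<xi>) \<and>
      deriv (\<lambda>\<xi>. D (\<phi> \<xi>) * deriv \<phi> \<xi>) \<xi> + (c - h (\<phi> \<xi>)) * deriv \<phi> \<xi> + g (\<phi> \<xi>) = 0"
    using AE_not_front
  proof eventually_elim
    case (elim \<xi>)
    show ?case
    proof
      assume "\<xi> \<in> S"
      with S have "\<xi> < w" by auto
      note e = eq[OF this elim]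
      show "(\<lambda>\<xi>. D (\<phi> \<xi>) * deriv \<phi> \<xi>) differentiable (at \<xi>) \<and>
        deriv (\<lambda>\<xi>. D (\<phi> \<xi>) * deriv \<phi> \<xi>) \<xi> + (c - h (\<phi> \<xi>)) * deriv \<phi> \<xi> + g (\<phi> \<xi>) = 0"
        using e DERIV_imp_deriv[OF e] real_differentiable_def by (auto simp: algebra_simps)
    qed
  qed
qed

end

section \<open>Classical and sharp profiles\<close>

context trajectory
begin

lemma phi_classical:
  assumes "((\<lambda>s. z s / D s) \<longlongrightarrow> 0) (at_right 0)"
  shows "classical_profile R f h D g c {..<w} \<phi>"
  unfolding classical_profile_def
proof (intro conjI phi_tw_profile phi_classical_on order_refl)
  fix \<xi> assume "\<xi> \<in> {..<w}"
  then have \<xi>: "\<xi> < w" by simp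
  show "\<phi> differentiable (at \<xi>)"
  proof (cases "\<phi> \<xi> = 0")
    case True
    from phi_deriv_at_zero[OF assms \<xi> True] show ?thesis using real_differentiable_def by blast
  next
    case False
    then have "0 < \<phi> \<xi>" using phi_nonneg[OF \<xi>] by simp
    from phi_deriv_pos[OF \<xi> this] show ?thesis using real_differentiable_def by blast
  qed
qed

lemma phi_sharp_at_front:
  assumes "\<xi>0 \<in> front" "\<not> \<phi> differentiable (at \<xi>0)"
  shows "sharp_profile_at R f h D g c 0 {..<w} \<phi>"
  unfolding sharp_profile_at_def
proof (intro conjI phi_tw_profile g_0 bexI[of _ \<xi>0] assms(2))
  show "\<phi> \<xi>0 = 0" "\<xi>0 \<in> {..<w}" using assms(1) by (auto simp: front_def)
  show "classical_on h D g c ({..<w} - {\<xi>0}) \<phi>"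
    by (rule phi_classical_on) (use phi_differentiable front_unique assms(1) in auto)
qed

text \<open>Differentiability can fail only at the front, so the two alternatives are exhaustive
  whatever the behaviour of \<open>z / D\<close> at 0.\<close>

lemma phi_classical_or_sharp: "classical_or_sharp R f h D g c {..<w} \<phi>"
proof (cases "\<forall>\<xi><w. \<phi> differentiable (at \<xi>)")
  case True
  then have "classical_profile R f h D g c {..<w} \<phi>"
    unfolding classical_profile_def by (intro conjI phi_tw_profile phi_classical_on) auto
  then show ?thesis by (simp add: classical_or_sharp_def)
next
  case False
  then obtain \<xi> where \<xi>: "\<xi> < w" "\<not> \<phi> differentiable (at \<xi>)" by blast
  then have "\<xi> \<in> front" using phi_differentiable by blast
  then show ?thesis unfolding classical_or_sharp_def using phi_sharp_at_front \<xi>(2) by blast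
qed

text \<open>Near the state 0 the slope of \<open>T\<close> is at most \<open>1 / a\<close>, so
  \<open>T\<close> is bounded below and the front sits at its infimum. To its right the profile
  rises with average slope at least \<open>a\<close>.\<close>

lemma phi_sharp:
  assumes a: "0 < a" and \<delta>0: "0 < \<delta>0" and le: "\<And>s. 0 < s \<Longrightarrow> s < \<delta>0 \<Longrightarrow> s < R \<Longrightarrow> a * D s \<le> z s"
  shows "sharp_profile_at R f h D g c 0 {..<w} \<phi>"
proof -
  define \<delta> where "\<delta> = min \<delta>0 R"
  have \<delta>: "0 < \<delta>" "\<delta> \<le> R" using \<delta>0 R_pos by (auto simp: \<delta>_def)
  have T_le: "T s - s / a \<le> T t" if st: "0 < t" "t < R" "0 < s" "s < \<delta>" for s t
  proof (cases "t < s")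
    case True
    have "s < R" using st \<delta> by simp
    then obtain r where r: "t < r" "r < s" "T s - T t = (s - t) * (D r / z r)"
      using T_MVT[OF st(1) True] by blast
    have "0 < z r" "a * D r \<le> z r" using r st \<delta> z_pos[of r] le[of r] by (auto simp: \<delta>_def)
    then have "D r / z r \<le> 1 / a" using a by (simp add: field_simps)
    then have "T s - T t \<le> (s - t) * (1 / a)" unfolding r(3) using True by (intro mult_left_mono) auto
    also have "\<dots> \<le> s * (1 / a)" using st a by (intro mult_right_mono) auto
    finally show ?thesis by simp
  next
    case False
    then have "T s \<le> T t" using T_le_iff[of s t] st \<delta> by auto
    moreover have "0 \<le> s / a" using st a by simp
    ultimately show ?thesis by linarith
  qed
  define A where "A = T ` {0<..<R}"
  have A: "A \<noteq> {}" "bdd_below A"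
    using R_pos T_le[of _ "\<delta> / 2"] \<delta> unfolding A_def by (auto intro!: bdd_belowI2)
  define \<xi>0 where "\<xi>0 = Inf A"
  have less: "\<xi>0 < T s" if "0 < s" "s < R" for s
  proof -
    have "\<xi>0 \<le> T (s / 2)" unfolding \<xi>0_def using that by (intro cInf_lower A) (auto simp: A_def)
    also have "T (s / 2) < T s" using that by (intro T_less) auto
    finally show ?thesis .
  qed
  have w: "\<xi>0 < w" using less[of "R/2"] T_less_w[of "R/2"] R_pos by simp
  have zero: "\<phi> \<xi>0 = 0"
    using w by (cases rule: phi_cases) (use less in force)+
  have near: "\<exists>s>0. s < R \<and> T s < x" if "\<xi>0 < x" for x
    using that cInf_less_iff[OF A] unfolding \<xi>0_def A_def by auto
  have front: "\<xi>0 \<in> front"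
    unfolding front_def
  proof (intro CollectI conjI allI impI w zero)
    fix x assume x: "\<xi>0 < x" "x < w"
    from near[OF x(1)] obtain s where "0 < s" "s < R" "T s < x" by blast
    then show "0 < \<phi> x" using phi_le_iff[OF x(2), of s] by auto
  qed
  moreover have "\<not> \<phi> differentiable (at \<xi>0)"
  proof
    assume "\<phi> differentiable (at \<xi>0)"
    then obtain l where l: "(\<phi> has_real_derivative l) (at \<xi>0)" using real_differentiable_def by blast
    \<comment> \<open>The front is a minimum, so a derivative could only be 0.\<close>
    have "l = 0"
    proof (rule DERIV_local_min[OF l])
      show "0 < w - \<xi>0" using w by simp
      show "\<forall>y. \<bar>\<xi>0 - y\<bar> < w - \<xi>0 \<longrightarrow> \<phi> \<xi>0 \<le> \<phi> y"
        using zero phi_nonneg by auto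
    qed
    with l have "((\<lambda>y. (\<phi> y - \<phi> \<xi>0) / (y - \<xi>0)) \<longlongrightarrow> 0) (at \<xi>0)"
      by (simp add: has_field_derivative_iff)
    from order_tendstoD(2)[OF this a] obtain d where d: "0 < d"
      "\<And>x. x \<noteq> \<xi>0 \<Longrightarrow> dist x \<xi>0 < d \<Longrightarrow> (\<phi> x - \<phi> \<xi>0) / (x - \<xi>0) < a"
      unfolding eventually_at by auto
    obtain s' where s': "0 < s'" "s' < R" "T s' < \<xi>0 + d" using near[of "\<xi>0 + d"] d(1) by auto
    define s where "s = min s' (\<delta> / 2)"
    have s: "0 < s" "s < R" "s < \<delta>" "s \<le> s'" using s' \<delta> by (auto simp: s_def)
    have "T s \<le> T s'" using T_le_iff[of s s'] s s' by simp
    with s' less[OF s(1,2)] have "dist (T s) \<xi>0 < d" "T s \<noteq> \<xi>0" by (auto simp: dist_real_def)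
    from d(2)[OF this(2,1)] have "s / (T s - \<xi>0) < a" using zero phi_T[OF s(1,2)] by simp
    \<comment> \<open>Together with \<open>\<phi> (T s) = s\<close> this bounds the difference
      quotient at \<open>T s\<close> from below by \<open>a\<close>.\<close>
    moreover have "T s - s / a \<le> \<xi>0"
      unfolding \<xi>0_def using A(1) T_le[OF _ _ s(1,3)] by (intro cInf_greatest) (auto simp: A_def)
    ultimately show False using less[OF s(1,2)] a by (simp add: field_simps)
  qed
  ultimately show ?thesis by (rule phi_sharp_at_front)
qed

text \<open>For small \<open>\<epsilon>\<close> the function \<open>\<epsilon> D\<close> is a strict supersolution of the equation for
  \<open>z\<close> near 0: a trajectory above it would have to decrease to it from the left.\<close>
lemma slope_tendsto_0_degenerate:
  assumes D0: "D 0 = 0" and slope: "\<And>\<epsilon>. 0 < \<epsilon> \<Longrightarrow> h 0 - c < \<epsilon> * D' 0"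
  shows "((\<lambda>s. z s / D s) \<longlongrightarrow> 0) (at_right 0)"
proof (rule order_tendstoI)
  fix a :: real assume "a < 0"
  have "a < z s / D s" if "0 < s" "s < R" for s
    using \<open>a < 0\<close> divide_pos_pos[OF z_pos[OF that] D_pos[OF that]] by linarith
  then show "eventually (\<lambda>s. a < z s / D s) (at_right 0)"
    unfolding eventually_at_right_field using R_pos by blast
next
  fix a :: real assume a: "0 < a"
  define \<epsilon> where "\<epsilon> = a / 2"
  have \<epsilon>: "0 < \<epsilon>" "\<epsilon> < a" using a by (auto simp: \<epsilon>_def)
  \<comment> \<open>The amount by which the derivative of \<open>\<epsilon> * D\<close> exceeds the
    right-hand side of the trajectory equation evaluated at
    \<open>z = \<epsilon> * D\<close>.\<close>
  define e where "e s = \<epsilon> * D' s - (h s - c) + g s / \<epsilon>" for s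
  have "continuous_on {0..R} e"
    unfolding e_def using \<epsilon> by (intro continuous_intros D'_cont h_cont g_cont) auto
  from continuous_on_Icc_at_rightD[OF this R_pos] have "(e \<longlongrightarrow> e 0) (at_right 0)" .
  moreover have "0 < e 0" using slope[OF \<epsilon>(1)] by (simp add: e_def g_0)
  ultimately have "eventually (\<lambda>s. 0 < e s) (at_right 0)" by (rule order_tendstoD(1))
  then obtain \<delta> where \<delta>: "0 < \<delta>" "\<And>s. 0 < s \<Longrightarrow> s < \<delta> \<Longrightarrow> 0 < e s"
    unfolding eventually_at_right_field by auto
  have "z x / D x < a" if x: "0 < x" "x < min \<delta> R" for x
  proof (rule ccontr)
    have xR: "x < R" and x\<delta>: "x < \<delta>" using x by auto
    assume "\<not> z x / D x < a"
    then have "a * D x \<le> z x" using D_pos[OF x(1) xR] by (simp add: not_less pos_le_divide_eq)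
    moreover have "\<epsilon> * D x < a * D x"
      by (rule mult_strict_right_mono[OF \<epsilon>(2) D_pos[OF x(1) xR]])
    ultimately have "\<epsilon> * D x < z x" by linarith
    define q where "q s = z s - \<epsilon> * D s" for s
    have qc: "continuous_on {0..R} q" unfolding q_def by (intro continuous_intros z_cont D_cont)
    have "continuous_on {0..x} q" using qc xR by (auto intro: continuous_on_subset)
    then obtain t where t: "0 \<le> t" "t < x" "q t \<le> 0" "\<And>s. t < s \<Longrightarrow> s \<le> x \<Longrightarrow> 0 < q s"
      by (rule last_nonpos_point) (use x \<open>\<epsilon> * D x < z x\<close> in \<open>auto simp: q_def z_0 D0\<close>)
    have "continuous_on {t..x} q" using qc xR t by (auto intro: continuous_on_subset)
    then obtain s where s: "t < s" "s < x"
      "q x - q t = (x - t) * (h s - c - D s * g s / z s - \<epsilon> * D' s)"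
    proof (rule MVT_interior[OF t(2)])
      fix s assume "t < s" "s < x"
      then have "0 < s" "s < R" using t xR by auto
      then show "(q has_real_derivative h s - c - D s * g s / z s - \<epsilon> * D' s) (at s)"
        unfolding q_def by (intro DERIV_diff DERIV_cmult z_deriv D_deriv_interior)
    qed
    have sR: "0 < s" "s < R" "s < \<delta>" using s t xR x\<delta> by auto
    have "\<epsilon> * D s < z s" using t(4)[of s] s by (simp add: q_def)
    \<comment> \<open>Above \<open>\<epsilon> * D\<close> the source term \<open>- D g / z\<close>
      is smaller than on it, so \<open>q\<close> has derivative at most \<open>- e s < 0\<close>.
      But \<open>q\<close> rises from a nonpositive value at \<open>t\<close> to a positive one at
      \<open>x\<close>.\<close>
    then have "D s / z s \<le> 1 / \<epsilon>" using \<epsilon>(1) z_pos[OF sR(1,2)] by (simp add: field_simps)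
    then have "- g s * (D s / z s) \<le> - g s * (1 / \<epsilon>)"
      using g_neg[of s] sR by (intro mult_left_mono) auto
    then have "h s - c - D s * g s / z s - \<epsilon> * D' s \<le> - e s"
      by (simp add: e_def mult.commute)
    also have "\<dots> < 0" using \<delta>(2) sR by simp
    finally have "(x - t) * (h s - c - D s * g s / z s - \<epsilon> * D' s) < 0"
      using t(2) by (intro mult_pos_neg) auto
    with s(3) t(3) t(4)[of x] t(2) show False by simp
  qed
  then show "eventually (\<lambda>s. z s / D s < a) (at_right 0)"
    unfolding eventually_at_right_field using R_pos \<delta>(1) by (intro exI[of _ "min \<delta> R"]) auto
qed

lemma D'_0_nonneg:
  assumes "D 0 = 0"
  shows "0 \<le> D' 0"
proof -
  have "((\<lambda>s. (D s - D 0) / (s - 0)) \<longlongrightarrow> D' 0) (at_right 0)"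
    using D_deriv[of 0] R_pos by (simp add: has_field_derivative_iff at_within_Icc_at_right)
  moreover have "eventually (\<lambda>s. 0 \<le> (D s - D 0) / (s - 0)) (at_right 0)"
    unfolding eventually_at_right_field
    using R_pos assms D_nonneg by (intro exI[of _ R]) auto
  ultimately show ?thesis by (rule tendsto_lowerbound) simp
qed

text \<open>The source term \<open>- D g / z\<close> is nonnegative, so near 0 the trajectory rises
  at least with slope \<open>\<kappa>\<close>, half the gap \<open>h 0 - c\<close>. As
  \<open>D 0 = 0\<close>, \<open>D\<close> rises at most with slope \<open>L\<close>, which gives
  \<open>a = \<kappa> / L\<close>.\<close>

lemma phi_sharp_subcritical:
  assumes D0: "D 0 = 0" and c: "c < h 0"
  shows "sharp_profile_at R f h D g c 0 {..<w} \<phi>"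
proof -
  define \<kappa> where "\<kappa> = (h 0 - c) / 2"
  have \<kappa>: "0 < \<kappa>" "c + \<kappa> < h 0" using c by (auto simp: \<kappa>_def field_simps)
  from order_tendstoD(1)[OF continuous_on_Icc_at_rightD[OF h_cont R_pos] \<kappa>(2)]
  obtain \<delta> where \<delta>: "0 < \<delta>" "\<And>s. 0 < s \<Longrightarrow> s < \<delta> \<Longrightarrow> c + \<kappa> < h s"
    unfolding eventually_at_right_field by auto
  from continuous_on_Icc_bounded[OF D'_cont]
  obtain L0 where L0: "0 \<le> L0" "\<And>s. s \<in> {0..R} \<Longrightarrow> \<bar>D' s\<bar> \<le> L0" by blast
  define L where "L = L0 + 1"
  have L: "0 < L" "\<And>s. s \<in> {0..R} \<Longrightarrow> D' s \<le> L" using L0 by (force simp: L_def)+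
  show ?thesis
  proof (rule phi_sharp[of "\<kappa> / L" \<delta>])
    fix s assume s: "0 < s" "s < \<delta>" "s < R"
    have sub: "{0..s} \<subseteq> {0..R}" using s by auto
    obtain t where t: "0 < t" "t < s" "z s - z 0 = (s - 0) * (h t - c - D t * g t / z t)"
      by (rule MVT_interior[OF s(1) continuous_on_subset[OF z_cont sub]]) (use z_deriv s in auto)
    have "D t * g t / z t \<le> 0"
      using D_pos[of t] g_neg[of t] z_pos[of t] t s by (intro divide_nonpos_pos mult_nonneg_nonpos) auto
    then have "\<kappa> \<le> h t - c - D t * g t / z t" using \<delta>(2)[of t] t s by linarith
    then have "s * \<kappa> \<le> z s" using t(3) s by (simp add: z_0)
    obtain r where r: "0 < r" "r < s" "D s - D 0 = (s - 0) * D' r"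
      by (rule MVT_interior[OF s(1) continuous_on_subset[OF D_cont sub]]) (use D_deriv_interior s in auto)
    have "D s \<le> s * L" using r L(2)[of r] s D0 by simp
    then have "\<kappa> / L * D s \<le> \<kappa> / L * (s * L)" using \<kappa> L by (intro mult_left_mono) auto
    also have "\<dots> = s * \<kappa>" using L by simp
    finally show "\<kappa> / L * D s \<le> z s" using \<open>s * \<kappa> \<le> z s\<close> by linarith
  qed (use \<kappa> L \<delta> in auto)
qed

end

section \<open>Uniqueness and strictness\<close>

context wave_data
begin

text \<open>\<open>E (\<phi> \<xi>)\<close> has the flux as its derivative and determines
  \<open>\<phi> \<xi>\<close>, since \<open>E\<close> is strictly increasing even where
  \<open>D\<close> vanishes at an end point.\<close>

lemma D_antiderivative:
  obtains E where "\<And>x. x \<in> {0..R} \<Longrightarrow> (E has_real_derivative D x) (at x)"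
    "\<And>x y. 0 \<le> x \<Longrightarrow> x < y \<Longrightarrow> y \<le> R \<Longrightarrow> E x < E y"
    "\<exists>L. \<forall>x\<in>{0..R}. \<forall>y\<in>{0..R}. \<bar>E x - E y\<bar> \<le> L * \<bar>x - y\<bar>"
proof -
  \<comment> \<open>Continuing \<open>D\<close> by constants gives \<open>E\<close> two-sided
    derivatives at 0 and \<open>R\<close>, so the chain rule applies to profiles taking these
    values.\<close>
  have "continuous_on UNIV (\<lambda>x. D (max 0 (min R x)))"
    by (rule continuous_on_compose2[OF D_cont]) (use R_pos in \<open>auto intro!: continuous_intros\<close>)
  then obtain E where "\<And>x. (E has_real_derivative D (max 0 (min R x))) (at x)"
    using antiderivative_on_open_interval[of UNIV] by auto
  from this have E: "(E has_real_derivative D x) (at x)" if "x \<in> {0..R}" for x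
    using that by (metis atLeastAtMost_iff max_absorb2 min.absorb2)
  from continuous_on_Icc_bounded[OF D_cont] obtain L
    where L: "\<And>s. s \<in> {0..R} \<Longrightarrow> \<bar>D s\<bar> \<le> L" by blast
  show ?thesis
  proof
    show "(E has_real_derivative D x) (at x)" if "x \<in> {0..R}" for x using E that .
    show "E x < E y" if xy: "0 \<le> x" "x < y" "y \<le> R" for x y
    proof -
      have "continuous_on {x..y} E"
        by (intro continuous_at_imp_continuous_on ballI DERIV_isCont[OF E]) (use xy in auto)
      then obtain t where t: "x < t" "t < y" "E y - E x = (y - x) * D t"
        by (rule MVT_interior[OF xy(2)]) (use E xy in auto)
      then have "0 < (y - x) * D t" using D_pos[of t] xy by simp
      with t show ?thesis by simp
    qed
    have "norm (E x - E y) \<le> L * norm (x - y)" if "x \<in> {0..R}" "y \<in> {0..R}" for x y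
      by (rule field_differentiable_bound[OF _ has_field_derivative_at_within[OF E] _ that])
         (use L in auto)
    then show "\<exists>L. \<forall>x\<in>{0..R}. \<forall>y\<in>{0..R}. \<bar>E x - E y\<bar> \<le> L * \<bar>x - y\<bar>"
      unfolding real_norm_def by blast
  qed
qed

text \<open>No continuity of \<open>deriv u\<close> is known, so primitives are compared instead:
  \<open>E (u t)\<close> and the integral of \<open>y\<close> differ by a constant, and their
  derivatives agree at every point of \<open>U\<close>.\<close>

lemma flux_eq_pointwise:
  assumes y: "continuous_on I y"
    and int: "\<forall>a b. a \<le> b \<longrightarrow> {a..b} \<subseteq> I \<longrightarrow>
       ((\<lambda>\<xi>. D (u \<xi>) * deriv u \<xi>) has_integral integral {a..b} y) {a..b}"
    and uR: "u ` I \<subseteq> {0..R}" and U: "open U" "U \<subseteq> I" "\<forall>\<xi>\<in>U. u differentiable (at \<xi>)"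
    and \<xi>: "\<xi> \<in> U"
  shows "D (u \<xi>) * deriv u \<xi> = y \<xi>"
proof -
  obtain e where e: "0 < e" "cball \<xi> e \<subseteq> U" using U(1) \<xi> open_contains_cball by blast
  define a b where "a = \<xi> - e" and "b = \<xi> + e"
  have ab: "a < \<xi>" "\<xi> < b" "{a..b} \<subseteq> U" using e by (auto simp: a_def b_def cball_eq_atLeastAtMost)
  obtain E where E: "\<And>x. x \<in> {0..R} \<Longrightarrow> (E has_real_derivative D x) (at x)"
    using D_antiderivative by metis
  have d: "((\<lambda>t. E (u t)) has_real_derivative D (u t) * deriv u t) (at t)" if t: "t \<in> U" for t
  proof -
    have "(E has_real_derivative D (u t)) (at (u t))" using uR U(2) t by (intro E) blast
    moreover have "(u has_real_derivative deriv u t) (at t)"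
      using U(3) t by (simp add: DERIV_deriv_iff_real_differentiable)
    ultimately show ?thesis by (rule DERIV_chain2)
  qed
  have eq: "E (u t) - E (u a) = integral {a..t} y" if t: "t \<in> {a..b}" for t
  proof -
    have sub: "{a..t} \<subseteq> U" using ab(3) t by auto
    have "((\<lambda>\<xi>. D (u \<xi>) * deriv u \<xi>) has_integral E (u t) - E (u a)) {a..t}"
    proof (rule fundamental_theorem_of_calculus)
      fix x assume "x \<in> {a..t}"
      then show "((\<lambda>t. E (u t)) has_vector_derivative D (u x) * deriv u x) (at x within {a..t})"
        using d[of x] sub has_field_derivative_at_within
        unfolding has_real_derivative_iff_has_vector_derivative[symmetric] by blast
    qed (use t in auto)
    moreover have "((\<lambda>\<xi>. D (u \<xi>) * deriv u \<xi>) has_integral integral {a..t} y) {a..t}"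
      using sub U(2) t by (intro int[rule_format]) auto
    ultimately show ?thesis by (rule has_integral_unique)
  qed
  have "continuous_on {a..b} y" using y ab(3) U(2) by (meson continuous_on_subset order_trans)
  from integral_has_real_derivative[OF this, of \<xi>]
  have "((\<lambda>t. integral {a..t} y) has_real_derivative y \<xi>) (at \<xi>)"
    using ab by (simp add: at_within_Icc_at)
  then have "((\<lambda>t. E (u t) - E (u a)) has_real_derivative y \<xi>) (at \<xi>)"
    by (rule has_field_derivative_transform_within_open[where S="{a<..<b}"]) (use ab eq in auto)
  moreover have "((\<lambda>t. E (u t) - E (u a)) has_real_derivative D (u \<xi>) * deriv u \<xi> - 0) (at \<xi>)"
    by (intro DERIV_diff d \<xi> DERIV_const)
  ultimately show ?thesis using DERIV_unique by force
qed

end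

context trajectory
begin

text \<open>Along a second profile with flux \<open>y\<close>, the difference \<open>d = y - z(\<phi>\<^sub>1)\<close> satisfies
  \<open>d' = (g/z) d\<close> with \<open>g < 0\<close>, so \<open>d\<^sup>2\<close> decreases; as \<open>d\<close> vanishes at the left end, \<open>d = 0\<close>.\<close>
lemma phi_unique:
  assumes sw: "semi_wavefront_from R f D g c 0 w1 \<phi>1"
    and cs: "classical_or_sharp R f h D g c {..<w1} \<phi>1"
  shows "shifted_restriction_of w1 \<phi>1 w \<phi>"
proof -
  let ?I = "{..<w1}"
  have tw: "tw_profile R f D g c ?I \<phi>1" and lim0: "(\<phi>1 \<longlongrightarrow> 0) at_bot"
    and nonconst: "\<not> \<phi>1 constant_on ?I"
    using sw by (auto simp: semi_wavefront_from_def)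
  have img: "\<phi>1 ` ?I \<subseteq> {0..R}" and cont: "continuous_on ?I \<phi>1"
    using tw by (auto simp: tw_profile_def)
  have nonneg: "0 \<le> \<phi>1 x" and leR: "\<phi>1 x \<le> R" if "x < w1" for x
    using img that by auto
  have isc: "isCont \<phi>1 x" if "x < w1" for x
    using cont that by (simp add: continuous_on_eq_continuous_at)
  have mono: "\<phi>1 x \<le> \<phi>1 x'" if "x \<le> x'" "x' < w1" for x x'
  proof -
    \<comment> \<open>A decreasing nonnegative function with limit 0 on the left is identically 0,
      contrary to non-constancy.\<close>
    have "\<not> antimono_on ?I \<phi>1"
    proof
      assume anti: "antimono_on ?I \<phi>1"
      have "\<phi>1 x = 0" if x: "x < w1" for x
      proof -
        have "eventually (\<lambda>t. t < x) at_bot" by (rule eventually_gt_at_bot)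
        then have "eventually (\<lambda>t. \<phi>1 x \<le> \<phi>1 t) at_bot"
          by eventually_elim (use anti x in \<open>auto simp: monotone_on_def\<close>)
        then have "\<phi>1 x \<le> 0" by (rule tendsto_lowerbound[OF lim0]) simp
        with nonneg[OF x] show ?thesis by simp
      qed
      then show False using nonconst by (auto simp: constant_on_def)
    qed
    then have "mono_on ?I \<phi>1" using sw by (auto simp: semi_wavefront_from_def)
    then show ?thesis using that by (auto simp: monotone_on_def)
  qed
  define J where "J = {x. x < w1 \<and> 0 < \<phi>1 x}"
  have J_up: "x' \<in> J" if "x \<in> J" "x \<le> x'" "x' < w1" for x x'
    using that mono[of x x'] by (auto simp: J_def)
  have J_eq: "J = ?I \<inter> \<phi>1 -` {0<..}" by (auto simp: J_def)
  have J_open: "open J"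
    unfolding J_eq by (rule continuous_open_preimage[OF cont]) auto
  have J_sub: "J \<subseteq> ?I" by (auto simp: J_def)
  have diff: "\<phi>1 differentiable (at x)" if x: "x \<in> J" for x
    using cs unfolding classical_or_sharp_def
  proof
    assume "classical_profile R f h D g c ?I \<phi>1"
    then show ?thesis using x J_sub by (auto simp: classical_profile_def classical_on_def)
  next
    assume "\<exists>l. sharp_profile_at R f h D g c l ?I \<phi>1"
    then obtain l \<xi>0 where l: "g l = 0" "\<xi>0 < w1" "\<phi>1 \<xi>0 = l" "classical_on h D g c (?I - {\<xi>0}) \<phi>1"
      by (auto simp: sharp_profile_at_def)
    \<comment> \<open>\<open>g\<close> vanishes in \<open>[0, R]\<close> only at 0, so the singular
      point of a sharp competitor lies outside \<open>J\<close>.\<close>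
    then have "l = 0" using g_neg[of l] nonneg[of \<xi>0] leR[of \<xi>0] by force
    then have "x \<noteq> \<xi>0" using l x by (auto simp: J_def)
    then show ?thesis using x J_sub l(4) by (auto simp: classical_on_def)
  qed
  obtain y where yc: "continuous_on ?I y"
    and yd: "\<And>\<xi>. \<xi> \<in> ?I \<Longrightarrow> ((\<lambda>\<xi>. y \<xi> - (f (\<phi>1 \<xi>) - c * \<phi>1 \<xi>)) has_real_derivative - g (\<phi>1 \<xi>)) (at \<xi>)"
    and yint: "\<And>a b. a \<le> b \<Longrightarrow> {a..b} \<subseteq> ?I \<Longrightarrow>
       ((\<lambda>\<xi>. D (\<phi>1 \<xi>) * deriv \<phi>1 \<xi>) has_integral integral {a..b} y) {a..b}"
    using tw_profile_flux[OF adm tw] by blast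
  have ycont: "isCont y x" if "x < w1" for x
    using yc that by (simp add: continuous_on_eq_continuous_at)
  have "\<forall>a b. a \<le> b \<longrightarrow> {a..b} \<subseteq> ?I \<longrightarrow>
       ((\<lambda>\<xi>. D (\<phi>1 \<xi>) * deriv \<phi>1 \<xi>) has_integral integral {a..b} y) {a..b}"
    using yint by blast
  note flux = flux_eq_pointwise[OF yc this img]
  have fluxJ: "D (\<phi>1 x) * deriv \<phi>1 x = y x" if "x \<in> J" for x
    by (rule flux[OF J_open J_sub _ that]) (use diff in blast)
  \<comment> \<open>A monotone profile that reaches \<open>R\<close> before \<open>w1\<close> would
    stay there with zero flux, and the balance law would force \<open>g R = 0\<close>.\<close>
  have lessR: "\<phi>1 x < R" if x: "x < w1" for x
  proof (rule ccontr)
    assume "\<not> \<phi>1 x < R"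
    then have eqR: "\<phi>1 t = R" if "x \<le> t" "t < w1" for t
      using leR[of t] mono[of x t] that by auto
    obtain t where t: "x < t" "t < w1" using x dense by blast
    have der: "(\<phi>1 has_real_derivative 0) (at s)" if s: "x < s" "s < w1" for s
    proof -
      have "((\<lambda>_. R) has_real_derivative 0) (at s)" by simp
      then show ?thesis
        by (rule has_field_derivative_transform_within_open[where S="{x<..<w1}"]) (use s eqR in auto)
    qed
    have y0: "y s = 0" if s: "x < s" "s < w1" for s
    proof -
      have "s \<in> J" using eqR[of s] s R_pos by (simp add: J_def)
      from fluxJ[OF this] show ?thesis using DERIV_imp_deriv[OF der[OF s]] by simp
    qed
    have "((\<lambda>_. - (f R - c * R)) has_real_derivative 0) (at t)" by simp
    then have "((\<lambda>\<xi>. y \<xi> - (f (\<phi>1 \<xi>) - c * \<phi>1 \<xi>)) has_real_derivative 0) (at t)"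
      by (rule has_field_derivative_transform_within_open[where S="{x<..<w1}"]) (use t eqR y0 in auto)
    then have "g (\<phi>1 t) = 0" using yd[of t] t DERIV_unique by fastforce
    then show False using g_neg[of R] R_pos eqR[of t] t by simp
  qed
  have J_range: "0 < \<phi>1 x" "\<phi>1 x < R" "x < w1" if "x \<in> J" for x
    using that lessR by (auto simp: J_def)
  have der: "(\<phi>1 has_real_derivative y x / D (\<phi>1 x)) (at x)" if x: "x \<in> J" for x
  proof -
    have "(\<phi>1 has_real_derivative deriv \<phi>1 x) (at x)"
      using diff[OF x] by (simp add: DERIV_deriv_iff_real_differentiable)
    moreover have "deriv \<phi>1 x = y x / D (\<phi>1 x)"
      using fluxJ[OF x] D_pos[OF J_range(1,2)[OF x]] by (simp add: field_simps)
    ultimately show ?thesis by simp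
  qed
  have yder: "(y has_real_derivative - g (\<phi>1 x) + (h (\<phi>1 x) - c) * (y x / D (\<phi>1 x))) (at x)"
    if x: "x \<in> J" for x
  proof -
    have "((\<lambda>\<xi>. (y \<xi> - (f (\<phi>1 \<xi>) - c * \<phi>1 \<xi>)) + F (\<phi>1 \<xi>)) has_real_derivative
        - g (\<phi>1 x) + (h (\<phi>1 x) - c) * (y x / D (\<phi>1 x))) (at x)"
      by (intro DERIV_add yd DERIV_chain2[OF F_deriv der[OF x]]) (use J_range[OF x] in auto)
    then show ?thesis by (simp add: F_def)
  qed
  have ynonneg: "0 \<le> y x" if x: "x \<in> J" for x
  proof -
    have "mono_on ?I \<phi>1" using mono by (intro mono_onI) auto
    moreover have "x \<in> interior ?I" using J_range(3)[OF x] by (simp add: interior_open)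
    ultimately have "0 \<le> y x / D (\<phi>1 x)" by (rule mono_on_imp_deriv_nonneg[OF _ der[OF x]])
    then show ?thesis using D_pos[of "\<phi>1 x"] J_range[OF x] by (simp add: zero_le_divide_iff)
  qed
  define d where "d x = y x - z (\<phi>1 x)" for x
  have dcont: "continuous_on ?I d"
    unfolding d_def by (intro continuous_intros yc continuous_on_compose2[OF z_cont cont img])
  have dder: "((\<lambda>x. (d x)\<^sup>2) has_real_derivative 2 * (d x)\<^sup>2 * (g (\<phi>1 x) / z (\<phi>1 x))) (at x)"
    if x: "x \<in> J" for x
  proof -
    note r = J_range(1,2)[OF x]
    have "(d has_real_derivative (- g (\<phi>1 x) + (h (\<phi>1 x) - c) * (y x / D (\<phi>1 x)))
        - (h (\<phi>1 x) - c - D (\<phi>1 x) * g (\<phi>1 x) / z (\<phi>1 x)) * (y x / D (\<phi>1 x))) (at x)"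
      unfolding d_def[abs_def] by (intro DERIV_diff yder[OF x] DERIV_chain2[OF z_deriv[OF r] der[OF x]])
    also have "(- g (\<phi>1 x) + (h (\<phi>1 x) - c) * (y x / D (\<phi>1 x)))
        - (h (\<phi>1 x) - c - D (\<phi>1 x) * g (\<phi>1 x) / z (\<phi>1 x)) * (y x / D (\<phi>1 x)) = d x * (g (\<phi>1 x) / z (\<phi>1 x))"
      using D_pos[OF r] z_pos[OF r] by (simp add: d_def field_simps)
    finally have "(d has_real_derivative d x * (g (\<phi>1 x) / z (\<phi>1 x))) (at x)" .
    from DERIV_power[OF this, of 2] show ?thesis by (simp add: power2_eq_square mult_ac)
  qed
  have ddecr: "(d b)\<^sup>2 \<le> (d a)\<^sup>2" if ab: "a < b" "b < w1" "\<And>x. a < x \<Longrightarrow> x < b \<Longrightarrow> x \<in> J" for a b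
  proof -
    have "continuous_on {a..b} (\<lambda>x. (d x)\<^sup>2)"
      using ab(2) by (intro continuous_intros continuous_on_subset[OF dcont]) auto
    then obtain x where x: "a < x" "x < b" "(d b)\<^sup>2 - (d a)\<^sup>2 = (b - a) * (2 * (d x)\<^sup>2 * (g (\<phi>1 x) / z (\<phi>1 x)))"
      by (rule MVT_interior[OF ab(1)]) (use dder ab(3) in auto)
    have r: "0 < \<phi>1 x" "\<phi>1 x < R" using J_range[OF ab(3)[OF x(1,2)]] by auto
    have "g (\<phi>1 x) / z (\<phi>1 x) \<le> 0"
      using g_neg[of "\<phi>1 x"] z_pos[OF r] r by (intro divide_nonpos_pos) auto
    then have "(b - a) * (2 * (d x)\<^sup>2 * (g (\<phi>1 x) / z (\<phi>1 x))) \<le> 0"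
      using ab(1) by (intro mult_nonneg_nonpos) auto
    with x(3) show ?thesis by linarith
  qed
  have d0: "d \<xi> = 0" if \<xi>: "\<xi> \<in> J" for \<xi>
  proof (cases "\<exists>x<w1. \<phi>1 x = 0")
    case True
    then obtain x where x: "x < w1" "\<phi>1 x = 0" by blast
    have \<xi>': "0 < \<phi>1 \<xi>" "\<xi> < w1" using \<xi> by (auto simp: J_def)
    have "x < \<xi>" using mono[of \<xi> x] x \<xi>' by (metis not_le)
    moreover have "continuous_on {x..\<xi>} \<phi>1" using cont \<xi>' by (auto intro: continuous_on_subset)
    ultimately obtain t where t: "x \<le> t" "t < \<xi>" "\<phi>1 t \<le> 0" "\<And>s. t < s \<Longrightarrow> s \<le> \<xi> \<Longrightarrow> 0 < \<phi>1 s"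
      using last_nonpos_point[of x \<xi> \<phi>1] x \<xi>' by auto
    have tw1: "t < w1" using t \<xi>' by simp
    have zero: "\<phi>1 s = 0" if "s \<le> t" for s
      using mono[OF that tw1] nonneg[of s] t(3) that tw1 by auto
    have yz: "y s = 0" if s: "s < t" for s
    proof -
      have dz: "(\<phi>1 has_real_derivative 0) (at r)" if "r < t" for r
      proof -
        have "((\<lambda>_. 0) has_real_derivative 0) (at r)" by simp
        then show ?thesis
          by (rule has_field_derivative_transform_within_open[where S="{..<t}"]) (use that zero in auto)
      qed
      have "D (\<phi>1 s) * deriv \<phi>1 s = y s"
        by (rule flux[of "{..<t}"]) (use s tw1 dz real_differentiable_def in auto)
      then show ?thesis using DERIV_imp_deriv[OF dz[OF s]] by simp
    qed
    \<comment> \<open>The flux vanishes to the left of \<open>t\<close>, where the profile is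
      constant. At \<open>t\<close> itself the profile may fail to be differentiable, but
      \<open>y\<close> is continuous.\<close>
    have "y t = 0"
      by (rule isCont_eq_if_eq_at_left[OF ycont[OF tw1], of "\<lambda>_. 0" "t - 1"]) (use yz in auto)
    then have "d t = 0" using zero[of t] by (simp add: d_def z_0)
    moreover have "(d \<xi>)\<^sup>2 \<le> (d t)\<^sup>2"
      by (rule ddecr[OF t(2) \<xi>'(2)]) (use t(4) \<xi>' in \<open>auto simp: J_def\<close>)
    ultimately show ?thesis by simp
  next
    case False
    then have J_all: "x \<in> J" if "x < w1" for x
      using nonneg[OF that] that by (force simp: J_def)
    have \<xi>1: "\<xi> < w1" using \<xi> J_sub by auto
    have small: "\<bar>d \<xi>\<bar> \<le> \<epsilon>" if \<epsilon>: "0 < \<epsilon>" for \<epsilon>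
    proof -
      have "((\<lambda>x. z (\<phi>1 x)) \<longlongrightarrow> z 0) at_bot"
      proof (rule filterlim_compose[OF continuous_on_Icc_at_rightD[OF z_cont R_pos]])
        have "eventually (\<lambda>x. x < w1) at_bot" by (rule eventually_gt_at_bot)
        then have "eventually (\<lambda>x. \<phi>1 x \<in> {0<..}) at_bot"
          by eventually_elim (use J_all in \<open>auto simp: J_def\<close>)
        moreover from this have "eventually (\<lambda>x. \<phi>1 x \<noteq> 0) at_bot" by eventually_elim auto
        ultimately show "filterlim \<phi>1 (at_right 0) at_bot"
          using lim0 by (simp add: filterlim_at eventually_conj_iff)
      qed
      then have "eventually (\<lambda>x. z (\<phi>1 x) < \<epsilon>) at_bot"
        using \<epsilon> z_0 order_tendstoD(2) by fastforce
      then obtain x0 where x0: "\<And>x. x \<le> x0 \<Longrightarrow> z (\<phi>1 x) < \<epsilon>"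
        by (auto simp: eventually_at_bot_linorder)
      define m where "m = min x0 (\<xi> - 1)"
      have m: "m < w1" "m < \<xi>" "m \<le> x0" using \<xi>1 by (auto simp: m_def)
      \<comment> \<open>For a positive profile the left end is at minus infinity, and the flux is
        not known in advance to tend to 0. Points with small flux suffice, since \<open>d\<close>
        squared decreases from each of them to \<open>\<xi>\<close>.\<close>
      have "\<exists>x\<le>m. y x < \<epsilon>"
      proof (rule ccontr)
        assume "\<not> (\<exists>x\<le>m. y x < \<epsilon>)"
        then have big: "\<epsilon> \<le> y x" if "x \<le> m" for x using that by force
        from continuous_on_Icc_bounded[OF D_cont]
        obtain B0 where B0: "\<And>s. s \<in> {0..R} \<Longrightarrow> \<bar>D s\<bar> \<le> B0" by blast
        define B where "B = \<bar>B0\<bar> + 1"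
        have B: "0 < B" "\<And>s. s \<in> {0..R} \<Longrightarrow> D s \<le> B" using B0 by (force simp: B_def)+
        \<comment> \<open>A flux of at least \<open>\<epsilon>\<close> means slope at least
          \<open>\<epsilon> / B\<close>; over the length \<open>l\<close> the profile would grow by
          \<open>R + 1\<close>, more than its range allows.\<close>
        define l where "l = (R + 1) * B / \<epsilon>"
        have l: "0 < l" using R_pos B \<epsilon> by (simp add: l_def)
        have "continuous_on {m - l..m} \<phi>1" using cont m by (auto intro: continuous_on_subset)
        then obtain t where t: "m - l < t" "t < m" "\<phi>1 m - \<phi>1 (m - l) = (m - (m - l)) * (y t / D (\<phi>1 t))"
        proof (rule MVT_interior[rotated])
          fix x assume "m - l < x" "x < m"
          then show "(\<phi>1 has_real_derivative y x / D (\<phi>1 x)) (at x)" using m by (intro der J_all) auto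
        qed (use l in auto)
        have r: "0 < \<phi>1 t" "\<phi>1 t < R" using J_range[OF J_all[of t]] t m by auto
        have "\<epsilon> / B \<le> y t / D (\<phi>1 t)"
          using big[of t] t B(2)[of "\<phi>1 t"] r D_pos[OF r] \<epsilon> by (intro frac_le) auto
        then have "l * (\<epsilon> / B) \<le> l * (y t / D (\<phi>1 t))" using l by (intro mult_left_mono) auto
        also have "l * (\<epsilon> / B) = R + 1" using B \<epsilon> by (simp add: l_def)
        finally show False using t(3) leR[of m] nonneg[of "m - l"] m l by auto
      qed
      then obtain x where x: "x \<le> m" "y x < \<epsilon>" by blast
      have xw: "x < w1" using x m by simp
      have "0 \<le> y x" by (rule ynonneg[OF J_all[OF xw]])
      moreover have "0 < z (\<phi>1 x)" using J_range[OF J_all[OF xw]] by (intro z_pos) auto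
      moreover have "z (\<phi>1 x) < \<epsilon>" using x0 x m by simp
      ultimately have "\<bar>d x\<bar> < \<epsilon>" using x(2) by (simp add: d_def abs_less_iff)
      moreover have "(d \<xi>)\<^sup>2 \<le> (d x)\<^sup>2"
        by (rule ddecr[OF _ \<xi>1]) (use x m \<xi>1 J_all in auto)
      then have "\<bar>d \<xi>\<bar> \<le> \<bar>d x\<bar>" by (simp add: abs_le_square_iff)
      ultimately show ?thesis by simp
    qed
    have "\<bar>d \<xi>\<bar> \<le> 0"
    proof (rule field_le_epsilon)
      fix e :: real assume "0 < e"
      from small[OF this] show "\<bar>d \<xi>\<bar> \<le> 0 + e" by simp
    qed
    then show ?thesis by simp
  qed
  have Tder: "((\<lambda>x. T (\<phi>1 x) - x) has_real_derivative 0) (at x)" if x: "x \<in> J" for x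
  proof -
    note r = J_range(1,2)[OF x]
    have "((\<lambda>x. T (\<phi>1 x) - x) has_real_derivative D (\<phi>1 x) / z (\<phi>1 x) * (y x / D (\<phi>1 x)) - 1) (at x)"
      by (intro DERIV_diff DERIV_chain2[OF T_deriv[OF r] der[OF x]] DERIV_ident)
    moreover have "y x = z (\<phi>1 x)" using d0[OF x] by (simp add: d_def)
    ultimately show ?thesis using D_pos[OF r] z_pos[OF r] by simp
  qed
  have "J \<noteq> {}"
  proof
    assume "J = {}"
    then have "\<phi>1 x = 0" if "x < w1" for x using nonneg[OF that] that by (force simp: J_def)
    then show False using nonconst by (auto simp: constant_on_def)
  qed
  then obtain j where j: "j \<in> J" by blast
  define s where "s = T (\<phi>1 j) - j"
  have Ts: "T (\<phi>1 x) = x + s" if x: "x \<in> J" for x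
  proof -
    have const: "T (\<phi>1 a) - a = T (\<phi>1 b) - b" if "a \<in> J" "b \<in> J" "a \<le> b" for a b
    proof (rule eq_if_zero_derivative[where B="\<lambda>_. 0", OF _ refl that(3)])
      fix t assume "a \<le> t" "t \<le> b"
      then have "t \<in> J" using J_up[of a t] that J_range(3)[OF that(2)] by auto
      then show "((\<lambda>x. T (\<phi>1 x) - x) has_real_derivative 0) (at t)" by (rule Tder)
    qed
    have "T (\<phi>1 x) - x = T (\<phi>1 j) - j"
    proof (cases "x \<le> j")
      case True
      then show ?thesis by (rule const[OF x j])
    next
      case False
      then have "j \<le> x" by simp
      then show ?thesis by (rule const[OF j x, symmetric])
    qed
    then show ?thesis by (simp add: s_def)
  qed
  have shift: "x + s < w" if "x < w1" for x
  proof -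
    have mx: "max x j \<in> J" using J_up[OF j, of "max x j"] that J_range(3)[OF j] by auto
    have "x + s \<le> T (\<phi>1 (max x j))" using Ts[OF mx] by simp
    also have "\<dots> < w" using J_range[OF mx] by (intro T_less_w) auto
    finally show ?thesis .
  qed
  show ?thesis
    unfolding shifted_restriction_of_def
  proof (intro exI[of _ s] conjI allI impI)
    show "w1 + s \<le> w"
    proof (rule dense_le)
      fix x assume "x < w1 + s"
      then show "x \<le> w" using shift[of "x - s"] by simp
    qed
    fix \<xi> assume \<xi>: "\<xi> < w1"
    show "\<phi>1 \<xi> = \<phi> (\<xi> + s)"
    proof (cases "\<xi> \<in> J")
      case True
      then show ?thesis using phi_T[OF J_range(1,2)[OF True]] Ts[OF True] by simp
    next
      case False
      then have z1: "\<phi>1 \<xi> = 0" using nonneg[OF \<xi>] \<xi> by (force simp: J_def)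
      show ?thesis
        using shift[OF \<xi>]
      proof (cases rule: phi_cases)
        case pos
        \<comment> \<open>A value that \<open>\<phi>1\<close> takes at some
          \<open>x > \<xi>\<close>. Then \<open>T v = x + s\<close> exceeds
          \<open>\<xi> + s = T (\<phi> (\<xi> + s))\<close>, although
          \<open>v \<le> \<phi> (\<xi> + s)\<close>.\<close>
        define v where "v = min (\<phi> (\<xi> + s)) (\<phi>1 j)"
        have v: "0 < v" "v \<le> \<phi> (\<xi> + s)" "v \<le> \<phi>1 j" "v < R"
          using pos J_range[OF j] by (auto simp: v_def)
        have "\<xi> \<le> j" using mono[of j \<xi>] \<xi> z1 J_range[OF j] by (metis linear not_le)
        moreover have "continuous_on {\<xi>..j} \<phi>1"
          using J_range(3)[OF j] by (intro continuous_on_subset[OF cont]) auto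
        ultimately obtain x where x: "\<xi> \<le> x" "x \<le> j" "\<phi>1 x = v"
          using IVT'[of \<phi>1 \<xi> v j] v z1 by auto
        have xJ: "x \<in> J" using x v J_range(3)[OF j] by (simp add: J_def)
        have "x \<noteq> \<xi>" using x v z1 by auto
        then have "\<xi> + s < x + s" using x by simp
        also have "x + s = T v" using Ts[OF xJ] x by simp
        also have "T v \<le> T (\<phi> (\<xi> + s))" using T_le_iff[of v "\<phi> (\<xi> + s)"] v pos by simp
        finally show ?thesis using pos by simp
      next
        case zero
        then show ?thesis using z1 by simp
      qed
    qed
  qed
qed

section \<open>Strictness: no continuation beyond the value \<open>R\<close>\<close>

lemma phi_tendsto_R: "(\<phi> \<longlongrightarrow> R) (at_left w)"
proof (rule order_tendstoI)
  fix a assume "a < R"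
  then obtain s where s: "max a 0 < s" "s < R" using R_pos dense[of "max a 0" R] by auto
  then have s0: "0 < s" by simp
  have "a < \<phi> x" if "T s < x" "x < w" for x
    using phi_le_iff[OF that(2) s0 s(2)] that s by auto
  then show "eventually (\<lambda>x. a < \<phi> x) (at_left w)"
    unfolding eventually_at_left_field using T_less_w[OF s0 s(2)] by blast
next
  fix a assume "R < a"
  then have "\<phi> x < a" if "x < w" for x using phi_less_R[OF that] by simp
  then show "eventually (\<lambda>x. \<phi> x < a) (at_left w)"
    unfolding eventually_at_left_field using lt_ex by blast
qed

text \<open>A global extension \<open>\<theta>\<close> attains the maximal value \<open>R\<close> at \<open>w\<close>, but its flux stays
  positive to the right of \<open>w\<close>, which forces it to exceed \<open>R\<close>. If \<open>z R = 0\<close>, positivity of the flux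
  comes from \<open>F s \<ge> F R\<close>, which holds because \<open>z - F\<close> is increasing.\<close>
lemma phi_strict: "strict_profile R f D g c {..<w} \<phi>"
  unfolding strict_profile_def
proof (intro conjI phi_tw_profile notI)
  show False if "{..<w} = UNIV" using that by blast
  assume "\<exists>\<theta>. tw_profile R f D g c UNIV \<theta> \<and> (\<forall>\<xi>\<in>{..<w}. \<theta> \<xi> = \<phi> \<xi>)"
  then obtain \<theta> where tw: "tw_profile R f D g c UNIV \<theta>" and ext: "\<And>\<xi>. \<xi> < w \<Longrightarrow> \<theta> \<xi> = \<phi> \<xi>" by auto
  have img: "\<theta> ` UNIV \<subseteq> {0..R}" and cont: "continuous_on UNIV \<theta>"
    and diffae: "AE \<xi> in lebesgue. \<theta> differentiable (at \<xi>)"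
    and ac: "locally_abs_cont_on {\<xi>. D (\<theta> \<xi>) \<noteq> 0} \<theta>"
    using tw by (auto simp: tw_profile_def)
  have nonneg: "0 \<le> \<theta> x" and leR: "\<theta> x \<le> R" for x using img by (auto simp: image_subset_iff)
  have isc: "isCont \<theta> x" for x using cont by (simp add: continuous_on_eq_continuous_at)
  obtain y where yc: "continuous_on UNIV y"
    and yd: "\<And>\<xi>. ((\<lambda>\<xi>. y \<xi> - F (\<theta> \<xi>)) has_real_derivative - g (\<theta> \<xi>)) (at \<xi>)"
    and yint: "\<And>a b. a \<le> b \<Longrightarrow>
       ((\<lambda>\<xi>. D (\<theta> \<xi>) * deriv \<theta> \<xi>) has_integral integral {a..b} y) {a..b}"
    using tw_profile_flux[OF adm tw] unfolding F_def by auto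
  have ycont: "isCont y x" for x using yc by (simp add: continuous_on_eq_continuous_at)
  have theta_w: "\<theta> w = R"
  proof (rule tendsto_unique)
    show "(\<theta> \<longlongrightarrow> \<theta> w) (at_left w)"
      using isc[of w] by (simp add: isCont_def filterlim_at_split)
    show "(\<theta> \<longlongrightarrow> R) (at_left w)"
      by (rule Lim_transform_eventually[OF phi_tendsto_R])
         (use ext lt_ex[of w] in \<open>auto simp: eventually_at_left_field\<close>)
  qed auto
  \<comment> \<open>To the right of \<open>T (R / 2)\<close> the profile is positive, hence
    differentiable, so its flux can be identified pointwise.\<close>
  have y_left: "y \<xi> = z (\<theta> \<xi>)" if \<xi>: "T (R / 2) < \<xi>" "\<xi> < w" for \<xi>
  proof -
    have der: "(\<theta> has_real_derivative z (\<phi> x) / D (\<phi> x)) (at x)" and pos: "0 < \<phi> x"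
      if x: "x \<in> {T (R / 2)<..<w}" for x
    proof -
      show "0 < \<phi> x" using phi_le_iff[of x "R / 2"] x R_pos by auto
      then have "(\<phi> has_real_derivative z (\<phi> x) / D (\<phi> x)) (at x)"
        using x by (intro phi_deriv_pos) auto
      then show "(\<theta> has_real_derivative z (\<phi> x) / D (\<phi> x)) (at x)"
        by (rule has_field_derivative_transform_within_open[where S="{..<w}"]) (use x ext in auto)
    qed
    have \<xi>': "\<xi> \<in> {T (R / 2)<..<w}" using \<xi> by simp
    have "D (\<theta> \<xi>) * deriv \<theta> \<xi> = y \<xi>"
    proof (rule flux_eq_pointwise[OF yc _ img, of "{T (R / 2)<..<w}"])
      show "\<forall>a b. a \<le> b \<longrightarrow> {a..b} \<subseteq> UNIV \<longrightarrow>
          ((\<lambda>\<xi>. D (\<theta> \<xi>) * deriv \<theta> \<xi>) has_integral integral {a..b} y) {a..b}"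
        by (intro allI impI yint)
      show "\<forall>\<xi>\<in>{T (R / 2)<..<w}. \<theta> differentiable (at \<xi>)"
        unfolding real_differentiable_def using der by blast
    qed (use \<xi>' in auto)
    moreover have "deriv \<theta> \<xi> = z (\<phi> \<xi>) / D (\<phi> \<xi>)" by (rule DERIV_imp_deriv[OF der[OF \<xi>']])
    ultimately show ?thesis
      using D_pos[OF pos[OF \<xi>'] phi_less_R[OF \<xi>(2)]] ext[OF \<xi>(2)] by simp
  qed
  have "continuous_on UNIV (\<lambda>x. z (\<theta> x))" by (rule continuous_on_compose2[OF z_cont cont img])
  then have "isCont (\<lambda>x. z (\<theta> x)) w" by (simp add: continuous_on_eq_continuous_at)
  then have "y w = z (\<theta> w)"
    by (rule isCont_eq_if_eq_at_left[OF ycont _ T_less_w[of "R / 2"]]) (use R_pos y_left in auto)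
  then have yw: "y w = z R" by (simp add: theta_w)
  obtain \<eta>1 where \<eta>1: "0 < \<eta>1" "\<And>x. \<bar>x - w\<bar> < \<eta>1 \<Longrightarrow> 0 < \<theta> x"
    using order_tendstoD(1)[OF isc[of w, unfolded isCont_def], of 0] theta_w R_pos
    unfolding eventually_at by (auto simp: dist_real_def) (metis R_pos theta_w)
  obtain \<eta> where \<eta>: "0 < \<eta>" "\<eta> \<le> \<eta>1" "\<And>x. w < x \<Longrightarrow> x < w + \<eta> \<Longrightarrow> 0 < y x"
  proof (cases "0 < z R")
    case True
    then have "eventually (\<lambda>x. 0 < y x) (at w)"
      using order_tendstoD(1)[OF ycont[of w, unfolded isCont_def], of 0] yw by simp
    then obtain \<eta>2 where \<eta>2: "0 < \<eta>2" "\<And>x. x \<noteq> w \<Longrightarrow> \<bar>x - w\<bar> < \<eta>2 \<Longrightarrow> 0 < y x"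
      unfolding eventually_at by (auto simp: dist_real_def)
    show ?thesis by (rule that[of "min \<eta>1 \<eta>2"]) (use \<eta>1 \<eta>2 in auto)
  next
    case False
    then have zR: "z R = 0" using z_R by simp
    have F_ge: "F R \<le> F s" if s: "0 < s" "s \<le> R" for s
    proof (cases "s = R")
      case False
      then have sR: "s < R" using s by simp
      have "continuous_on {s..R} (\<lambda>s. z s - F s)" using zF_cont s by (auto intro: continuous_on_subset)
      then obtain t where t: "s < t" "t < R" "(z R - F R) - (z s - F s) = (R - s) * (- D t * g t / z t)"
        by (rule MVT_interior[OF sR, where u'="\<lambda>t. - D t * g t / z t"]) (use zF_deriv s in auto)
      have "0 \<le> - D t * g t / z t"
        using D_pos[of t] g_neg[of t] z_pos[of t] t s by (intro divide_nonneg_pos mult_nonpos_nonpos) auto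
      then have "0 \<le> (R - s) * (- D t * g t / z t)" using sR by (intro mult_nonneg_nonneg) auto
      then show ?thesis using t(3) zR z_pos[OF s(1) sR] by linarith
    qed simp
    show ?thesis
    proof (rule that[OF \<eta>1(1) order_refl])
      fix x assume x: "w < x" "x < w + \<eta>1"
      \<comment> \<open>\<open>y - F(\<theta>)\<close> equals \<open>- F R\<close> at
        \<open>w\<close> and increases strictly because \<open>g < 0\<close> on positive states;
        with \<open>F (\<theta> x) \<ge> F R\<close> this yields \<open>y x > 0\<close>.\<close>
      have "continuous_on {w..x} (\<lambda>\<xi>. y \<xi> - F (\<theta> \<xi>))"
        using yd by (intro continuous_at_imp_continuous_on ballI) (auto intro: DERIV_isCont)
      then obtain t where t: "w < t" "t < x"
        "(y x - F (\<theta> x)) - (y w - F (\<theta> w)) = (x - w) * (- g (\<theta> t))"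
        by (rule MVT_interior[OF x(1)]) (use yd in auto)
      have "0 < \<theta> t" "0 < \<theta> x" using \<eta>1(2)[of t] \<eta>1(2)[of x] t x by auto
      then have "0 < - g (\<theta> t)" "F R \<le> F (\<theta> x)" using g_neg leR F_ge by auto
      moreover from this x have "0 < (x - w) * (- g (\<theta> t))" by (intro mult_pos_pos) auto
      ultimately show "0 < y x" using t(3) yw zR theta_w by simp
    qed
  qed
  have int_pos: "0 < integral {a..b} y" if ab: "a < b" "w < a" "b < w + \<eta>" for a b
  proof -
    have ycab: "continuous_on {a..b} y" using yc by (rule continuous_on_subset) simp
    then obtain x0 where x0: "x0 \<in> {a..b}" "\<And>x. x \<in> {a..b} \<Longrightarrow> y x0 \<le> y x"
      using continuous_attains_inf[of "{a..b}" y] ab by auto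
    have "0 < y x0 * (b - a)" using \<eta>(3)[of x0] x0(1) ab by (intro mult_pos_pos) auto
    also have "y x0 * (b - a) = integral {a..b} (\<lambda>_. y x0)" using ab by simp
    also have "\<dots> \<le> integral {a..b} y"
      by (intro integral_le integrable_continuous_real ycab continuous_on_const x0(2))
    finally show ?thesis .
  qed
  show False
  \<comment> \<open>If the extension stays at \<open>R\<close>, its flux integrates to 0,
    contradicting \<open>int_pos\<close>. Otherwise \<open>t\<close> is the last point before
    \<open>b\<close> with value \<open>R\<close>, and the positive flux would make
    \<open>E (\<theta> x)\<close> increase from \<open>E R\<close> to the smaller number
    \<open>E (\<theta> b)\<close>.\<close>
  proof (cases "\<exists>x. w < x \<and> x < w + \<eta> \<and> \<theta> x < R")
    case False
    then have eqR: "\<theta> x = R" if "w < x" "x < w + \<eta>" for x using leR[of x] that by force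
    define a b where "a = w + \<eta> / 3" and "b = w + \<eta> / 2"
    have ab: "a < b" "w < a" "b < w + \<eta>" using \<eta>(1) by (auto simp: a_def b_def)
    have "((\<lambda>\<xi>. D (\<theta> \<xi>) * deriv \<theta> \<xi>) has_integral 0) {a..b}"
    proof (rule has_integral_eq[where f="\<lambda>_. 0"])
      fix x assume x: "x \<in> {a..b}"
      have "((\<lambda>_. R) has_real_derivative 0) (at x)" by simp
      then have "(\<theta> has_real_derivative 0) (at x)"
        by (rule has_field_derivative_transform_within_open[where S="{w<..<w + \<eta>}"]) (use x ab eqR in auto)
      from DERIV_imp_deriv[OF this] show "0 = D (\<theta> x) * deriv \<theta> x" by simp
    qed simp
    moreover have "((\<lambda>\<xi>. D (\<theta> \<xi>) * deriv \<theta> \<xi>) has_integral integral {a..b} y) {a..b}"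
      using ab by (intro yint) auto
    ultimately have "integral {a..b} y = 0" by (rule has_integral_unique[symmetric])
    with int_pos[OF ab] show False by simp
  next
    case True
    then obtain b where b: "w < b" "b < w + \<eta>" "\<theta> b < R" by blast
    have "continuous_on {w..b} (\<lambda>x. R - \<theta> x)"
      using cont by (intro continuous_intros) (rule continuous_on_subset, auto)
    then obtain t where t: "w \<le> t" "t < b" "R - \<theta> t \<le> 0" "\<And>x. t < x \<Longrightarrow> x \<le> b \<Longrightarrow> 0 < R - \<theta> x"
      by (rule last_nonpos_point) (use b theta_w in auto)
    have tR: "\<theta> t = R" using t(3) leR[of t] by simp
    obtain E where E: "\<And>x. x \<in> {0..R} \<Longrightarrow> (E has_real_derivative D x) (at x)"
      "\<And>x y. 0 \<le> x \<Longrightarrow> x < y \<Longrightarrow> y \<le> R \<Longrightarrow> E x < E y"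
      "\<exists>L. \<forall>x\<in>{0..R}. \<forall>y\<in>{0..R}. \<bar>E x - E y\<bar> \<le> L * \<bar>x - y\<bar>"
      using D_antiderivative by blast
    obtain L where L: "\<And>x y. x \<in> {0..R} \<Longrightarrow> y \<in> {0..R} \<Longrightarrow> \<bar>E x - E y\<bar> \<le> L * \<bar>x - y\<bar>"
      using E(3) by blast
    have acE: "locally_abs_cont_on {\<xi>. D (\<theta> \<xi>) \<noteq> 0} (\<lambda>x. E (\<theta> x))"
    proof (rule locally_abs_cont_on_lipschitz_compose[OF ac _ L])
      show "\<theta> ` {\<xi>. D (\<theta> \<xi>) \<noteq> 0} \<subseteq> {0..R}" using img by auto
    qed
    \<comment> \<open>Starts at \<open>a > t\<close> because \<open>D R\<close> may be 0 and
      absolute continuity is known only where \<open>D(\<theta>)\<close> does not vanish; the limit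
      \<open>a\<close> to \<open>t\<close> follows by continuity.\<close>
    have "E (\<theta> a) \<le> E (\<theta> b)" if a: "t < a" "a < b" for a
    proof -
      have "((\<lambda>\<xi>. D (\<theta> \<xi>) * deriv \<theta> \<xi>) has_integral E (\<theta> b) - E (\<theta> a)) {a..b}"
      proof (rule fundamental_theorem_of_calculus_abs_cont[OF acE])
        show "{a..b} \<subseteq> {\<xi>. D (\<theta> \<xi>) \<noteq> 0}"
        proof safe
          fix x assume x: "x \<in> {a..b}" "D (\<theta> x) = 0"
          have "0 < \<theta> x" using \<eta>1(2)[of x] x a b t \<eta> by auto
          moreover have "\<theta> x < R" using t(4)[of x] x a by auto
          ultimately show False using D_pos x(2) by fastforce
        qed
        show "AE x in lebesgue. x \<in> {\<xi>. D (\<theta> \<xi>) \<noteq> 0} \<longrightarrow>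
            ((\<lambda>x. E (\<theta> x)) has_real_derivative D (\<theta> x) * deriv \<theta> x) (at x)"
          using diffae
        proof eventually_elim
          case (elim x)
          then have "(\<theta> has_real_derivative deriv \<theta> x) (at x)"
            by (simp add: DERIV_deriv_iff_real_differentiable)
          from DERIV_chain2[OF E(1) this] show ?case using nonneg leR by simp
        qed
      qed (use a in auto)
      moreover have "((\<lambda>\<xi>. D (\<theta> \<xi>) * deriv \<theta> \<xi>) has_integral integral {a..b} y) {a..b}"
        using a by (intro yint) auto
      ultimately have "E (\<theta> b) - E (\<theta> a) = integral {a..b} y" by (rule has_integral_unique)
      also have "\<dots> > 0" using a t b by (intro int_pos) auto
      finally show ?thesis by simp
    qed
    then have ev: "eventually (\<lambda>a. E (\<theta> a) \<le> E (\<theta> b)) (at_right t)"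
      unfolding eventually_at_right_field using t(2) by blast
    have "isCont E R" using E(1)[of R] R_pos by (intro DERIV_isCont) auto
    then have "isCont (\<lambda>a. E (\<theta> a)) t"
      using isc[of t] tR by (intro isCont_o2[of t \<theta> E]) auto
    then have "((\<lambda>a. E (\<theta> a)) \<longlongrightarrow> E R) (at_right t)"
      using tR by (simp add: isCont_def filterlim_at_split)
    then have "E R \<le> E (\<theta> b)" by (rule tendsto_upperbound[OF _ ev]) simp
    with E(2)[of "\<theta> b" R] b(3) nonneg[of b] show False by simp
  qed
qed

end

section \<open>Both behaviours at the critical speed when \<open>D'\<close> vanishes at 0\<close>

lemma critical_speed_classical_example:
  fixes R c :: real
  assumes "0 < R"
  shows "\<exists>f h D D' g w \<phi>.
    admissible_data R f h D D' g \<and> D 0 = 0 \<and> D' 0 = 0 \<and> c = h 0 \<and>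
    semi_wavefront_from R f D g c 0 w \<phi> \<and> classical_profile R f h D g c {..<w} \<phi>"
proof -
  \<comment> \<open>With \<open>h - c = 0\<close> the trajectory can be prescribed and the source
    computed from it as \<open>g = - z z' / D\<close>. Here \<open>z / D = s\<close> tends to
    0.\<close>
  define f h D D' g z where "f s = c * s" and "h s = c" and "D s = s^2" and "D' s = 2 * s"
    and "g s = - 3 * s^3" and "z s = s^3" for s :: real
  note defs = f_def[abs_def] h_def[abs_def] D_def[abs_def] D'_def[abs_def] g_def[abs_def] z_def[abs_def]
  have adm: "admissible_data R f h D D' g"
    unfolding admissible_data_def C1_with_deriv_def defs using assms
    by (auto intro!: derivative_eq_intros continuous_intros)
  interpret trajectory R c f h D D' g z
  proof
    show "(z has_real_derivative h s - c - D s * g s / z s) (at s)" if "0 < s" for s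
      unfolding defs using that
      by (auto intro!: derivative_eq_intros simp: field_simps power2_eq_square power3_eq_cube)
  qed (use assms adm in \<open>auto simp: defs intro!: continuous_intros\<close>)
  have "((\<lambda>s. s) \<longlongrightarrow> 0) (at_right (0::real))" by (rule tendsto_ident_at)
  then have "((\<lambda>s. z s / D s) \<longlongrightarrow> 0) (at_right 0)"
    by (rule Lim_transform_eventually)
       (auto simp: eventually_at_right_field defs power2_eq_square power3_eq_cube intro!: exI[of _ 1])
  from phi_classical[OF this] phi_semi_wavefront adm show ?thesis
    by (intro exI[of _ f] exI[of _ h] exI[of _ D] exI[of _ D'] exI[of _ g] exI[of _ w] exI[of _ \<phi>])
       (simp add: D_def D'_def h_def)
qed

lemma critical_speed_sharp_example:
  fixes R c :: real
  assumes "0 < R"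
  shows "\<exists>f h D D' g w \<phi>.
    admissible_data R f h D D' g \<and> D 0 = 0 \<and> D' 0 = 0 \<and> c = h 0 \<and>
    semi_wavefront_from R f D g c 0 w \<phi> \<and> sharp_profile_at R f h D g c 0 {..<w} \<phi>"
proof -
  \<comment> \<open>The same recipe with \<open>z = D\<close>: the slope \<open>z / D\<close> is
    constantly 1, so the front has a corner.\<close>
  define f h D D' g z where "f s = c * s" and "h s = c" and "D s = s^2" and "D' s = 2 * s"
    and "g s = - 2 * s" and "z s = s^2" for s :: real
  note defs = f_def[abs_def] h_def[abs_def] D_def[abs_def] D'_def[abs_def] g_def[abs_def] z_def[abs_def]
  have adm: "admissible_data R f h D D' g"
    unfolding admissible_data_def C1_with_deriv_def defs using assms
    by (auto intro!: derivative_eq_intros continuous_intros)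
  interpret trajectory R c f h D D' g z
  proof
    show "(z has_real_derivative h s - c - D s * g s / z s) (at s)" if "0 < s" for s
      unfolding defs using that by (auto intro!: derivative_eq_intros)
  qed (use assms adm in \<open>auto simp: defs intro!: continuous_intros\<close>)
  have "sharp_profile_at R f h D g c 0 {..<w} \<phi>"
    by (rule phi_sharp[of 1 1]) (auto simp: D_def z_def)
  with phi_semi_wavefront adm show ?thesis
    by (intro exI[of _ f] exI[of _ h] exI[of _ D] exI[of _ D'] exI[of _ g] exI[of _ w] exI[of _ \<phi>])
       (simp add: D_def D'_def h_def)
qed

theorem theorem2p2:
  fixes R c :: real and f h D D' g :: "real \<Rightarrow> real"
  assumes "admissible_data R f h D D' g"
  shows
    "(\<exists>w \<phi>.
        semi_wavefront_from R f D g c 0 w \<phi> \<and>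
        classical_or_sharp R f h D g c {..<w} \<phi> \<and>
        (\<forall>w1 \<phi>1. semi_wavefront_from R f D g c 0 w1 \<phi>1 \<and>
                  classical_or_sharp R f h D g c {..<w1} \<phi>1 \<longrightarrow>
                  shifted_restriction_of w1 \<phi>1 w \<phi>) \<and>
        strict_profile R f D g c {..<w} \<phi> \<and>
        (D 0 > 0 \<longrightarrow> classical_profile R f h D g c {..<w} \<phi>) \<and>
        (D 0 = 0 \<and> c < h 0 \<longrightarrow> sharp_profile_at R f h D g c 0 {..<w} \<phi>) \<and>
        (D 0 = 0 \<and> c > h 0 \<longrightarrow> classical_profile R f h D g c {..<w} \<phi>) \<and>
        (D 0 = 0 \<and> c = h 0 \<and> D' 0 > 0 \<longrightarrow> classical_profile R f h D g c {..<w} \<phi>)) \<and>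
     (\<exists>f h D D' g w \<phi>.
        admissible_data R f h D D' g \<and> D 0 = 0 \<and> D' 0 = 0 \<and> c = h 0 \<and>
        semi_wavefront_from R f D g c 0 w \<phi> \<and> classical_profile R f h D g c {..<w} \<phi>) \<and>
     (\<exists>f h D D' g w \<phi>.
        admissible_data R f h D D' g \<and> D 0 = 0 \<and> D' 0 = 0 \<and> c = h 0 \<and>
        semi_wavefront_from R f D g c 0 w \<phi> \<and> sharp_profile_at R f h D g c 0 {..<w} \<phi>)"
proof -
  interpret wave_data R c f h D D' g by unfold_locales (rule assms)
  obtain z where z: "continuous_on {0..R} z" "z 0 = 0" "0 \<le> z R"
    "\<And>s. 0 < s \<Longrightarrow> s < R \<Longrightarrow> 0 < z s"
    "\<And>s. 0 < s \<Longrightarrow> s < R \<Longrightarrow> (z has_real_derivative h s - c - D s * g s / z s) (at s)"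
    using trajectory_exists by blast
  interpret trajectory R c f h D D' g z by unfold_locales (use z in auto)
  have "classical_profile R f h D g c {..<w} \<phi>" if "D 0 > 0"
    using that by (intro phi_classical slope_tendsto_0_nondegenerate)
  moreover have "classical_profile R f h D g c {..<w} \<phi>" if "D 0 = 0" "c > h 0"
  proof (intro phi_classical slope_tendsto_0_degenerate that(1))
    fix \<epsilon> :: real assume "0 < \<epsilon>"
    \<comment> \<open>\<open>D' 0\<close> may be 0 here; the strict inequality comes from
      \<open>c > h 0\<close>.\<close>
    then have "0 \<le> \<epsilon> * D' 0" using D'_0_nonneg[OF that(1)] by simp
    with that(2) show "h 0 - c < \<epsilon> * D' 0" by linarith
  qed
  moreover have "classical_profile R f h D g c {..<w} \<phi>" if "D 0 = 0" "c = h 0" "D' 0 > 0"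
    using that by (intro phi_classical slope_tendsto_0_degenerate) auto
  ultimately have "semi_wavefront_from R f D g c 0 w \<phi> \<and>
        classical_or_sharp R f h D g c {..<w} \<phi> \<and>
        (\<forall>w1 \<phi>1. semi_wavefront_from R f D g c 0 w1 \<phi>1 \<and>
                  classical_or_sharp R f h D g c {..<w1} \<phi>1 \<longrightarrow>
                  shifted_restriction_of w1 \<phi>1 w \<phi>) \<and>
        strict_profile R f D g c {..<w} \<phi> \<and>
        (D 0 > 0 \<longrightarrow> classical_profile R f h D g c {..<w} \<phi>) \<and>
        (D 0 = 0 \<and> c < h 0 \<longrightarrow> sharp_profile_at R f h D g c 0 {..<w} \<phi>) \<and>
        (D 0 = 0 \<and> c > h 0 \<longrightarrow> classical_profile R f h D g c {..<w} \<phi>) \<and>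
        (D 0 = 0 \<and> c = h 0 \<and> D' 0 > 0 \<longrightarrow> classical_profile R f h D g c {..<w} \<phi>)"
    using phi_semi_wavefront phi_classical_or_sharp phi_unique phi_strict phi_sharp_subcritical by blast
  then show ?thesis
    using critical_speed_classical_example[OF R_pos] critical_speed_sharp_example[OF R_pos] by blast
qed

end
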